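(* Let $0\le t<T$ and $k\ge2$. Let $\xi_\tau\in\tilde H_2(\rho,[t,T])$, let $\Phi(t_1,\ldots,t_{k-1})$ be a continuous nonrandom function on the closed domain $\{(t_1,\ldots,t_{k-1}):\ t\le t_{k-1}\le\ldots\le t_1\le T\}$, and suppose that there is a constant $K$ with $|\rho_\tau|\le K<\infty$ with probability 1 for all $\tau\in[t,T]$. For each $l=1,\ldots,k$ let either $M^{(l)}_\tau=M_\tau$ or $M^{(l)}_\tau=\tau$ for $\tau\in[t,T]$. Then the stochastic integral $\hat S[\xi,\Phi]^{(k)}_{T,t}$ exists and $$S[\xi,\Phi]^{(k)}_{T,t}=\hat S[\xi,\Phi]^{(k)}_{T,t}\quad\text{with probability }1.$$
   Context: Setting. $(\Omega,\mathrm{F},\mathsf{P})$ is a complete probability space, $\mathsf{M}$ denotes expectation, $\{\mathrm{F}_\tau,\ \tau\in[0,T]\}$ is a nondecreasing family of $\sigma$-algebras in $\mathrm{F}$, and $M_\tau$, $\tau\in[0,T]$, is a martingale with respect to it ($M_\tau$ is $\mathrm{F}_\tau$-measurable and $\mathsf{M}\{|M_\tau|\}<\infty$). It is assumed that there is a stochastic process $\rho_\tau$, $\tau\in[0,T]$, $\mathrm{F}_\tau$-measurable for each $\tau$ and nonnegative with probability 1, such that for $0\le t<s\le T$ $$\mathsf{M}\{(M_s-M_t)^2\,|\,\mathrm{F}_t\}=\mathsf{M}\Big\{\int_t^s\rho_\tau d\tau\,\Big|\,\mathrm{F}_t\Big\}\quad\text{with probability }1.$$ $H_2(\rho,[t,T])$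 is the class of processes $\varphi_\tau$, $\tau\in[t,T]$, $\mathrm{F}_\tau$-measurable for each $\tau$, with $\mathsf{M}\{\int_t^T\varphi_\tau^2\rho_\tau d\tau\}<\infty$. $\tilde H_2(\rho,[t,T])$ is the class of $\varphi\in H_2(\rho,[t,T])$ that are mean-square continuous on $[t,T]$. For $\varphi\in H_2(\rho,[t,T])$ the integral $\int_t^T\varphi_\tau dM_\tau$ is the mean-square limit of $\sum_j\varphi^{(N)}(\tau_j)(M_{\tau_{j+1}}-M_{\tau_j})$ along partitions of $[t,T]$ with mesh tending to $0$, for any step processes $\varphi^{(N)}\in H_2(\rho,[t,T])$ (constant in time on each $[\tau_j,\tau_{j+1})$) with $\int_t^T\mathsf{M}\{|\varphi^{(N)}_\tau-\varphi_\tau|^2\rho_\tau\}d\tau\to0$. Integrals with respect to $d\tau$ are mean-square integrals with respect to time. Iterated integral. $$S[\xi,\Phi]^{(k)}_{T,t}=\int_t^T\ldots\int_t^{t_{k-1}}\Phi(t_1,\ldots,t_{k-1})\,\xi_{t_k}\,dM^{(k)}_{t_k}\ldots dM^{(1)}_{t_1},$$ the innermost integration being over $t_k\in[t,t_{k-1}]$ and the outermost over $t_1\in[t,T]$. Reversed-order integrals. All limits $\mathrm{l.i.m.}$ are mean-square limits along partitions $s=\tau_0<\tau_1<\ldots<\tau_N=T$ of the relevant interval $[s,T]$ with mesh tending to $0$ as $N\to\infty$, and $\Delta M^{(i)}_{\tau_l}=M^{(i)}_{\tau_{l+1}}-M^{(i)}_{\tau_l}$. Define $$A_1(s;t_2,\ldots,t_{k-1})=\int_s^T\Phi(t_1,t_2,\ldots,t_{k-1})\,dM^{(1)}_{t_1},$$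 and for $2\le r\le k-1$, $$A_r(s;t_{r+1},\ldots,t_{k-1})=\underset{N\to\infty}{\mathrm{l.i.m.}}\ \sum_{l=0}^{N-1}\Delta M^{(r)}_{\tau_l}\,A_{r-1}(\tau_{l+1};\tau_l,t_{r+1},\ldots,t_{k-1})$$ with $\{\tau_l\}$ partitioning $[s,T]$ and $t\le t_{k-1}\le\ldots\le t_{r+1}\le s\le T$; $A_r(s;t_{r+1},\ldots,t_{k-1})$ is the meaning of $\int_s^TdM^{(r)}_{t_r}\int_{t_r}^TdM^{(r-1)}_{t_{r-1}}\ldots\int_{t_2}^T\Phi(t_1,\ldots,t_{k-1})dM^{(1)}_{t_1}$. Then $$\hat S[\xi,\Phi]^{(k)}_{T,t}=\int_t^T\xi_{t_k}dM^{(k)}_{t_k}\ldots\int_{t_3}^TdM^{(2)}_{t_2}\int_{t_2}^T\Phi(t_1,\ldots,t_{k-1})dM^{(1)}_{t_1}:=\underset{N\to\infty}{\mathrm{l.i.m.}}\ \sum_{l=0}^{N-1}\xi_{\tau_l}\,\Delta M^{(k)}_{\tau_l}\,A_{k-1}(\tau_{l+1})$$ with $\{\tau_l\}$ partitioning $[t,T]$. Existence of $\hat S$ means existence of the mean-square limits in this definition. *)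

theory Defs
  imports "HOL-Probability.Probability"
begin

section \<open>The martingale and its characteristic\<close>

text \<open>
  Processes are indexed by all reals, but only their values on \<open>[0,T]\<close> are constrained or used.
  A measure \<open>F \<tau>\<close> serves only as a \<open>\<sigma>\<close>-algebra: its space and its measurable sets.
\<close>

definition martingale_on ::
  "'a measure \<Rightarrow> (real \<Rightarrow> 'a measure) \<Rightarrow> (real \<Rightarrow> 'a \<Rightarrow> real) \<Rightarrow> real set \<Rightarrow> bool" where
  "martingale_on P F M I \<longleftrightarrow>
     (\<forall>s\<in>I. M s \<in> borel_measurable (F s) \<and> integrable P (M s)) \<and>
     (\<forall>s\<in>I. \<forall>u\<in>I. s \<le> u \<longrightarrow> (AE \<omega> in P. real_cond_exp P (F s) (M u) \<omega> = M s \<omega>))"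

text \<open>
  Both sides of \<open>rho_char\<close> are conditional expectations of nonnegative variables, so they are taken
  with values in \<open>[0,\<infinity>]\<close> and no integrability has to be presupposed; \<open>ennreal\<close> changes \<open>\<rho>\<close> only
  where it is negative, which happens with probability 0. Joint measurability of \<open>\<rho>\<close>
  is what gives a meaning to the time integral of \<open>\<rho>\<close> as a random variable.
\<close>

locale martingale_setting = prob_space P + complete_measure P
  for P :: "'a measure" +
  fixes F :: "real \<Rightarrow> 'a measure" and M \<rho> :: "real \<Rightarrow> 'a \<Rightarrow> real" and T :: real
  assumes subalg: "\<And>\<tau>. \<tau> \<in> {0..T} \<Longrightarrow> subalgebra P (F \<tau>)"
    and filtered: "\<And>s u. 0 \<le> s \<Longrightarrow> s \<le> u \<Longrightarrow> u \<le> T \<Longrightarrow> sets (F s) \<subseteq> sets (F u)"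
    and mart: "martingale_on P F M {0..T}"
    and rho_adapted: "\<And>\<tau>. \<tau> \<in> {0..T} \<Longrightarrow> \<rho> \<tau> \<in> borel_measurable (F \<tau>)"
    and rho_measurable:
      "(\<lambda>(\<tau>, \<omega>). \<rho> \<tau> \<omega>) \<in> borel_measurable (restrict_space borel {0..T} \<Otimes>\<^sub>M P)"
    and rho_nonneg: "\<And>\<tau>. \<tau> \<in> {0..T} \<Longrightarrow> AE \<omega> in P. 0 \<le> \<rho> \<tau> \<omega>"
    and rho_char: "\<And>s u. 0 \<le> s \<Longrightarrow> s < u \<Longrightarrow> u \<le> T \<Longrightarrow>
      AE \<omega> in P. nn_cond_exp P (F s) (\<lambda>\<omega>. ennreal ((M u \<omega> - M s \<omega>)\<^sup>2)) \<omega>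
               = nn_cond_exp P (F s) (\<lambda>\<omega>. \<integral>\<^sup>+\<tau>\<in>{s..u}. ennreal (\<rho> \<tau> \<omega>) \<partial>lborel) \<omega>"


section \<open>Mean-square convergence and continuity\<close>

definition square_int :: "'a measure \<Rightarrow> ('a \<Rightarrow> real) \<Rightarrow> bool" where
  "square_int P X \<longleftrightarrow> X \<in> borel_measurable P \<and> integrable P (\<lambda>\<omega>. (X \<omega>)\<^sup>2)"

definition ms_lim :: "'a measure \<Rightarrow> (nat \<Rightarrow> 'a \<Rightarrow> real) \<Rightarrow> ('a \<Rightarrow> real) \<Rightarrow> bool" where
  "ms_lim P X Y \<longleftrightarrow> (\<forall>n. square_int P (X n)) \<and> square_int P Y \<and>
     (\<lambda>n. \<integral>\<omega>. (X n \<omega> - Y \<omega>)\<^sup>2 \<partial>P) \<longlonglongrightarrow> 0"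

definition ms_continuous_on :: "'a measure \<Rightarrow> real set \<Rightarrow> (real \<Rightarrow> 'a \<Rightarrow> real) \<Rightarrow> bool" where
  "ms_continuous_on P I \<phi> \<longleftrightarrow> (\<forall>u\<in>I. square_int P (\<phi> u)) \<and>
     (\<forall>u\<in>I. ((\<lambda>v. \<integral>\<omega>. (\<phi> v \<omega> - \<phi> u \<omega>)\<^sup>2 \<partial>P) \<longlongrightarrow> 0) (at u within I))"


section \<open>Integrands\<close>

text \<open>
  \<open>weighted_norm2\<close> is the expectation of the time integral of \<open>\<phi>\<^sup>2 \<rho>\<close> over \<open>[a,b]\<close>. The expectation is
  written inside (Tonelli): the quantity then makes sense without a joint measurability
  assumption on \<open>\<phi>\<close> and does not depend on the version of each \<open>\<phi>\<^sub>u\<close>.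
\<close>

definition weighted_norm2 ::
  "'a measure \<Rightarrow> (real \<Rightarrow> 'a \<Rightarrow> real) \<Rightarrow> real \<Rightarrow> real \<Rightarrow> (real \<Rightarrow> 'a \<Rightarrow> real) \<Rightarrow> ennreal" where
  "weighted_norm2 P \<rho> a b \<phi> =
     (\<integral>\<^sup>+u\<in>{a..b}. (\<integral>\<^sup>+\<omega>. ennreal ((\<phi> u \<omega>)\<^sup>2 * \<rho> u \<omega>) \<partial>P) \<partial>lborel)"

definition H2 ::
  "'a measure \<Rightarrow> (real \<Rightarrow> 'a measure) \<Rightarrow> (real \<Rightarrow> 'a \<Rightarrow> real) \<Rightarrow> real \<Rightarrow> real \<Rightarrow>
   (real \<Rightarrow> 'a \<Rightarrow> real) set" where
  "H2 P F \<rho> a b =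
     {\<phi>. (\<forall>u\<in>{a..b}. \<phi> u \<in> borel_measurable (F u)) \<and> weighted_norm2 P \<rho> a b \<phi> < \<infinity>}"

definition H2_cont ::
  "'a measure \<Rightarrow> (real \<Rightarrow> 'a measure) \<Rightarrow> (real \<Rightarrow> 'a \<Rightarrow> real) \<Rightarrow> real \<Rightarrow> real \<Rightarrow>
   (real \<Rightarrow> 'a \<Rightarrow> real) set" where
  "H2_cont P F \<rho> a b = {\<phi> \<in> H2 P F \<rho> a b. ms_continuous_on P {a..b} \<phi>}"


section \<open>Partitions\<close>

text \<open>
  In a partition of \<open>[a,b]\<close> with points \<open>\<tau> 0 < \<dots> < \<tau> N\<close> the number \<open>N\<close> is 0 exactly when \<open>a = b\<close>;
  integrals over one-point intervals are therefore limits of empty sums.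
\<close>

definition is_partition :: "real \<Rightarrow> real \<Rightarrow> nat \<Rightarrow> (nat \<Rightarrow> real) \<Rightarrow> bool" where
  "is_partition a b N \<tau> \<longleftrightarrow> \<tau> 0 = a \<and> \<tau> N = b \<and> (\<forall>l<N. \<tau> l < \<tau> (Suc l))"

definition mesh :: "nat \<Rightarrow> (nat \<Rightarrow> real) \<Rightarrow> real" where
  "mesh N \<tau> = Max (insert 0 ((\<lambda>l. \<tau> (Suc l) - \<tau> l) ` {..<N}))"

definition partition_seq ::
  "real \<Rightarrow> real \<Rightarrow> (nat \<Rightarrow> nat) \<Rightarrow> (nat \<Rightarrow> nat \<Rightarrow> real) \<Rightarrow> bool" where
  "partition_seq a b N \<tau> \<longleftrightarrow>
     (\<forall>n. is_partition a b (N n) (\<tau> n)) \<and> (\<lambda>n. mesh (N n) (\<tau> n)) \<longlonglongrightarrow> 0"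

definition step_on :: "nat \<Rightarrow> (nat \<Rightarrow> real) \<Rightarrow> (real \<Rightarrow> 'a \<Rightarrow> real) \<Rightarrow> bool" where
  "step_on N \<tau> \<psi> \<longleftrightarrow> (\<forall>l<N. \<forall>u\<in>{\<tau> l..<\<tau> (Suc l)}. \<psi> u = \<psi> (\<tau> l))"


section \<open>Single integrals\<close>

text \<open>
  Integrals are determined only up to null sets, so they are relations: the last argument
  is a version of the integral.
\<close>

definition step_approx ::
  "'a measure \<Rightarrow> (real \<Rightarrow> 'a measure) \<Rightarrow> (real \<Rightarrow> 'a \<Rightarrow> real) \<Rightarrow> real \<Rightarrow> real \<Rightarrow>
   (real \<Rightarrow> 'a \<Rightarrow> real) \<Rightarrow> (nat \<Rightarrow> nat) \<Rightarrow> (nat \<Rightarrow> nat \<Rightarrow> real) \<Rightarrow>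
   (nat \<Rightarrow> real \<Rightarrow> 'a \<Rightarrow> real) \<Rightarrow> bool" where
  "step_approx P F \<rho> a b \<phi> N \<tau> \<psi> \<longleftrightarrow> partition_seq a b N \<tau> \<and>
     (\<forall>n. \<psi> n \<in> H2 P F \<rho> a b \<and> step_on (N n) (\<tau> n) (\<psi> n)) \<and>
     (\<lambda>n. weighted_norm2 P \<rho> a b (\<lambda>u \<omega>. \<psi> n u \<omega> - \<phi> u \<omega>)) \<longlonglongrightarrow> 0"

text \<open>The existence of some approximating sequence is demanded so that the condition on all of
  them cannot hold vacuously.\<close>

definition has_mart_integral ::
  "'a measure \<Rightarrow> (real \<Rightarrow> 'a measure) \<Rightarrow> (real \<Rightarrow> 'a \<Rightarrow> real) \<Rightarrow> (real \<Rightarrow> 'a \<Rightarrow> real) \<Rightarrow>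
   real \<Rightarrow> real \<Rightarrow> (real \<Rightarrow> 'a \<Rightarrow> real) \<Rightarrow> ('a \<Rightarrow> real) \<Rightarrow> bool" where
  "has_mart_integral P F M \<rho> a b \<phi> X \<longleftrightarrow> \<phi> \<in> H2 P F \<rho> a b \<and>
     (\<exists>N \<tau> \<psi>. step_approx P F \<rho> a b \<phi> N \<tau> \<psi>) \<and>
     (\<forall>N \<tau> \<psi>. step_approx P F \<rho> a b \<phi> N \<tau> \<psi> \<longrightarrow>
        ms_lim P (\<lambda>n \<omega>. \<Sum>l<N n. \<psi> n (\<tau> n l) \<omega> * (M (\<tau> n (Suc l)) \<omega> - M (\<tau> n l) \<omega>)) X)"

definition has_time_integral ::
  "'a measure \<Rightarrow> real \<Rightarrow> real \<Rightarrow> (real \<Rightarrow> 'a \<Rightarrow> real) \<Rightarrow> ('a \<Rightarrow> real) \<Rightarrow> bool" where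
  "has_time_integral P a b \<phi> X \<longleftrightarrow>
     (\<forall>N \<tau> \<sigma>. partition_seq a b N \<tau> \<and> (\<forall>n. \<forall>l<N n. \<sigma> n l \<in> {\<tau> n l..\<tau> n (Suc l)}) \<longrightarrow>
        ms_lim P (\<lambda>n \<omega>. \<Sum>l<N n. \<phi> (\<sigma> n l) \<omega> * (\<tau> n (Suc l) - \<tau> n l)) X)"

text \<open>The flag \<open>m\<close> selects the integrator: \<open>M\<close> if it is true, time if it is false.\<close>

definition integrator :: "(real \<Rightarrow> 'a \<Rightarrow> real) \<Rightarrow> bool \<Rightarrow> real \<Rightarrow> 'a \<Rightarrow> real" where
  "integrator M m = (if m then M else (\<lambda>\<tau> \<omega>. \<tau>))"

definition has_int ::
  "'a measure \<Rightarrow> (real \<Rightarrow> 'a measure) \<Rightarrow> (real \<Rightarrow> 'a \<Rightarrow> real) \<Rightarrow> (real \<Rightarrow> 'a \<Rightarrow> real) \<Rightarrow>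
   bool \<Rightarrow> real \<Rightarrow> real \<Rightarrow> (real \<Rightarrow> 'a \<Rightarrow> real) \<Rightarrow> ('a \<Rightarrow> real) \<Rightarrow> bool" where
  "has_int P F M \<rho> m a b \<phi> X \<longleftrightarrow>
     (if m then has_mart_integral P F M \<rho> a b \<phi> X else has_time_integral P a b \<phi> X)"


section \<open>Iterated integrals in the two orders\<close>

text \<open>
  A tuple of time variables with indices in \<open>J\<close> is a function that is \<open>undefined\<close> outside \<open>J\<close>,
  so the product topology on \<open>nat \<Rightarrow> real\<close> induces on \<open>ordered_times a b {1..<k}\<close> the usual
  topology of a subset of \<open>(k-1)\<close>-dimensional space. Larger indices carry smaller times.
\<close>

definition ordered_times :: "real \<Rightarrow> real \<Rightarrow> nat set \<Rightarrow> (nat \<Rightarrow> real) set" where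
  "ordered_times a b J =
     {x \<in> J \<rightarrow>\<^sub>E {a..b}. \<forall>i\<in>J. \<forall>j\<in>J. i \<le> j \<longrightarrow> x j \<le> x i}"

text \<open>
  \<open>V r x\<close> is the integral over \<open>t\<^sub>k, \<dots>, t\<^sub>r\<close> for fixed outer variables \<open>x = (t\<^sub>1, \<dots>, t\<^bsub>r-1\<^esub>)\<close>. Its
  upper limit is \<open>t\<^bsub>r-1\<^esub>\<close>, or \<open>T\<close> if \<open>r = 1\<close>. That the integrands with respect to \<open>M\<close> are in
  \<open>H2\<close> forces the choice of adapted versions of the inner integrals.
\<close>

definition has_iterated_integral ::
  "'a measure \<Rightarrow> (real \<Rightarrow> 'a measure) \<Rightarrow> (real \<Rightarrow> 'a \<Rightarrow> real) \<Rightarrow> (real \<Rightarrow> 'a \<Rightarrow> real) \<Rightarrow>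
   (nat \<Rightarrow> bool) \<Rightarrow> nat \<Rightarrow> real \<Rightarrow> real \<Rightarrow> (real \<Rightarrow> 'a \<Rightarrow> real) \<Rightarrow> ((nat \<Rightarrow> real) \<Rightarrow> real) \<Rightarrow>
   ('a \<Rightarrow> real) \<Rightarrow> bool" where
  "has_iterated_integral P F M \<rho> m k t T \<xi> \<Phi> S \<longleftrightarrow>
     (\<exists>V :: nat \<Rightarrow> (nat \<Rightarrow> real) \<Rightarrow> 'a \<Rightarrow> real.
        (\<forall>x\<in>ordered_times t T {1..<k}.
           has_int P F M \<rho> (m k) t (x (k - 1)) (\<lambda>u \<omega>. \<Phi> x * \<xi> u \<omega>) (V k x)) \<and>
        (\<forall>r\<in>{1..<k}. \<forall>x\<in>ordered_times t T {1..<r}.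
           has_int P F M \<rho> (m r) t (if r = 1 then T else x (r - 1))
             (\<lambda>u. V (Suc r) (x(r := u))) (V r x)) \<and>
        S = V 1 (\<lambda>_. undefined))"

text \<open>
  \<open>A r s x\<close> is the reversed-order integral over \<open>t\<^sub>1, \<dots>, t\<^sub>r\<close> with lower limit \<open>s\<close> for fixed
  \<open>x = (t\<^bsub>r+1\<^esub>, \<dots>, t\<^bsub>k-1\<^esub>)\<close> with entries in \<open>[t,s]\<close>.
\<close>

definition has_reversed_integral ::
  "'a measure \<Rightarrow> (real \<Rightarrow> 'a measure) \<Rightarrow> (real \<Rightarrow> 'a \<Rightarrow> real) \<Rightarrow> (real \<Rightarrow> 'a \<Rightarrow> real) \<Rightarrow>
   (nat \<Rightarrow> bool) \<Rightarrow> nat \<Rightarrow> real \<Rightarrow> real \<Rightarrow> (real \<Rightarrow> 'a \<Rightarrow> real) \<Rightarrow> ((nat \<Rightarrow> real) \<Rightarrow> real) \<Rightarrow>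
   ('a \<Rightarrow> real) \<Rightarrow> bool" where
  "has_reversed_integral P F M \<rho> m k t T \<xi> \<Phi> S \<longleftrightarrow>
     (\<exists>A :: nat \<Rightarrow> real \<Rightarrow> (nat \<Rightarrow> real) \<Rightarrow> 'a \<Rightarrow> real.
        (\<forall>s\<in>{t..T}. \<forall>x\<in>ordered_times t s {2..<k}.
           has_int P F M \<rho> (m 1) s T (\<lambda>u \<omega>. \<Phi> (x(1 := u))) (A 1 s x)) \<and>
        (\<forall>r\<in>{2..<k}. \<forall>s\<in>{t..T}. \<forall>x\<in>ordered_times t s {Suc r..<k}.
           \<forall>N \<tau>. partition_seq s T N \<tau> \<longrightarrow>
             ms_lim P
               (\<lambda>n \<omega>. \<Sum>l<N n.
                  (integrator M (m r) (\<tau> n (Suc l)) \<omega> - integrator M (m r) (\<tau> n l) \<omega>) *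
                  A (r - 1) (\<tau> n (Suc l)) (x(r := \<tau> n l)) \<omega>)
               (A r s x)) \<and>
        (\<forall>N \<tau>. partition_seq t T N \<tau> \<longrightarrow>
           ms_lim P
             (\<lambda>n \<omega>. \<Sum>l<N n. \<xi> (\<tau> n l) \<omega> *
                (integrator M (m k) (\<tau> n (Suc l)) \<omega> - integrator M (m k) (\<tau> n l) \<omega>) *
                A (k - 1) (\<tau> n (Suc l)) (\<lambda>_. undefined) \<omega>)
             S))"

end

theory Submission
  imports Defs
begin

text \<open>
  All integrals are compared with forward iterated integrals of \<open>L\<^sup>2\<close>-continuous adapted integrands. On
  \<open>[t,T]\<close> the bound on \<open>\<rho>\<close> gives, for both integrators, \<open>E(\<Sum> Y\<^sub>p \<Delta>\<^sub>p)\<^sup>2 \<le> C (b - a) sup E Y\<^sub>p\<^sup>2\<close> for adapted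
  \<open>Y\<close>, so integrals are limits of left Riemann sums, uniformly in parameters.

  For the reversed sum over a partition with consecutive points \<open>p < q\<close>, the factor \<open>\<xi>\<^sub>p \<Delta>\<^sub>p\<close> is known at time \<open>q\<close> and
  can therefore be moved inside the remaining integrals, which start at \<open>q\<close>. The reversed sum thus becomes
  a forward iterated integral in which the innermost integral has been replaced by its Riemann sum,
  extended over the partition intervals that end before the next outer variable. This replacement is
  uniformly small in \<open>L\<^sup>2\<close>, and each further integration multiplies the error by at most a constant.
  Applied with \<open>\<xi> = 1\<close> the same argument identifies the intermediate reversed integrals.
\<close>

section \<open>The space of square integrable random variables\<close>

text \<open>A product of two square integrable variables need not be square integrable, and the
  reversed sums consist of such products: \<open>\<xi>\<close> times an increment times an inner
  integral, with no fourth moments assumed. They are square integrable all the same, because each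
  product equals, almost surely, an iterated integral whose integrand already contains the factor.
  This is why the lower limit of the inner integral has to be the right end point of the cell: there
  the factor is adapted.

  Integrals are relations that fix a variable only up to a null set, and uncountably many inner
  integrals occur at once. So one adapted version of each is chosen, uniformly continuous in mean
  square in its parameters, and every other admissible choice is shown to agree with it almost
  surely for fixed parameters. An \<open>H2\<close> step process need not be square integrable at
  its individual times, so agreement with the defined martingale integral rests on an isometry with
  values in \<open>[0,\<infinity>]\<close> and not on the L2 bound alone.\<close>

definition l2norm :: "'a measure \<Rightarrow> ('a \<Rightarrow> real) \<Rightarrow> real" where
  "l2norm P X = sqrt (\<integral>w. (X w)\<^sup>2 \<partial>P)"

abbreviation l2dist :: "'a measure \<Rightarrow> ('a \<Rightarrow> real) \<Rightarrow> ('a \<Rightarrow> real) \<Rightarrow> real" where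
  "l2dist P X Y \<equiv> l2norm P (\<lambda>w. X w - Y w)"

lemma square_int_borel: "square_int P X \<Longrightarrow> X \<in> borel_measurable P"
  by (simp add: square_int_def)

lemma square_int_mult:
  assumes "square_int P X" "square_int P Y"
  shows "integrable P (\<lambda>w. X w * Y w)"
proof (rule Bochner_Integration.integrable_bound)
  show "integrable P (\<lambda>w. (X w)\<^sup>2 + (Y w)\<^sup>2)"
    using assms by (auto simp: square_int_def)
  show "(\<lambda>w. X w * Y w) \<in> borel_measurable P"
    using assms by (auto simp: square_int_def)
  have "\<bar>x * y\<bar> \<le> x\<^sup>2 + y\<^sup>2" for x y :: real
  proof -
    have "0 \<le> (\<bar>x\<bar> - \<bar>y\<bar>)\<^sup>2" by simp
    then have "2 * (\<bar>x\<bar> * \<bar>y\<bar>) \<le> x\<^sup>2 + y\<^sup>2" by (simp add: power2_diff)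
    moreover have "0 \<le> \<bar>x\<bar> * \<bar>y\<bar>" by simp
    ultimately show ?thesis unfolding abs_mult by linarith
  qed
  then show "AE w in P. norm (X w * Y w) \<le> norm ((X w)\<^sup>2 + (Y w)\<^sup>2)"
    by (intro AE_I2) (metis abs_ge_self order_trans real_norm_def)
qed

lemma square_int_add:
  assumes "square_int P X" "square_int P Y"
  shows "square_int P (\<lambda>w. X w + Y w)"
  unfolding square_int_def
proof
  show "(\<lambda>w. X w + Y w) \<in> borel_measurable P"
    using assms by (auto simp: square_int_def)
  have "(\<lambda>w. (X w + Y w)\<^sup>2) = (\<lambda>w. (X w)\<^sup>2 + (Y w)\<^sup>2 + 2 * (X w * Y w))"
    by (auto simp: power2_sum)
  then show "integrable P (\<lambda>w. (X w + Y w)\<^sup>2)"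
    using assms square_int_mult[OF assms] by (auto simp: square_int_def)
qed

lemma square_int_cmult:
  assumes "square_int P X" shows "square_int P (\<lambda>w. c * X w)"
  using assms by (auto simp: square_int_def power_mult_distrib)

lemma square_int_multc:
  assumes "square_int P X" shows "square_int P (\<lambda>w. X w * c)"
  using square_int_cmult[OF assms, of c] by (simp add: mult.commute)

lemma square_int_diff:
  assumes "square_int P X" "square_int P Y"
  shows "square_int P (\<lambda>w. X w - Y w)"
  using square_int_add[OF assms(1) square_int_cmult[OF assms(2), of "-1"]] by simp

lemma square_int_zero: "square_int P (\<lambda>w. 0)"
  by (simp add: square_int_def)

lemma square_int_sum:
  assumes "\<And>i. i \<in> I \<Longrightarrow> square_int P (X i)"
  shows "square_int P (\<lambda>w. \<Sum>i\<in>I. X i w)"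
  using assms by (induct I rule: infinite_finite_induct) (auto intro: square_int_zero square_int_add)

lemma square_int_cong_AE:
  assumes "square_int P X" "AE w in P. X w = Y w" "Y \<in> borel_measurable P"
  shows "square_int P Y"
  unfolding square_int_def
proof
  have "integrable P (\<lambda>w. (Y w)\<^sup>2) \<longleftrightarrow> integrable P (\<lambda>w. (X w)\<^sup>2)"
    using assms by (intro integrable_cong_AE) (auto simp: square_int_def)
  then show "integrable P (\<lambda>w. (Y w)\<^sup>2)" using assms by (simp add: square_int_def)
qed fact

lemma l2norm_nonneg: "0 \<le> l2norm P X"
  by (simp add: l2norm_def)

lemma l2norm_sq: "(l2norm P X)\<^sup>2 = (\<integral>w. (X w)\<^sup>2 \<partial>P)"
  by (simp add: l2norm_def)

lemma l2norm_cong_AE: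
  assumes "AE w in P. X w = Y w" "X \<in> borel_measurable P" "Y \<in> borel_measurable P"
  shows "l2norm P X = l2norm P Y"
  unfolding l2norm_def using assms by (intro arg_cong[where f = sqrt] integral_cong_AE) auto

lemma l2norm_cmult: "l2norm P (\<lambda>w. c * X w) = \<bar>c\<bar> * l2norm P X"
  by (simp add: l2norm_def power_mult_distrib real_sqrt_mult)

lemma l2norm_minus_commute: "l2dist P X Y = l2dist P Y X"
  by (simp add: l2norm_def power2_commute)

lemma l2norm_zero: "l2norm P (\<lambda>w. 0) = 0"
  by (simp add: l2norm_def)

lemma l2norm_eq_0:
  assumes "square_int P X" "l2norm P X = 0"
  shows "AE w in P. X w = 0"
proof -
  have "(\<integral>w. (X w)\<^sup>2 \<partial>P) = 0" using assms(2) by (simp add: l2norm_def)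
  then have "AE w in P. (X w)\<^sup>2 = 0"
    using integral_nonneg_eq_0_iff_AE[where M = P and f = "\<lambda>w. (X w)\<^sup>2"] assms(1) by (simp add: square_int_def)
  then show ?thesis by simp
qed

lemma l2norm_triangle:
  assumes X: "square_int P X" and Y: "square_int P Y"
  shows "l2norm P (\<lambda>w. X w + Y w) \<le> l2norm P X + l2norm P Y"
proof -
  note [measurable] = square_int_borel[OF X] square_int_borel[OF Y]
  consider "l2norm P X = 0" | "l2norm P Y = 0" | "l2norm P X > 0" "l2norm P Y > 0"
    using l2norm_nonneg[of P X] l2norm_nonneg[of P Y] by linarith
  then show ?thesis
  proof cases
    case 1
    then have "AE w in P. X w + Y w = Y w" using l2norm_eq_0[OF X] by auto
    then show ?thesis using 1 l2norm_cong_AE[of "\<lambda>w. X w + Y w" Y P] by simp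
  next
    case 2
    then have "AE w in P. X w + Y w = X w" using l2norm_eq_0[OF Y] by auto
    then show ?thesis using 2 l2norm_cong_AE[of "\<lambda>w. X w + Y w" X P] by simp
  next
    case 3
    define a b where "a = l2norm P X" and "b = l2norm P Y"
    have ab: "a > 0" "b > 0" using 3 by (auto simp: a_def b_def)
    \<comment> \<open>weighted AM-GM, with the weight chosen so that the right-hand side integrates to \<open>(a + b)\<^sup>2\<close>\<close>
    have *: "(x + y)\<^sup>2 \<le> (1 + b / a) * x\<^sup>2 + (1 + a / b) * y\<^sup>2" for x y :: real
    proof -
      have "(1 + b / a) * x\<^sup>2 + (1 + a / b) * y\<^sup>2 - (x + y)\<^sup>2 = (b * x - a * y)\<^sup>2 / (a * b)"
        using ab by (simp add: field_simps power2_eq_square)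
      moreover have "\<dots> \<ge> 0" using ab by simp
      ultimately show ?thesis by linarith
    qed
    have "(\<integral>w. (X w + Y w)\<^sup>2 \<partial>P) \<le> (\<integral>w. (1 + b / a) * (X w)\<^sup>2 + (1 + a / b) * (Y w)\<^sup>2 \<partial>P)"
      using X Y square_int_add[OF X Y] *
      by (intro integral_mono) (auto simp: square_int_def)
    also have "\<dots> = (1 + b / a) * a\<^sup>2 + (1 + a / b) * b\<^sup>2"
      using X Y by (simp add: a_def b_def l2norm_sq square_int_def)
    also have "\<dots> = (a + b)\<^sup>2" using ab by (simp add: field_simps power2_eq_square)
    finally show ?thesis
      using ab unfolding a_def[symmetric] b_def[symmetric] by (auto simp: l2norm_def intro: real_le_lsqrt)
  qed
qed

lemma l2norm_triangle_diff:
  assumes X: "square_int P X" and Y: "square_int P Y" and Z: "square_int P Z"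
  shows "l2dist P X Z \<le> l2dist P X Y + l2dist P Y Z"
  using l2norm_triangle[OF square_int_diff[OF X Y] square_int_diff[OF Y Z]] by simp

lemma l2norm_triangle_minus:
  assumes X: "square_int P X" and Y: "square_int P Y"
  shows "l2dist P X Y \<le> l2norm P X + l2norm P Y"
  using l2norm_triangle_diff[OF X square_int_zero Y] l2norm_minus_commute[of P "\<lambda>_. 0" Y] by simp

lemma l2norm_le_add_diff:
  assumes X: "square_int P X" and Y: "square_int P Y"
  shows "l2norm P X \<le> l2norm P Y + l2dist P X Y"
  using l2norm_triangle[OF Y square_int_diff[OF X Y]] by simp

lemma l2norm_sum:
  assumes "finite I" "\<And>i. i \<in> I \<Longrightarrow> square_int P (X i)"
  shows "l2norm P (\<lambda>w. \<Sum>i\<in>I. X i w) \<le> (\<Sum>i\<in>I. l2norm P (X i))"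
  using assms
proof (induct I)
  case (insert i I)
  have "l2norm P (\<lambda>w. X i w + (\<Sum>i\<in>I. X i w)) \<le> l2norm P (X i) + l2norm P (\<lambda>w. \<Sum>i\<in>I. X i w)"
    using insert by (intro l2norm_triangle square_int_sum) auto
  with insert show ?case by force
qed (simp add: l2norm_zero)

lemma l2norm_eqI:
  assumes X: "square_int P X" and Y: "square_int P Y"
    and "\<And>e. e > 0 \<Longrightarrow> l2dist P X Y \<le> e"
  shows "AE w in P. X w = Y w"
proof -
  have "l2dist P X Y \<le> 0"
    using assms(3) by (rule dense_ge)
  then have "l2dist P X Y = 0" using l2norm_nonneg[of P "\<lambda>w. X w - Y w"] by linarith
  from l2norm_eq_0[OF square_int_diff[OF X Y] this] show ?thesis by simp
qed

section \<open>Mean-square limits: uniqueness, perturbation, factors and completeness\<close>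

lemma ms_lim_iff:
  "ms_lim P X Y \<longleftrightarrow> (\<forall>n. square_int P (X n)) \<and> square_int P Y \<and>
     (\<lambda>n. l2dist P (X n) Y) \<longlonglongrightarrow> 0"
proof -
  have "(\<lambda>n. \<integral>w. (X n w - Y w)\<^sup>2 \<partial>P) \<longlonglongrightarrow> 0 \<longleftrightarrow>
    (\<lambda>n. l2dist P (X n) Y) \<longlonglongrightarrow> 0" (is "?A \<longleftrightarrow> ?B")
  proof
    assume ?A
    from tendsto_real_sqrt[OF this] show ?B by (simp add: l2norm_def)
  next
    assume ?B
    from tendsto_power[OF this, of 2] show ?A by (simp add: l2norm_sq)
  qed
  then show ?thesis by (simp add: ms_lim_def)
qed

text \<open>Sums formed from two versions of the same inner integrals agree only almost surely, for
  each \<open>n\<close> separately. That is enough, since mean-square distances do not see null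
  sets.\<close>

lemma ms_lim_unique:
  assumes X: "ms_lim P X Y" and X': "ms_lim P X' Y'"
    and ae: "\<And>n. AE w in P. X n w = X' n w"
  shows "AE w in P. Y w = Y' w"
proof -
  note A = X[unfolded ms_lim_iff] X'[unfolded ms_lim_iff]
  have eq: "l2dist P (X' n) Y' = l2dist P (X n) Y'" for n
  proof (rule l2norm_cong_AE)
    show "AE w in P. X' n w - Y' w = X n w - Y' w" using ae[of n] by auto
  qed (use A in \<open>auto intro!: square_int_borel[OF square_int_diff]\<close>)
  have "(\<lambda>n. l2dist P (X n) Y + l2dist P (X' n) Y') \<longlonglongrightarrow> 0 + 0"
    using A by (intro tendsto_add) auto
  moreover have "l2dist P Y Y' \<le>
      l2dist P (X n) Y + l2dist P (X' n) Y'" for n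
    unfolding eq l2norm_minus_commute[of P "X n" Y] using A by (intro l2norm_triangle_diff) auto
  ultimately have "l2dist P Y Y' \<le> 0 + 0"
    by (intro LIMSEQ_le_const) auto
  then show ?thesis using A
    by (intro l2norm_eqI) auto
qed

lemma ms_lim_approx:
  assumes X: "ms_lim P X Y" and sq: "\<And>n. square_int P (X' n)"
    and d: "(\<lambda>n. l2dist P (X' n) (X n)) \<longlonglongrightarrow> 0"
  shows "ms_lim P X' Y"
  unfolding ms_lim_iff
proof (intro conjI allI sq)
  note A = X[unfolded ms_lim_iff]
  show "square_int P Y" using A by blast
  have "(\<lambda>n. l2dist P (X' n) (X n) + l2dist P (X n) Y) \<longlonglongrightarrow> 0 + 0"
    using d A by (intro tendsto_add) auto
  then have L: "(\<lambda>n. l2dist P (X' n) (X n) + l2dist P (X n) Y) \<longlonglongrightarrow> 0"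
    by simp
  have "\<And>n. l2dist P (X' n) Y
      \<le> l2dist P (X' n) (X n) + l2dist P (X n) Y"
    using A sq by (auto intro!: l2norm_triangle_diff)
  then show "(\<lambda>n. l2dist P (X' n) Y) \<longlonglongrightarrow> 0"
    by (intro real_tendsto_sandwich[OF _ _ tendsto_const L]) (auto simp: l2norm_nonneg)
qed

context prob_space
begin

lemma square_int_const: "square_int M (\<lambda>w. c)"
  by (simp add: square_int_def)

lemma square_int_imp_integrable:
  assumes "square_int M X" shows "integrable M X"
  using square_int_mult[OF assms square_int_const[of 1]] by simp

text \<open>The variance of \<open>\<bar>X\<bar>\<close> is nonnegative.\<close>

lemma l1norm_le_l2norm:
  assumes "square_int M X" shows "(\<integral>w. \<bar>X w\<bar> \<partial>M) \<le> l2norm M X"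
proof -
  have "(expectation (\<lambda>w. \<bar>X w\<bar>))\<^sup>2 \<le> expectation (\<lambda>w. \<bar>X w\<bar>\<^sup>2)"
  proof -
    have "0 \<le> variance (\<lambda>w. \<bar>X w\<bar>)" by (rule variance_positive)
    also have "\<dots> = expectation (\<lambda>w. \<bar>X w\<bar>\<^sup>2) - (expectation (\<lambda>w. \<bar>X w\<bar>))\<^sup>2"
      using square_int_imp_integrable[OF assms] assms by (intro variance_eq) (auto simp: square_int_def)
    finally show ?thesis by simp
  qed
  then show ?thesis by (auto simp: l2norm_def intro: real_le_rsqrt)
qed

lemma l2_tendsto_L1:
  assumes "ms_lim M X Y"
  shows "(\<lambda>n. \<integral>w. norm (X n w - Y w) \<partial>M) \<longlonglongrightarrow> 0"
proof (rule real_tendsto_sandwich[OF _ _ tendsto_const])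
  note A = assms[unfolded ms_lim_iff]
  show "(\<lambda>n. l2dist M (X n) Y) \<longlonglongrightarrow> 0" using A by blast
  show "\<forall>\<^sub>F n in sequentially. (\<integral>w. norm (X n w - Y w) \<partial>M) \<le> l2dist M (X n) Y"
    using A l1norm_le_l2norm[OF square_int_diff] by simp
qed simp

text \<open>\<open>Z\<close> need not be bounded: both limits are almost sure limits along a common subsequence.\<close>

lemma ms_lim_mult_factor:
  assumes X: "ms_lim M X Y" and ZX: "ms_lim M ZX W"
    and ae: "\<And>n. AE w in M. ZX n w = Z w * X n w"
  shows "AE w in M. W w = Z w * Y w"
proof -
  have int: "integrable M (X n)" "integrable M Y" "integrable M (ZX n)" "integrable M W" for n
    using X ZX by (auto simp: ms_lim_iff intro: square_int_imp_integrable)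
  have [measurable]: "X n \<in> borel_measurable M" "Y \<in> borel_measurable M" for n
    using int by auto
  obtain r where r: "strict_mono r" "AE w in M. (\<lambda>n. X (r n) w - Y w) \<longlonglongrightarrow> 0"
    using tendsto_L1_AE_subseq[OF _ l2_tendsto_L1[OF X]] int by auto
  have ZXr: "ms_lim M (\<lambda>n. ZX (r n)) W"
    using ZX LIMSEQ_subseq_LIMSEQ[OF _ r(1), of "\<lambda>n. l2dist M (ZX n) W"]
    by (simp add: ms_lim_iff o_def)
  obtain r' where r': "strict_mono r'" "AE w in M. (\<lambda>n. ZX (r (r' n)) w - W w) \<longlonglongrightarrow> 0"
    using tendsto_L1_AE_subseq[OF _ l2_tendsto_L1[OF ZXr]] int by auto
  have "AE w in M. \<forall>n. ZX n w = Z w * X n w" using ae by (simp add: AE_all_countable)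
  with r(2) r'(2) show ?thesis
  proof eventually_elim
    case (elim w)
    have "(\<lambda>n. X (r (r' n)) w) \<longlonglongrightarrow> Y w"
      using LIMSEQ_subseq_LIMSEQ[OF LIM_zero_cancel[OF elim(1)] r'(1)] by (simp add: o_def)
    then have "(\<lambda>n. ZX (r (r' n)) w) \<longlonglongrightarrow> Z w * Y w"
      using elim(3) by (auto intro: tendsto_mult)
    then show ?case using LIM_zero_cancel[OF elim(2)] LIMSEQ_unique by blast
  qed
qed

text \<open>Riesz-Fischer. An L2 Cauchy sequence is L1 Cauchy, so a subsequence converges almost
  surely, and Fatou's lemma along that subsequence turns the Cauchy bound into a bound on the
  distance to the limit. The sub-\<sigma>-algebra \<open>G\<close> is carried along because
  integrals have to be adapted.\<close>

lemma square_int_complete: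
  assumes sub: "subalgebra M G" and G: "\<And>n. X n \<in> borel_measurable G"
    and sq: "\<And>n. square_int M (X n)"
    and C: "\<And>e. e > 0 \<Longrightarrow> \<exists>N. \<forall>i\<ge>N. \<forall>j\<ge>N. l2dist M (X i) (X j) < e"
  shows "\<exists>Y. Y \<in> borel_measurable G \<and> ms_lim M X Y"
proof -
  note [measurable] = square_int_borel[OF sq]
  have C1: "\<exists>N. \<forall>i\<ge>N. \<forall>j\<ge>N. (\<integral>w. norm (X i w - X j w) \<partial>M) < e" if "e > 0" for e
  proof -
    obtain N where N: "\<And>i j. i \<ge> N \<Longrightarrow> j \<ge> N \<Longrightarrow> l2dist M (X i) (X j) < e"
      using C[of e] \<open>e > 0\<close> by blast
    have "(\<integral>w. norm (X i w - X j w) \<partial>M) < e" if "i \<ge> N" "j \<ge> N" for i j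
      using l1norm_le_l2norm[OF square_int_diff[OF sq[of i] sq[of j]]] N[OF that] by simp
    then show ?thesis by blast
  qed
  obtain r where r: "strict_mono r" "AE w in M. Cauchy (\<lambda>i. X (r i) w)"
    using cauchy_L1_AE_cauchy_subseq[OF square_int_imp_integrable[OF sq] C1] by blast
  \<comment> \<open>Taking \<open>lim\<close> at every point, also where the subsequence diverges,
    yields a limit measurable for \<open>G\<close> itself and not only up to null sets.\<close>
  define Y where "Y = (\<lambda>w. lim (\<lambda>i. X (r i) w))"
  have YG: "Y \<in> borel_measurable G" unfolding Y_def using G by (intro borel_measurable_lim_metric) auto
  then have [measurable]: "Y \<in> borel_measurable M" using measurable_from_subalg[OF sub] by blast
  have ae: "AE w in M. (\<lambda>i. X (r i) w) \<longlonglongrightarrow> Y w"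
    using r(2) by eventually_elim (simp add: Y_def Cauchy_convergent_iff convergent_LIMSEQ_iff)
  have bd: "\<exists>N. \<forall>n\<ge>N. (\<integral>\<^sup>+w. ennreal ((X n w - Y w)\<^sup>2) \<partial>M) \<le> ennreal (e\<^sup>2)" if "e > 0" for e
  proof -
    obtain N where N: "\<And>i j. i \<ge> N \<Longrightarrow> j \<ge> N \<Longrightarrow> l2dist M (X i) (X j) < e"
      using C[of e] \<open>e > 0\<close> by blast
    have "(\<integral>\<^sup>+w. ennreal ((X n w - Y w)\<^sup>2) \<partial>M) \<le> ennreal (e\<^sup>2)" if n: "n \<ge> N" for n
    proof -
      have "(\<integral>\<^sup>+w. ennreal ((X n w - Y w)\<^sup>2) \<partial>M)
        = (\<integral>\<^sup>+w. liminf (\<lambda>i. ennreal ((X n w - X (r i) w)\<^sup>2)) \<partial>M)"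
      proof (rule nn_integral_cong_AE)
        show "AE w in M. ennreal ((X n w - Y w)\<^sup>2) = liminf (\<lambda>i. ennreal ((X n w - X (r i) w)\<^sup>2))"
          using ae
        proof eventually_elim
          case (elim w)
          have "(\<lambda>i. ennreal ((X n w - X (r i) w)\<^sup>2)) \<longlonglongrightarrow> ennreal ((X n w - Y w)\<^sup>2)"
            using elim by (intro tendsto_ennrealI tendsto_intros)
          from lim_imp_Liminf[OF _ this] show ?case by simp
        qed
      qed
      also have "\<dots> \<le> liminf (\<lambda>i. \<integral>\<^sup>+w. ennreal ((X n w - X (r i) w)\<^sup>2) \<partial>M)"
        by (rule nn_integral_liminf) simp
      also have "\<dots> \<le> ennreal (e\<^sup>2)"
      proof (rule Liminf_le)
        have "(\<integral>\<^sup>+w. ennreal ((X n w - X (r i) w)\<^sup>2) \<partial>M) \<le> ennreal (e\<^sup>2)" if "i \<ge> N" for i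
        proof -
          have "(\<integral>\<^sup>+w. ennreal ((X n w - X (r i) w)\<^sup>2) \<partial>M)
              = ennreal ((l2dist M (X n) (X (r i)))\<^sup>2)"
            unfolding l2norm_sq using square_int_diff[OF sq sq]
            by (intro nn_integral_eq_integral) (auto simp: square_int_def)
          also have "\<dots> \<le> ennreal (e\<^sup>2)"
            using N[OF n, of "r i"] seq_suble[OF r(1), of i] that
            by (intro ennreal_leI power_mono) (auto simp: l2norm_nonneg)
          finally show ?thesis .
        qed
        then show "\<forall>\<^sub>F i in sequentially. (\<integral>\<^sup>+w. ennreal ((X n w - X (r i) w)\<^sup>2) \<partial>M) \<le> ennreal (e\<^sup>2)"
          by (auto simp: eventually_sequentially)
      qed simp
      finally show ?thesis .
    qed
    then show ?thesis by blast
  qed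
  have sqd: "\<exists>N. \<forall>n\<ge>N. square_int M (\<lambda>w. X n w - Y w) \<and> l2dist M (X n) Y \<le> e"
    if "e > 0" for e
  proof -
    obtain N where N: "\<And>n. n \<ge> N \<Longrightarrow> (\<integral>\<^sup>+w. ennreal ((X n w - Y w)\<^sup>2) \<partial>M) \<le> ennreal (e\<^sup>2)"
      using bd[OF \<open>e > 0\<close>] by blast
    have "square_int M (\<lambda>w. X n w - Y w) \<and> l2dist M (X n) Y \<le> e" if "n \<ge> N" for n
    proof
      have i: "integrable M (\<lambda>w. (X n w - Y w)\<^sup>2)"
        by (rule integrableI_nonneg) (use N[OF that] in \<open>auto simp: le_less_trans\<close>)
      then show "square_int M (\<lambda>w. X n w - Y w)" by (simp add: square_int_def)
      have "ennreal (\<integral>w. (X n w - Y w)\<^sup>2 \<partial>M) \<le> ennreal (e\<^sup>2)"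
        using N[OF that] nn_integral_eq_integral[OF i] by simp
      then show "l2dist M (X n) Y \<le> e"
        using \<open>e > 0\<close> unfolding l2norm_def by (intro real_le_lsqrt) (auto simp: ennreal_le_iff)
    qed
    then show ?thesis by blast
  qed
  have sqY: "square_int M Y"
  proof -
    obtain n where "square_int M (\<lambda>w. X n w - Y w)" using sqd[of 1] by auto
    from square_int_diff[OF sq[of n] this] show ?thesis by simp
  qed
  have "(\<lambda>n. l2dist M (X n) Y) \<longlonglongrightarrow> 0"
  proof (rule LIMSEQ_I)
    fix e :: real assume "e > 0"
    then obtain N where "\<forall>n\<ge>N. l2dist M (X n) Y \<le> e / 2" using sqd[of "e / 2"] by auto
    then show "\<exists>N. \<forall>n\<ge>N. norm (l2dist M (X n) Y - 0) < e"
      using \<open>e > 0\<close> by (intro exI[of _ N]) (force simp: l2norm_nonneg)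
  qed
  then show ?thesis using YG sq sqY by (auto simp: ms_lim_iff)
qed

end

section \<open>Finite grids and their refinements\<close>

definition next_pt :: "real set \<Rightarrow> real \<Rightarrow> real" where
  "next_pt R p = Min {q \<in> R. p < q}"

definition floor_pt :: "real set \<Rightarrow> real \<Rightarrow> real" where
  "floor_pt R p = Max {q \<in> R. q \<le> p}"

text \<open>Grids are sets of points instead of indexed sequences: refinement is inclusion, a common
  refinement is a union, and restriction to a subinterval with end points in the grid needs no
  reindexing.\<close>

definition grid :: "real set \<Rightarrow> real \<Rightarrow> real \<Rightarrow> bool" where
  "grid R a b \<longleftrightarrow> finite R \<and> a \<in> R \<and> b \<in> R \<and> a \<le> b"

definition pts :: "real set \<Rightarrow> real \<Rightarrow> real \<Rightarrow> real set" where
  "pts R a b = {p \<in> R. a \<le> p \<and> p < b}"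

definition mesh_less :: "real set \<Rightarrow> real \<Rightarrow> real \<Rightarrow> real \<Rightarrow> bool" where
  "mesh_less R a b \<delta> \<longleftrightarrow> (\<forall>p\<in>pts R a b. next_pt R p - p < \<delta>)"

lemma finite_pts [simp]: "finite R \<Longrightarrow> finite (pts R a b)"
  by (simp add: pts_def)

lemma pts_same [simp]: "pts R a a = {}"
  by (auto simp: pts_def)

lemma pts_mono: "a \<le> a' \<Longrightarrow> b' \<le> b \<Longrightarrow> pts R a' b' \<subseteq> pts R a b"
  by (auto simp: pts_def)

lemma mesh_less_subset: "mesh_less R a b \<delta> \<Longrightarrow> a \<le> a' \<Longrightarrow> b' \<le> b \<Longrightarrow> mesh_less R a' b' \<delta>"
  using pts_mono unfolding mesh_less_def by blast

lemma nxt_props: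
  assumes "finite R" "b \<in> R" "p < b"
  shows "next_pt R p \<in> R" "p < next_pt R p" "next_pt R p \<le> b" "\<And>q. q \<in> R \<Longrightarrow> p < q \<Longrightarrow> next_pt R p \<le> q"
proof -
  have "next_pt R p \<in> {q \<in> R. p < q}" unfolding next_pt_def by (rule Min_in) (use assms in auto)
  then show "next_pt R p \<in> R" "p < next_pt R p" by auto
  show *: "next_pt R p \<le> q" if "q \<in> R" "p < q" for q
    unfolding next_pt_def by (rule Min_le) (use assms that in auto)
  show "next_pt R p \<le> b" by (rule *) (use assms in auto)
qed

lemma flr_props:
  assumes "finite R" "a \<in> R" "a \<le> p"
  shows "floor_pt R p \<in> R" "floor_pt R p \<le> p" "a \<le> floor_pt R p" "\<And>q. q \<in> R \<Longrightarrow> q \<le> p \<Longrightarrow> q \<le> floor_pt R p"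
proof -
  have "floor_pt R p \<in> {q \<in> R. q \<le> p}" unfolding floor_pt_def by (rule Max_in) (use assms in auto)
  then show "floor_pt R p \<in> R" "floor_pt R p \<le> p" by auto
  show *: "q \<le> floor_pt R p" if "q \<in> R" "q \<le> p" for q
    unfolding floor_pt_def by (rule Max_ge) (use assms that in auto)
  show "a \<le> floor_pt R p" by (rule *) (use assms in auto)
qed

lemma flr_nxt:
  assumes "finite R" "a \<in> R" "a \<le> p" "b \<in> R" "p < b"
  shows "p < next_pt R (floor_pt R p)"
proof (rule ccontr)
  assume "\<not> ?thesis"
  moreover have "floor_pt R p < b" using flr_props(2)[OF assms(1-3)] assms by simp
  note n = nxt_props[OF assms(1) assms(4) this]
  ultimately have "next_pt R (floor_pt R p) \<le> floor_pt R p" by (intro flr_props(4)[OF assms(1-3)]) auto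
  then show False using n(2) by simp
qed

lemma flr_eqI:
  assumes "finite R" "q \<in> R" "b \<in> R" "q < b" "q \<le> p" "p < next_pt R q"
  shows "floor_pt R p = q"
proof -
  note f = flr_props[OF assms(1,2,5)]
  have "\<not> q < floor_pt R p" using nxt_props(4)[OF assms(1,3,4) f(1)] f(2) assms(6) by auto
  then show ?thesis using f(3) by simp
qed

lemma pts_nxt:
  assumes "finite R" "p \<in> R" "b \<in> R" "p < b" "a \<le> p"
  shows "pts R a (next_pt R p) = insert p (pts R a p)" "p \<notin> pts R a p"
proof -
  note n = nxt_props[OF assms(1,3,4)]
  show "pts R a (next_pt R p) = insert p (pts R a p)"
    using n assms by (force simp: pts_def)
qed (simp add: pts_def)

lemma pts_split:
  assumes "grid R a c" "grid R c b"
  shows "pts R a b = pts R a c \<union> pts R c b" "pts R a c \<inter> pts R c b = {}"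
  using assms by (auto simp: pts_def grid_def)

text \<open>Takes the place of induction on the index of a partition point. The proof is by
  induction on the number of grid points before \<open>c\<close>; the last of them has
  \<open>c\<close> as its successor.\<close>

lemma grid_induct:
  assumes g: "grid R a b" and base: "P a"
    and step: "\<And>p. p \<in> pts R a b \<Longrightarrow> P p \<Longrightarrow> P (next_pt R p)"
  shows "P b"
proof -
  have fin: "finite R" "a \<in> R" using g by (auto simp: grid_def)
  have "c \<in> R \<Longrightarrow> a \<le> c \<Longrightarrow> c \<le> b \<Longrightarrow> P c" for c
  proof (induction "card (pts R a c)" arbitrary: c rule: less_induct)
    case less
    show ?case
    proof (cases "c = a")
      case True then show ?thesis using base by simp
    next
      case False
      then have ne: "pts R a c \<noteq> {}" using fin less.prems by (auto simp: pts_def)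
      define p where "p = Max (pts R a c)"
      have p: "p \<in> pts R a c" unfolding p_def using fin ne by (intro Max_in) auto
      then have p': "p \<in> R" "a \<le> p" "p < c" by (auto simp: pts_def)
      note n = nxt_props[OF fin(1) less.prems(1) p'(3)]
      have "next_pt R p = c"
      proof (rule ccontr)
        assume "next_pt R p \<noteq> c"
        then have "next_pt R p \<in> pts R a c" using n p' by (auto simp: pts_def)
        then have "next_pt R p \<le> p" unfolding p_def using fin by (intro Max_ge) auto
        then show False using n by simp
      qed
      moreover have "card (pts R a p) < card (pts R a c)"
        using p p' fin by (intro psubset_card_mono) (auto simp: pts_def)
      then have "P p" using less.hyps[of p] p' less.prems by auto
      then have "P (next_pt R p)" using p' less.prems by (intro step) (auto simp: pts_def)
      ultimately show ?thesis by simp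
    qed
  qed
  then show ?thesis using g by (auto simp: grid_def)
qed

lemma sum_pts_nxt:
  fixes f :: "real \<Rightarrow> 'b::comm_monoid_add"
  assumes "grid R a b" "p \<in> pts R a b"
  shows "(\<Sum>q\<in>pts R a (next_pt R p). f q) = (\<Sum>q\<in>pts R a p. f q) + f p"
proof -
  have *: "finite R" "p \<in> R" "b \<in> R" "p < b" "a \<le> p" using assms by (auto simp: grid_def pts_def)
  show ?thesis using pts_nxt[OF *] *(1) by (simp add: add.commute)
qed

lemma sum_pts_telescope:
  fixes g :: "real \<Rightarrow> real"
  assumes "grid R a b"
  shows "(\<Sum>p\<in>pts R a b. g (next_pt R p) - g p) = g b - g a"
  by (rule grid_induct[OF assms]) (simp_all add: sum_pts_nxt[OF assms])

text \<open>Within one cell of \<open>R\<close> the point \<open>floor_pt R q\<close> does not move,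
  and the increments of \<open>g\<close> over the finer cells telescope to the increment over the
  whole cell.\<close>

lemma sum_pts_refine:
  fixes f g :: "real \<Rightarrow> real"
  assumes g: "grid R a b" and R': "R \<subseteq> R'" "finite R'"
  shows "(\<Sum>p\<in>pts R a b. f p * (g (next_pt R p) - g p))
       = (\<Sum>p\<in>pts R' a b. f (floor_pt R p) * (g (next_pt R' p) - g p))"
proof (rule grid_induct[OF g])
  fix p assume p: "p \<in> pts R a b"
    and IH: "(\<Sum>p\<in>pts R a p. f p * (g (next_pt R p) - g p))
       = (\<Sum>p\<in>pts R' a p. f (floor_pt R p) * (g (next_pt R' p) - g p))"
  have p': "finite R" "p \<in> R" "b \<in> R" "p < b" "a \<le> p" "a \<in> R"
    using g p by (auto simp: grid_def pts_def)
  note n = nxt_props[OF p'(1,3,4)]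
  have g1: "grid R' a p" "grid R' p (next_pt R p)"
    using p' n R' by (auto simp: grid_def)
  have "(\<Sum>q\<in>pts R' p (next_pt R p). f (floor_pt R q) * (g (next_pt R' q) - g q))
      = (\<Sum>q\<in>pts R' p (next_pt R p). f p * (g (next_pt R' q) - g q))"
    using flr_eqI[OF p'(1,2,3,4)] by (intro sum.cong) (auto simp: pts_def)
  also have "\<dots> = f p * (g (next_pt R p) - g p)"
    by (simp add: sum_distrib_left[symmetric] sum_pts_telescope[OF g1(2)])
  finally show "(\<Sum>p\<in>pts R a (next_pt R p). f p * (g (next_pt R p) - g p))
       = (\<Sum>p\<in>pts R' a (next_pt R p). f (floor_pt R p) * (g (next_pt R' p) - g p))"
    using pts_split[OF g1] R' by (simp add: sum_pts_nxt[OF g p] IH sum.union_disjoint)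
qed simp

text \<open>The prescribed points \<open>Q\<close> allow a given grid to be refined, or the end
  points of a whole family of intervals to be included.\<close>

lemma mesh_less_grid_exists:
  assumes "a \<le> b" "0 < \<delta>" "finite Q"
  shows "\<exists>R. grid R a b \<and> Q \<subseteq> R \<and> mesh_less R a b \<delta>"
proof -
  \<comment> \<open>Multiples of \<open>\<delta> / 2\<close>: the first one strictly beyond
    \<open>p\<close> is at most \<open>\<delta> / 2\<close> away, which keeps the gap strictly below
    \<open>\<delta>\<close>.\<close>
  define h where "h = (\<lambda>i::int. of_int i * (\<delta> / 2))"
  define R where "R = Q \<union> {a, b} \<union> h ` {\<lfloor>a / (\<delta> / 2)\<rfloor>..\<lceil>b / (\<delta> / 2)\<rceil>}"
  have g: "grid R a b" "Q \<subseteq> R" using assms by (auto simp: grid_def R_def)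
  have "next_pt R p - p < \<delta>" if "p \<in> pts R a b" for p
  proof -
    have p: "a \<le> p" "p < b" using that by (auto simp: pts_def)
    define i where "i = \<lfloor>p / (\<delta> / 2)\<rfloor> + 1"
    have "\<lfloor>a / (\<delta> / 2)\<rfloor> \<le> \<lfloor>p / (\<delta> / 2)\<rfloor>"
      using p assms by (intro floor_mono divide_right_mono) auto
    moreover have "\<lfloor>p / (\<delta> / 2)\<rfloor> < \<lceil>b / (\<delta> / 2)\<rceil>"
    proof -
      have "real_of_int \<lfloor>p / (\<delta> / 2)\<rfloor> \<le> p / (\<delta> / 2)" by simp
      also have "\<dots> < b / (\<delta> / 2)" using p assms by (intro divide_strict_right_mono) auto
      also have "\<dots> \<le> of_int \<lceil>b / (\<delta> / 2)\<rceil>" by simp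
      finally show ?thesis by linarith
    qed
    ultimately have "h i \<in> R" by (auto simp: R_def i_def)
    moreover have "p / (\<delta> / 2) < of_int i" "of_int i \<le> p / (\<delta> / 2) + 1"
      unfolding i_def by linarith+
    then have "p < h i" "h i \<le> p + \<delta> / 2" using assms by (auto simp: h_def field_simps)
    ultimately have "next_pt R p \<le> h i"
      using nxt_props(4)[of R b p "h i"] g p by (auto simp: grid_def)
    then show ?thesis using \<open>h i \<le> p + \<delta> / 2\<close> assms by linarith
  qed
  then show ?thesis using g by (auto simp: mesh_less_def)
qed


section \<open>Riemann sums in mean square\<close>

locale bounded_martingale_setting = martingale_setting P F M \<rho> T
  for P :: "'a measure" and F :: "real \<Rightarrow> 'a measure" and M \<rho> :: "real \<Rightarrow> 'a \<Rightarrow> real" and T :: real +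
  fixes t K :: real
  assumes t_nonneg: "0 \<le> t" and t_less: "t < T"
    and rho_le: "\<And>\<tau>. \<tau> \<in> {t..T} \<Longrightarrow> AE w in P. \<bar>\<rho> \<tau> w\<bar> \<le> K"
begin

lemma K_nonneg: "0 \<le> K"
proof -
  have "AE w in P. \<bar>\<rho> t w\<bar> \<le> K" using rho_le[of t] t_less by simp
  then have "AE w in P. 0 \<le> K" by eventually_elim linarith
  then show ?thesis by simp
qed

lemma adapted_P: "u \<in> {0..T} \<Longrightarrow> X \<in> borel_measurable (F u) \<Longrightarrow> X \<in> borel_measurable P"
  using measurable_from_subalg[OF subalg] by blast

lemma adapted_mono:
  assumes "X \<in> borel_measurable (F u)" "0 \<le> u" "u \<le> v" "v \<le> T"
  shows "X \<in> borel_measurable (F v)"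
proof (rule measurable_from_subalg[OF _ assms(1)])
  show "subalgebra (F v) (F u)"
    using subalg[of u] subalg[of v] filtered[of u v] assms by (auto simp: subalgebra_def)
qed

lemma M_adapted: "u \<in> {0..T} \<Longrightarrow> M u \<in> borel_measurable (F u)"
  and M_integrable: "u \<in> {0..T} \<Longrightarrow> integrable P (M u)"
  using mart by (auto simp: martingale_on_def)

lemma M_borel: "u \<in> {0..T} \<Longrightarrow> M u \<in> borel_measurable P"
  using M_adapted adapted_P by blast

section \<open>Increments of the martingale: orthogonality and isometry\<close>

lemma sigma_finite_F: "u \<in> {0..T} \<Longrightarrow> sigma_finite_subalgebra P (F u)"
  by (rule finite_measure_subalgebra_is_sigma_finite)
    (simp add: finite_measure_subalgebra.intro finite_measure_subalgebra_axioms.intro subalg finite_measure_axioms)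

text \<open>Condition on \<open>F s\<close>: the factor \<open>Z * Y\<close> is known at time
  \<open>s\<close> and the increment has conditional mean 0. Square integrability is asked of
  \<open>Z\<close> and of the product of \<open>Y\<close> with the increment, not of
  \<open>Y\<close>, so that step processes of finite weighted energy are covered.\<close>

lemma mart_cross:
  assumes su: "0 \<le> s" "s \<le> u" "u \<le> T" and Y: "Y \<in> borel_measurable (F s)"
    and Z: "Z \<in> borel_measurable (F s)" "square_int P Z"
    and YM: "square_int P (\<lambda>w. Y w * (M u w - M s w))"
  shows "(\<integral>w. Z w * (Y w * (M u w - M s w)) \<partial>P) = 0"
proof -
  interpret S: sigma_finite_subalgebra P "F s" using su by (intro sigma_finite_F) auto
  have iM: "integrable P (M u)" "integrable P (M s)" using su by (auto intro: M_integrable)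
  have AE0: "AE w in P. real_cond_exp P (F s) (\<lambda>w. M u w - M s w) w = 0"
  proof -
    have "AE w in P. real_cond_exp P (F s) (M u) w = M s w"
      using mart su by (auto simp: martingale_on_def)
    moreover have "AE w in P. real_cond_exp P (F s) (M s) w = M s w"
      using su by (intro S.real_cond_exp_F_meas iM M_adapted) auto
    ultimately show ?thesis using S.real_cond_exp_diff[OF iM] by eventually_elim simp
  qed
  have int: "integrable P (\<lambda>w. (Z w * Y w) * (M u w - M s w))"
    using square_int_mult[OF Z(2) YM] by (simp add: mult.assoc)
  have "(\<integral>w. (Z w * Y w) * (M u w - M s w) \<partial>P)
    = (\<integral>w. (Z w * Y w) * real_cond_exp P (F s) (\<lambda>w. M u w - M s w) w \<partial>P)"
    using S.real_cond_exp_intg(2)[OF int] Z Y iM by auto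
  also have "\<dots> = (\<integral>w. 0 \<partial>P)"
  proof (rule integral_cong_AE)
    show "AE w in P. (Z w * Y w) * real_cond_exp P (F s) (\<lambda>w. M u w - M s w) w = 0"
      using AE0 by auto
    have "Y \<in> borel_measurable P" "Z \<in> borel_measurable P" using Y Z su adapted_P[of s] by auto
    then show "(\<lambda>w. (Z w * Y w) * real_cond_exp P (F s) (\<lambda>w. M u w - M s w) w) \<in> borel_measurable P"
      by measurable
  qed simp
  finally show ?thesis by (simp add: mult.assoc)
qed

text \<open>Joint measurability of \<open>\<rho>\<close> is given on \<open>[0,T]\<close> only.
  Freezing the time at the nearer end point outside this interval extends it to the whole line,
  where Tonelli's theorem for \<open>lborel\<close> and \<open>P\<close> applies.\<close>

lemma rho_clamp_measurable:
  "(\<lambda>(\<tau>, w). \<rho> (max 0 (min \<tau> T)) w) \<in> borel_measurable (borel \<Otimes>\<^sub>M P)"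
proof -
  have "(\<lambda>(\<tau>, w). (max 0 (min \<tau> T), w)) \<in> borel \<Otimes>\<^sub>M P \<rightarrow>\<^sub>M restrict_space borel {0..T} \<Otimes>\<^sub>M P"
    unfolding split_beta' using t_nonneg t_less
    by (intro measurable_Pair measurable_restrict_space2) auto
  from measurable_compose[OF this rho_measurable] show ?thesis by (simp add: split_beta')
qed

text \<open>Conditioning on \<open>F s\<close> pulls out \<open>Y\<close>, \<open>rho_char\<close>
  replaces the conditional second moment, and after removing the conditioning Tonelli exchanges time
  and expectation. In \<open>[0,\<infinity>]\<close> all of this holds without any integrability of
  \<open>Y\<close>.\<close>

lemma nn_isometry:
  assumes su: "0 \<le> s" "s < u" "u \<le> T" and Y: "Y \<in> borel_measurable (F s)"
  shows "(\<integral>\<^sup>+w. ennreal ((Y w * (M u w - M s w))\<^sup>2) \<partial>P)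
    = (\<integral>\<^sup>+\<tau>\<in>{s..u}. (\<integral>\<^sup>+w. ennreal ((Y w)\<^sup>2 * \<rho> \<tau> w) \<partial>P) \<partial>lborel)"
proof -
  interpret S: sigma_finite_subalgebra P "F s" using su by (intro sigma_finite_F) auto
  interpret pair_sigma_finite lborel P ..
  define r where "r = (\<lambda>\<tau> w. ennreal (\<rho> (max 0 (min \<tau> T)) w) * indicator {s..u} \<tau>)"
  have clamp: "max 0 (min \<tau> T) = \<tau>" if "\<tau> \<in> {s..u}" for \<tau> using that su by auto
  have [measurable]: "(\<lambda>(\<tau>, w). \<rho> (max 0 (min \<tau> T)) w) \<in> borel_measurable (lborel \<Otimes>\<^sub>M P)"
    using rho_clamp_measurable by (simp cong: measurable_cong_sets)
  have r_meas [measurable]: "(\<lambda>(\<tau>, w). r \<tau> w) \<in> borel_measurable (lborel \<Otimes>\<^sub>M P)"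
    unfolding r_def by measurable
  have r_eq: "(\<integral>\<^sup>+\<tau>\<in>{s..u}. ennreal (\<rho> \<tau> w) \<partial>lborel) = (\<integral>\<^sup>+\<tau>. r \<tau> w \<partial>lborel)" for w
    by (intro nn_integral_cong) (auto simp: r_def clamp indicator_def)
  have YP [measurable]: "Y \<in> borel_measurable P" using Y su by (intro adapted_P[of s]) auto
  have MP [measurable]: "M u \<in> borel_measurable P" "M s \<in> borel_measurable P"
    using su by (auto intro: M_borel)
  have YF: "(\<lambda>w. ennreal ((Y w)\<^sup>2)) \<in> borel_measurable (F s)" using Y by measurable
  have rP: "(\<lambda>w. \<integral>\<^sup>+\<tau>. r \<tau> w \<partial>lborel) \<in> borel_measurable P" by measurable
  have "(\<integral>\<^sup>+w. ennreal ((Y w * (M u w - M s w))\<^sup>2) \<partial>P)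
    = (\<integral>\<^sup>+w. ennreal ((Y w)\<^sup>2) * ennreal ((M u w - M s w)\<^sup>2) \<partial>P)"
    by (simp add: power_mult_distrib ennreal_mult)
  also have "\<dots> = (\<integral>\<^sup>+w. ennreal ((Y w)\<^sup>2)
      * nn_cond_exp P (F s) (\<lambda>w. ennreal ((M u w - M s w)\<^sup>2)) w \<partial>P)"
    by (rule S.nn_cond_exp_intg[symmetric, OF YF]) measurable
  also have "\<dots> = (\<integral>\<^sup>+w. ennreal ((Y w)\<^sup>2)
      * nn_cond_exp P (F s) (\<lambda>w. \<integral>\<^sup>+\<tau>. r \<tau> w \<partial>lborel) w \<partial>P)"
    using rho_char[OF su] unfolding r_eq by (intro nn_integral_cong_AE) auto
  also have "\<dots> = (\<integral>\<^sup>+w. ennreal ((Y w)\<^sup>2) * (\<integral>\<^sup>+\<tau>. r \<tau> w \<partial>lborel) \<partial>P)"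
    by (rule S.nn_cond_exp_intg[OF YF rP])
  also have "\<dots> = (\<integral>\<^sup>+w. \<integral>\<^sup>+\<tau>. ennreal ((Y w)\<^sup>2) * r \<tau> w \<partial>lborel \<partial>P)"
    by (intro nn_integral_cong nn_integral_cmult[symmetric]) measurable
  also have "\<dots> = (\<integral>\<^sup>+\<tau>. \<integral>\<^sup>+w. ennreal ((Y w)\<^sup>2) * r \<tau> w \<partial>P \<partial>lborel)"
    by (rule Fubini') measurable
  also have "\<dots> = (\<integral>\<^sup>+\<tau>\<in>{s..u}. (\<integral>\<^sup>+w. ennreal ((Y w)\<^sup>2 * \<rho> \<tau> w) \<partial>P) \<partial>lborel)"
    by (intro nn_integral_cong) (auto simp: r_def clamp indicator_def ennreal_mult')
  finally show ?thesis .
qed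

text \<open>In \<open>LS m R a b\<close> the grid may extend beyond \<open>[a,b]\<close>, so that one grid serves several intervals.\<close>

definition dI :: "bool \<Rightarrow> real \<Rightarrow> real \<Rightarrow> 'a \<Rightarrow> real" where
  "dI m p q w = integrator M m q w - integrator M m p w"

definition LS :: "bool \<Rightarrow> real set \<Rightarrow> real \<Rightarrow> real \<Rightarrow> (real \<Rightarrow> 'a \<Rightarrow> real) \<Rightarrow> 'a \<Rightarrow> real" where
  "LS m R a b \<phi> w = (\<Sum>p\<in>pts R a b. \<phi> p w * dI m p (next_pt R p) w)"

lemma dI_True: "dI True p q w = M q w - M p w"
  and dI_False: "dI False p q w = q - p"
  by (simp_all add: dI_def integrator_def)

lemma dI_adapted:
  assumes "0 \<le> p" "p \<le> q" "q \<le> T" shows "dI m p q \<in> borel_measurable (F q)"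
proof (cases m)
  case True
  have "M q \<in> borel_measurable (F q)" "M p \<in> borel_measurable (F q)"
    using assms M_adapted[of q] adapted_mono[OF M_adapted[of p]] by auto
  then show ?thesis using True by (simp add: dI_True[abs_def])
qed (simp add: dI_False[abs_def])

lemma LS_refine:
  assumes "grid R a b" "R \<subseteq> R'" "finite R'"
  shows "LS m R a b \<phi> w = LS m R' a b (\<lambda>p. \<phi> (floor_pt R p)) w"
  unfolding LS_def dI_def by (rule sum_pts_refine[OF assms])

lemma LS_nxt:
  assumes "grid R a b" "p \<in> pts R a b"
  shows "LS m R a (next_pt R p) \<phi> w = LS m R a p \<phi> w + \<phi> p w * dI m p (next_pt R p) w"
  unfolding LS_def by (rule sum_pts_nxt[OF assms])

lemma LS_diff: "LS m R a b \<phi> w - LS m R a b \<psi> w = LS m R a b (\<lambda>p w. \<phi> p w - \<psi> p w) w"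
  by (simp add: LS_def sum_subtractf left_diff_distrib)

lemma pts_bounds:
  assumes "grid R a b" "p \<in> pts R a b"
  shows "a \<le> p" "p < b" "p < next_pt R p" "next_pt R p \<le> b" "next_pt R p \<in> R" "p \<in> R"
  using assms nxt_props[of R b p] by (auto simp: grid_def pts_def)

text \<open>Pythagoras: the summands are pairwise orthogonal, since each partial sum is orthogonal
  to the next summand.\<close>

lemma LS_mart:
  assumes g: "grid R a b" and ab: "0 \<le> a" "b \<le> T"
    and Y: "\<And>p. p \<in> pts R a b \<Longrightarrow> Y p \<in> borel_measurable (F p)"
    and sq: "\<And>p. p \<in> pts R a b \<Longrightarrow> square_int P (\<lambda>w. Y p w * dI True p (next_pt R p) w)"
  shows "LS True R a b Y \<in> borel_measurable (F b)"
    and "square_int P (LS True R a b Y)"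
    and "(l2norm P (LS True R a b Y))\<^sup>2
      = (\<Sum>p\<in>pts R a b. (l2norm P (\<lambda>w. Y p w * dI True p (next_pt R p) w))\<^sup>2)"
proof -
  \<comment> \<open>Measurability at time \<open>c\<close> belongs to the induction claim because
    \<open>mart_cross\<close> needs the partial sum up to \<open>p\<close> to be known at time
    \<open>p\<close>.\<close>
  let ?P = "\<lambda>c. LS True R a c Y \<in> borel_measurable (F c) \<and> square_int P (LS True R a c Y)
    \<and> (l2norm P (LS True R a c Y))\<^sup>2
      = (\<Sum>p\<in>pts R a c. (l2norm P (\<lambda>w. Y p w * dI True p (next_pt R p) w))\<^sup>2)"
  have "?P b"
  proof (rule grid_induct[OF g])
    have "LS True R a a Y = (\<lambda>w. 0)" by (simp add: LS_def fun_eq_iff)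
    then show "?P a" by (simp add: l2norm_zero square_int_zero)
  next
    fix p assume p: "p \<in> pts R a b" and IH: "?P p"
    note b = pts_bounds[OF g p]
    let ?D = "\<lambda>w. Y p w * dI True p (next_pt R p) w"
    have eq: "LS True R a (next_pt R p) Y = (\<lambda>w. LS True R a p Y w + ?D w)"
      by (intro ext LS_nxt[OF g p])
    have "LS True R a p Y \<in> borel_measurable (F (next_pt R p))" "Y p \<in> borel_measurable (F (next_pt R p))"
      "dI True p (next_pt R p) \<in> borel_measurable (F (next_pt R p))"
      using IH Y[OF p] b ab by (auto intro: adapted_mono dI_adapted)
    then have m: "LS True R a (next_pt R p) Y \<in> borel_measurable (F (next_pt R p))"
      unfolding eq by measurable
    have s: "square_int P (LS True R a (next_pt R p) Y)"
      unfolding eq using IH sq[OF p] by (intro square_int_add) auto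
    have cross: "(\<integral>w. LS True R a p Y w * ?D w \<partial>P) = 0"
      using IH sq[OF p] Y[OF p] b ab unfolding dI_True by (intro mart_cross) auto
    have "(l2norm P (LS True R a (next_pt R p) Y))\<^sup>2
      = (\<integral>w. (LS True R a p Y w)\<^sup>2 + (?D w)\<^sup>2 + 2 * (LS True R a p Y w * ?D w) \<partial>P)"
      unfolding eq l2norm_sq by (simp add: power2_sum mult.assoc)
    also have "\<dots> = (l2norm P (LS True R a p Y))\<^sup>2 + (l2norm P ?D)\<^sup>2"
      using IH sq[OF p] square_int_mult[of P "LS True R a p Y" ?D] cross
      by (simp add: l2norm_sq square_int_def)
    finally show "?P (next_pt R p)" using m s IH by (simp add: sum_pts_nxt[OF g p])
  qed
  then show "LS True R a b Y \<in> borel_measurable (F b)" "square_int P (LS True R a b Y)"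
    "(l2norm P (LS True R a b Y))\<^sup>2
      = (\<Sum>p\<in>pts R a b. (l2norm P (\<lambda>w. Y p w * dI True p (next_pt R p) w))\<^sup>2)" by auto
qed

text \<open>One constant for both integrators. Squared norms of sums against \<open>M\<close> are
  bounded with the factor \<open>K * (b - a)\<close>, those against time with
  \<open>(b - a)\<^sup>2\<close>, which is at most \<open>(T - t) * (b - a)\<close>. The sum
  dominates both and is positive.\<close>

definition C :: real where "C = K + (T - t)"

lemma C_bounds: "K \<le> C" "T - t \<le> C" "0 < C"
  using K_nonneg t_less by (auto simp: C_def)

abbreviation rho_energy :: "real \<Rightarrow> ('a \<Rightarrow> real) \<Rightarrow> ennreal" where
  "rho_energy \<tau> Y \<equiv> \<integral>\<^sup>+w. ennreal ((Y w)\<^sup>2 * \<rho> \<tau> w) \<partial>P"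

lemma rho_weight_le:
  assumes "\<tau> \<in> {t..T}" "square_int P Y"
  shows "(rho_energy \<tau> Y) \<le> ennreal (K * (l2norm P Y)\<^sup>2)"
proof -
  have "(rho_energy \<tau> Y) \<le> (\<integral>\<^sup>+w. ennreal (K * (Y w)\<^sup>2) \<partial>P)"
    using rho_le[OF assms(1)]
    by (intro nn_integral_mono_AE)
      (auto elim!: eventually_mono intro!: ennreal_leI simp: mult.commute[of K] intro: mult_left_mono)
  also have "\<dots> = ennreal (K * (l2norm P Y)\<^sup>2)"
    unfolding l2norm_sq using assms(2) K_nonneg
    by (subst nn_integral_eq_integral) (auto simp: square_int_def)
  finally show ?thesis .
qed

lemma square_int_dI:
  assumes su: "t \<le> s" "s \<le> u" "u \<le> T" and Y: "Y \<in> borel_measurable (F s)" "square_int P Y"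
  shows "square_int P (\<lambda>w. Y w * dI m s u w)"
    and "(l2norm P (\<lambda>w. Y w * dI m s u w))\<^sup>2 \<le> C * (u - s) * (l2norm P Y)\<^sup>2"
proof -
  have "square_int P (\<lambda>w. Y w * dI m s u w) \<and>
    (l2norm P (\<lambda>w. Y w * dI m s u w))\<^sup>2 \<le> C * (u - s) * (l2norm P Y)\<^sup>2"
  \<comment> \<open>The characteristic is given only for intervals of positive length.\<close>
  proof (cases "s = u")
    case True
    then show ?thesis by (simp add: dI_def square_int_zero l2norm_zero)
  next
    case False
    then have lt: "s < u" using su by simp
    show ?thesis
    proof (cases m)
      case m: True
      have meas: "(\<lambda>w. Y w * dI m s u w) \<in> borel_measurable P"
        using Y su t_nonneg adapted_P[OF _ dI_adapted[of s u m]] by (auto simp: square_int_def)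
      have "(\<integral>\<^sup>+w. ennreal ((Y w * dI m s u w)\<^sup>2) \<partial>P)
        = (\<integral>\<^sup>+\<tau>\<in>{s..u}. (rho_energy \<tau> Y) \<partial>lborel)"
        using nn_isometry[OF _ lt _ Y(1)] su t_nonneg m by (simp add: dI_True)
      also have "\<dots> \<le> (\<integral>\<^sup>+\<tau>\<in>{s..u}. ennreal (K * (l2norm P Y)\<^sup>2) \<partial>lborel)"
        using rho_weight_le[OF _ Y(2)] su by (intro nn_integral_mono) (auto simp: indicator_def)
      also have "\<dots> = ennreal (K * (u - s) * (l2norm P Y)\<^sup>2)"
        using K_nonneg lt by (subst nn_integral_cmult_indicator) (auto simp: ennreal_mult[symmetric] mult_ac)
      also have "\<dots> \<le> ennreal (C * (u - s) * (l2norm P Y)\<^sup>2)"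
        using C_bounds lt by (intro ennreal_leI mult_right_mono) auto
      finally have le: "(\<integral>\<^sup>+w. ennreal ((Y w * dI m s u w)\<^sup>2) \<partial>P) \<le> ennreal (C * (u - s) * (l2norm P Y)\<^sup>2)" .
      then have i: "integrable P (\<lambda>w. (Y w * dI m s u w)\<^sup>2)"
        using meas by (intro integrableI_nonneg) (auto simp: le_less_trans)
      then have "ennreal ((l2norm P (\<lambda>w. Y w * dI m s u w))\<^sup>2) \<le> ennreal (C * (u - s) * (l2norm P Y)\<^sup>2)"
        using le nn_integral_eq_integral[OF i] by (simp add: l2norm_sq)
      then show ?thesis using i meas C_bounds lt by (simp add: square_int_def)
    next
      case False
      have "(u - s) * (u - s) \<le> C * (u - s)"
        using C_bounds su lt by (intro mult_right_mono) auto
      then show ?thesis using False square_int_multc[OF Y(2), of "u - s"] lt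
          l2norm_cmult[of P "u - s" Y]
        by (simp add: dI_False[abs_def] power_mult_distrib power2_eq_square[of "u - s"] mult.commute[of "Y _"]
            mult_right_mono)
    qed
  qed
  then show "square_int P (\<lambda>w. Y w * dI m s u w)"
    "(l2norm P (\<lambda>w. Y w * dI m s u w))\<^sup>2 \<le> C * (u - s) * (l2norm P Y)\<^sup>2" by auto
qed

lemma LS_bound:
  assumes g: "grid R a b" and ab: "t \<le> a" "b \<le> T" and \<beta>: "0 \<le> \<beta>"
    and Y: "\<And>p. p \<in> pts R a b \<Longrightarrow> Y p \<in> borel_measurable (F p)"
    and sq: "\<And>p. p \<in> pts R a b \<Longrightarrow> square_int P (Y p)"
    and le: "\<And>p. p \<in> pts R a b \<Longrightarrow> l2norm P (Y p) \<le> \<beta>"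
  shows "LS m R a b Y \<in> borel_measurable (F b)"
    and "square_int P (LS m R a b Y)"
    and "l2norm P (LS m R a b Y) \<le> sqrt (C * (b - a)) * \<beta>"
proof -
  have "a \<le> b" using g by (simp add: grid_def)
  note pb = pts_bounds[OF g]
  have sqd: "square_int P (\<lambda>w. Y p w * dI m p (next_pt R p) w)"
    and led: "(l2norm P (\<lambda>w. Y p w * dI m p (next_pt R p) w))\<^sup>2 \<le> C * (next_pt R p - p) * \<beta>\<^sup>2"
    if p: "p \<in> pts R a b" for p
  proof -
    show "square_int P (\<lambda>w. Y p w * dI m p (next_pt R p) w)"
      using pb[OF p] ab Y[OF p] sq[OF p] by (intro square_int_dI) auto
    have "(l2norm P (\<lambda>w. Y p w * dI m p (next_pt R p) w))\<^sup>2 \<le> C * (next_pt R p - p) * (l2norm P (Y p))\<^sup>2"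
      using pb[OF p] ab Y[OF p] sq[OF p] by (intro square_int_dI) auto
    also have "\<dots> \<le> C * (next_pt R p - p) * \<beta>\<^sup>2"
      using le[OF p] C_bounds pb[OF p] by (intro mult_left_mono power_mono) (auto simp: l2norm_nonneg)
    finally show "(l2norm P (\<lambda>w. Y p w * dI m p (next_pt R p) w))\<^sup>2 \<le> C * (next_pt R p - p) * \<beta>\<^sup>2" .
  qed
  show "LS m R a b Y \<in> borel_measurable (F b)"
    unfolding LS_def
  proof (rule borel_measurable_sum)
    fix p assume p: "p \<in> pts R a b"
    have "Y p \<in> borel_measurable (F b)" "dI m p (next_pt R p) \<in> borel_measurable (F b)"
      using Y[OF p] pb[OF p] ab t_nonneg
      by (auto intro: adapted_mono[of _ p] adapted_mono[OF dI_adapted])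
    then show "(\<lambda>w. Y p w * dI m p (next_pt R p) w) \<in> borel_measurable (F b)" by measurable
  qed
  show "square_int P (LS m R a b Y)"
    unfolding LS_def using sqd by (intro square_int_sum)
  show "l2norm P (LS m R a b Y) \<le> sqrt (C * (b - a)) * \<beta>"
  \<comment> \<open>Against \<open>M\<close> the bound comes from orthogonality. Against time there
    is none; the triangle inequality gives the factor \<open>b - a\<close>, which is at most
    \<open>sqrt (C * (b - a))\<close> because \<open>b - a \<le> C\<close>.\<close>
  proof (cases m)
    case m: True
    have "(l2norm P (LS m R a b Y))\<^sup>2 = (\<Sum>p\<in>pts R a b. (l2norm P (\<lambda>w. Y p w * dI m p (next_pt R p) w))\<^sup>2)"
      unfolding m[simplified eq_True[symmetric]] using m
      using LS_mart(3)[OF g, of Y] ab t_nonneg Y sqd by simp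
    also have "\<dots> \<le> (\<Sum>p\<in>pts R a b. C * (next_pt R p - p) * \<beta>\<^sup>2)"
      using led by (intro sum_mono)
    also have "\<dots> = C * (b - a) * \<beta>\<^sup>2"
      using sum_pts_telescope[OF g, of "\<lambda>x. x"]
      by (simp add: sum_distrib_left[symmetric] sum_distrib_right[symmetric])
    also have "\<dots> = (sqrt (C * (b - a)) * \<beta>)\<^sup>2"
      using C_bounds \<open>a \<le> b\<close> by (simp add: power_mult_distrib)
    finally show ?thesis
      by (rule power2_le_imp_le) (use C_bounds \<open>a \<le> b\<close> \<beta> in auto)
  next
    case m: False
    have "l2norm P (LS m R a b Y) \<le> (\<Sum>p\<in>pts R a b. l2norm P (\<lambda>w. Y p w * dI m p (next_pt R p) w))"
      unfolding LS_def using sqd g by (intro l2norm_sum) (auto simp: grid_def)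
    also have "\<dots> = (\<Sum>p\<in>pts R a b. (next_pt R p - p) * l2norm P (Y p))"
    proof (rule sum.cong)
      fix p assume p: "p \<in> pts R a b"
      have "(\<lambda>w. Y p w * dI m p (next_pt R p) w) = (\<lambda>w. (next_pt R p - p) * Y p w)"
        using m by (auto simp: dI_False)
      then show "l2norm P (\<lambda>w. Y p w * dI m p (next_pt R p) w) = (next_pt R p - p) * l2norm P (Y p)"
        using pb[OF p] by (simp add: l2norm_cmult)
    qed simp
    also have "\<dots> \<le> (\<Sum>p\<in>pts R a b. (next_pt R p - p) * \<beta>)"
      using le pb by (intro sum_mono mult_left_mono) (auto intro: less_imp_le)
    also have "\<dots> = (b - a) * \<beta>"
      using sum_pts_telescope[OF g, of "\<lambda>x. x"] by (simp add: sum_distrib_right[symmetric])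
    also have "b - a \<le> sqrt (C * (b - a))"
    proof (rule real_le_rsqrt)
      show "(b - a)\<^sup>2 \<le> C * (b - a)"
        unfolding power2_eq_square using C_bounds ab \<open>a \<le> b\<close> by (intro mult_right_mono) auto
    qed
    then have "(b - a) * \<beta> \<le> sqrt (C * (b - a)) * \<beta>" using \<beta> by (intro mult_right_mono)
    finally show ?thesis .
  qed
qed

section \<open>The integral of a mean-square continuous process\<close>

text \<open>Continuity is required in its uniform form together with adaptedness. For the given
  \<open>\<xi>\<close> this is obtained from compactness in \<open>ms_continuous_ms_uniform\<close>;
  for the iterated integrals an explicit modulus is inherited from the kernel.\<close>

definition ms_uniform :: "real \<Rightarrow> real \<Rightarrow> (real \<Rightarrow> 'a \<Rightarrow> real) \<Rightarrow> bool" where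
  "ms_uniform a b \<phi> \<longleftrightarrow> (\<forall>u\<in>{a..b}. \<phi> u \<in> borel_measurable (F u) \<and> square_int P (\<phi> u)) \<and>
     (\<forall>e>0. \<exists>d>0. \<forall>u\<in>{a..b}. \<forall>v\<in>{a..b}. \<bar>u - v\<bar> < d \<longrightarrow> l2dist P (\<phi> u) (\<phi> v) < e)"

lemma ms_uniformD:
  assumes "ms_uniform a b \<phi>" "u \<in> {a..b}"
  shows "\<phi> u \<in> borel_measurable (F u)" "square_int P (\<phi> u)"
  using assms by (auto simp: ms_uniform_def)

lemma ms_uniform_modulus:
  assumes "ms_uniform a b \<phi>" "0 < e"
  obtains d where "0 < d" "\<And>u v. u \<in> {a..b} \<Longrightarrow> v \<in> {a..b} \<Longrightarrow> \<bar>u - v\<bar> < d \<Longrightarrow>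
     l2dist P (\<phi> u) (\<phi> v) < e"
  using assms unfolding ms_uniform_def by meson

lemma ms_uniform_subset:
  assumes "ms_uniform a b \<phi>" "a \<le> a'" "b' \<le> b"
  shows "ms_uniform a' b' \<phi>"
proof -
  have "{a'..b'} \<subseteq> {a..b}" using assms by auto
  then show ?thesis using assms(1) unfolding ms_uniform_def by (meson subsetD)
qed

lemma ms_uniform_bounded:
  assumes "ms_uniform a b \<phi>"
  obtains B where "0 \<le> B" "\<And>u. u \<in> {a..b} \<Longrightarrow> l2norm P (\<phi> u) \<le> B"
proof -
  have "continuous_on {a..b} (\<lambda>u. l2norm P (\<phi> u))"
    unfolding continuous_on_iff
  proof (intro ballI allI impI)
    fix u e :: real assume u: "u \<in> {a..b}" and "0 < e"
    obtain d where d: "0 < d" "\<And>u v. u \<in> {a..b} \<Longrightarrow> v \<in> {a..b} \<Longrightarrow> \<bar>u - v\<bar> < d \<Longrightarrow>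
        l2dist P (\<phi> u) (\<phi> v) < e"
      using ms_uniform_modulus[OF assms \<open>0 < e\<close>] by metis
    have "dist (l2norm P (\<phi> v)) (l2norm P (\<phi> u)) < e" if v: "v \<in> {a..b}" "dist v u < d" for v
    proof -
      have "l2norm P (\<phi> v) \<le> l2norm P (\<phi> u) + l2dist P (\<phi> v) (\<phi> u)"
        "l2norm P (\<phi> u) \<le> l2norm P (\<phi> v) + l2dist P (\<phi> u) (\<phi> v)"
        using ms_uniformD(2)[OF assms] u v by (auto intro: l2norm_le_add_diff)
      then show ?thesis using d(2)[OF v(1) u] d(2)[OF u v(1)] v(2)
        by (simp add: dist_real_def abs_minus_commute[of u v])
    qed
    then show "\<exists>d>0. \<forall>v\<in>{a..b}. dist v u < d \<longrightarrow> dist (l2norm P (\<phi> v)) (l2norm P (\<phi> u)) < e"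
      using d(1) by blast
  qed
  then have "bounded ((\<lambda>u. l2norm P (\<phi> u)) ` {a..b})"
    by (intro compact_imp_bounded compact_continuous_image) auto
  then obtain B where B: "\<forall>x\<in>{a..b}. \<bar>l2norm P (\<phi> x)\<bar> \<le> B"
    by (auto simp: bounded_iff)
  show thesis
    by (rule that[of "max 0 B"]) (use B in \<open>force simp: abs_le_iff\<close>)+
qed

lemma LS_adapted:
  assumes "grid R a b" "t \<le> a" "b \<le> T"
    and Y: "\<And>p. p \<in> pts R a b \<Longrightarrow> Y p \<in> borel_measurable (F p)"
    and sq: "\<And>p. p \<in> pts R a b \<Longrightarrow> square_int P (Y p)"
  shows "LS m R a b Y \<in> borel_measurable (F b)" "square_int P (LS m R a b Y)"
proof -
  define \<beta> where "\<beta> = Max (insert 0 ((\<lambda>p. l2norm P (Y p)) ` pts R a b))"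
  have fin: "finite (pts R a b)" using assms(1) by (simp add: grid_def)
  then have "0 \<le> \<beta>" "\<And>p. p \<in> pts R a b \<Longrightarrow> l2norm P (Y p) \<le> \<beta>" by (auto simp: \<beta>_def)
  from LS_bound[OF assms(1-3) this(1) Y sq this(2)]
  show "LS m R a b Y \<in> borel_measurable (F b)" "square_int P (LS m R a b Y)" by auto
qed

lemma LS_ms_uniform:
  assumes "grid R a b" "t \<le> a" "b \<le> T" "ms_uniform a b \<phi>"
  shows "LS m R a b \<phi> \<in> borel_measurable (F b)" "square_int P (LS m R a b \<phi>)"
  by (rule LS_adapted[OF assms(1-3)]; use pts_bounds[OF assms(1)] ms_uniformD[OF assms(4)] in force)+

text \<open>On the finer grid both sums run over the same increments, the coarse one with its
  integrand frozen at \<open>floor_pt R\<close>. Freezing at an earlier time keeps the difference of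
  the integrands adapted, so \<open>LS_bound\<close> applies to it.\<close>

lemma LS_refine_bound:
  assumes g: "grid R a b" and R': "R \<subseteq> R'" "finite R'" and ab: "t \<le> a" "b \<le> T"
    and \<phi>: "ms_uniform a b \<phi>" and e: "0 \<le> e"
    and le: "\<And>p u. p \<in> pts R a b \<Longrightarrow> p \<le> u \<Longrightarrow> u < next_pt R p \<Longrightarrow> l2dist P (\<phi> p) (\<phi> u) \<le> e"
  shows "l2dist P (LS m R a b \<phi>) (LS m R' a b \<phi>) \<le> sqrt (C * (b - a)) * e"
proof -
  have g': "grid R' a b" using g R' by (auto simp: grid_def)
  have q: "floor_pt R q \<in> pts R a b" "floor_pt R q \<le> q" "q < next_pt R (floor_pt R q)" "q \<in> {a..b}" "floor_pt R q \<in> {a..b}"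
    if "q \<in> pts R' a b" for q
    using that flr_props[of R a q] flr_nxt[of R a q b] g by (auto simp: grid_def pts_def)
  have eq: "(\<lambda>w. LS m R a b \<phi> w - LS m R' a b \<phi> w) = LS m R' a b (\<lambda>q w. \<phi> (floor_pt R q) w - \<phi> q w)"
    by (simp add: LS_refine[OF g R'] LS_diff)
  show ?thesis
    unfolding eq
  proof (rule LS_bound(3)[OF g' ab e])
    fix q assume "q \<in> pts R' a b"
    note q = q[OF this]
    show "l2dist P (\<phi> (floor_pt R q)) (\<phi> q) \<le> e" by (rule le[OF q(1-3)])
    show "square_int P (\<lambda>w. \<phi> (floor_pt R q) w - \<phi> q w)"
      using q ms_uniformD(2)[OF \<phi>] by (intro square_int_diff) auto
    have "\<phi> q \<in> borel_measurable (F q)" "\<phi> (floor_pt R q) \<in> borel_measurable (F q)"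
      using q ms_uniformD(1)[OF \<phi>] ab t_nonneg by (auto intro: adapted_mono[of _ "floor_pt R q"])
    then show "(\<lambda>w. \<phi> (floor_pt R q) w - \<phi> q w) \<in> borel_measurable (F q)" by measurable
  qed
qed

text \<open>Convergence is stated for all fine grids rather than for a sequence, so that one grid
  can serve several integrals simultaneously.\<close>

definition is_int :: "bool \<Rightarrow> real \<Rightarrow> real \<Rightarrow> (real \<Rightarrow> 'a \<Rightarrow> real) \<Rightarrow> ('a \<Rightarrow> real) \<Rightarrow> bool" where
  "is_int m a b \<phi> X \<longleftrightarrow> square_int P X \<and>
     (\<forall>e>0. \<exists>d>0. \<forall>R. grid R a b \<longrightarrow> mesh_less R a b d \<longrightarrow>
        l2dist P (LS m R a b \<phi>) X \<le> e)"

text \<open>Any two fine grids are compared through their union, hence the sums satisfy a Cauchy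
  criterion in the mesh. Completeness is applied to one sequence of grids with mesh below
  \<open>1 / real (Suc n)\<close>, and the criterion transfers the limit to all fine grids.\<close>

lemma is_int_exists:
  assumes ab: "t \<le> a" "a \<le> b" "b \<le> T" and \<phi>: "ms_uniform a b \<phi>"
  shows "\<exists>X. X \<in> borel_measurable (F b) \<and> is_int m a b \<phi> X"
proof -
  have cmp: "\<exists>d>0. \<forall>R R'. grid R a b \<longrightarrow> grid R' a b \<longrightarrow> mesh_less R a b d \<longrightarrow> mesh_less R' a b d \<longrightarrow>
      l2dist P (LS m R a b \<phi>) (LS m R' a b \<phi>) \<le> e" if "e > 0" for e
  proof -
    define s where "s = sqrt (C * (b - a))"
    have "s \<ge> 0" using C_bounds ab by (simp add: s_def)
    \<comment> \<open>Each of the two comparisons with the union costs \<open>s * e'\<close>; adding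
      1 avoids a division by zero when \<open>a = b\<close>.\<close>
    define e' where "e' = e / (2 * (s + 1))"
    have e': "e' > 0" "2 * (s * e') \<le> e" using \<open>s \<ge> 0\<close> that by (auto simp: e'_def field_simps)
    obtain d where d: "0 < d" "\<And>u v. u \<in> {a..b} \<Longrightarrow> v \<in> {a..b} \<Longrightarrow> \<bar>u - v\<bar> < d \<Longrightarrow>
        l2dist P (\<phi> u) (\<phi> v) < e'"
      using ms_uniform_modulus[OF \<phi> e'(1)] by metis
    have one: "l2dist P (LS m R a b \<phi>) (LS m R' a b \<phi>) \<le> s * e'"
      if g: "grid R a b" "mesh_less R a b d" "R \<subseteq> R'" "finite R'" for R R'
      unfolding s_def
    proof (rule LS_refine_bound[OF g(1,3,4) ab(1,3) \<phi>])
      fix p u assume p: "p \<in> pts R a b" "p \<le> u" "u < next_pt R p"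
      then have "next_pt R p - p < d" using g by (auto simp: mesh_less_def)
      then show "l2dist P (\<phi> p) (\<phi> u) \<le> e'"
        using p pts_bounds[OF g(1) p(1)] by (intro less_imp_le d) auto
    qed (use e' in simp)
    have "l2dist P (LS m R a b \<phi>) (LS m R' a b \<phi>) \<le> e"
      if g: "grid R a b" "grid R' a b" "mesh_less R a b d" "mesh_less R' a b d" for R R'
    proof -
      have gU: "grid (R \<union> R') a b" and fin: "finite (R \<union> R')" using g by (auto simp: grid_def)
      have "l2dist P (LS m R a b \<phi>) (LS m R' a b \<phi>)
        \<le> l2dist P (LS m R a b \<phi>) (LS m (R \<union> R') a b \<phi>)
         + l2dist P (LS m (R \<union> R') a b \<phi>) (LS m R' a b \<phi>)"
        using g gU ab \<phi> by (intro l2norm_triangle_diff LS_ms_uniform)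
      also have "\<dots> \<le> s * e' + s * e'"
        unfolding l2norm_minus_commute[of P "LS m (R \<union> R') a b \<phi>" "LS m R' a b \<phi>"]
        using one[OF g(1,3) _ fin] one[OF g(2,4) _ fin] by (intro add_mono) auto
      finally show ?thesis using e'(2) by linarith
    qed
    then show ?thesis using d(1) by blast
  qed
  have "\<exists>R. grid R a b \<and> mesh_less R a b (1 / real (Suc n))" for n
    using mesh_less_grid_exists[OF ab(2), of "1 / real (Suc n)" "{}"] by auto
  then obtain R where R: "\<And>n. grid (R n) a b" "\<And>n. mesh_less (R n) a b (1 / real (Suc n))" by metis
  have Rd: "\<exists>N. \<forall>n\<ge>N. mesh_less (R n) a b d" if "d > 0" for d
  proof -
    obtain N where N: "1 / real (Suc N) < d" using nat_approx_posE[OF \<open>d > 0\<close>] by metis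
    have "mesh_less (R n) a b d" if "n \<ge> N" for n
    proof -
      have "1 / real (Suc n) \<le> 1 / real (Suc N)" using that by (simp add: field_simps)
      then show ?thesis using R(2)[of n] N unfolding mesh_less_def by force
    qed
    then show ?thesis by blast
  qed
  let ?X = "\<lambda>n. LS m (R n) a b \<phi>"
  have bT: "b \<in> {0..T}" using ab t_nonneg by auto
  have "\<exists>X. X \<in> borel_measurable (F b) \<and> ms_lim P ?X X"
  proof (rule square_int_complete[OF subalg[OF bT]])
    show "?X n \<in> borel_measurable (F b)" "square_int P (?X n)" for n
      using LS_ms_uniform[OF R(1) ab(1,3) \<phi>] by auto
    fix e :: real assume "e > 0"
    then obtain d where d: "d > 0" "\<And>R R'. grid R a b \<Longrightarrow> grid R' a b \<Longrightarrow> mesh_less R a b d \<Longrightarrow> mesh_less R' a b d \<Longrightarrow>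
      l2dist P (LS m R a b \<phi>) (LS m R' a b \<phi>) \<le> e / 2"
      using cmp[of "e / 2"] by auto
    obtain N where "\<forall>n\<ge>N. mesh_less (R n) a b d" using Rd[OF d(1)] by blast
    then have "\<forall>i\<ge>N. \<forall>j\<ge>N. l2dist P (?X i) (?X j) \<le> e / 2" using d(2) R(1) by blast
    then show "\<exists>N. \<forall>i\<ge>N. \<forall>j\<ge>N. l2dist P (?X i) (?X j) < e"
      using \<open>e > 0\<close> by (intro exI[of _ N]) force
  qed
  then obtain X where X: "X \<in> borel_measurable (F b)" "ms_lim P ?X X" by blast
  have "is_int m a b \<phi> X"
    unfolding is_int_def
  proof (intro conjI allI impI)
    show sqX: "square_int P X" using X by (simp add: ms_lim_iff)
    fix e :: real assume "e > 0"
    then obtain d where d: "d > 0" "\<And>R R'. grid R a b \<Longrightarrow> grid R' a b \<Longrightarrow> mesh_less R a b d \<Longrightarrow> mesh_less R' a b d \<Longrightarrow>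
      l2dist P (LS m R a b \<phi>) (LS m R' a b \<phi>) \<le> e"
      using cmp[of e] by auto
    obtain N where N: "\<forall>n\<ge>N. mesh_less (R n) a b d" using Rd[OF d(1)] by blast
    have "l2dist P (LS m Q a b \<phi>) X \<le> e" if Q: "grid Q a b" "mesh_less Q a b d" for Q
    proof -
      have "(\<lambda>n. e + l2dist P (?X n) X) \<longlonglongrightarrow> e + 0"
        using X(2) by (intro tendsto_intros) (simp add: ms_lim_iff)
      moreover have "l2dist P (LS m Q a b \<phi>) X \<le> e + l2dist P (?X n) X" if "n \<ge> N" for n
        using l2norm_triangle_diff[of P "LS m Q a b \<phi>" "?X n" X] LS_ms_uniform[OF Q(1) ab(1,3) \<phi>]
          LS_ms_uniform[OF R(1) ab(1,3) \<phi>, of m n] sqX d(2)[OF Q(1) R(1)[of n] Q(2)] N that by force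
      ultimately have "l2dist P (LS m Q a b \<phi>) X \<le> e + 0"
        by (intro LIMSEQ_le_const) auto
      then show ?thesis by simp
    qed
    then show "\<exists>d>0. \<forall>R. grid R a b \<longrightarrow> mesh_less R a b d \<longrightarrow>
        l2dist P (LS m R a b \<phi>) X \<le> e" using d(1) by blast
  qed
  then show ?thesis using X(1) by blast
qed

text \<open>A version measurable at the upper limit \<open>b\<close>. This is what makes an inner
  integral, as a process in its upper limit, an admissible integrand for the next integral.\<close>

definition ms_int :: "bool \<Rightarrow> real \<Rightarrow> real \<Rightarrow> (real \<Rightarrow> 'a \<Rightarrow> real) \<Rightarrow> 'a \<Rightarrow> real" where
  "ms_int m a b \<phi> = (SOME X. X \<in> borel_measurable (F b) \<and> is_int m a b \<phi> X)"

lemma ms_int_props: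
  assumes "t \<le> a" "a \<le> b" "b \<le> T" "ms_uniform a b \<phi>"
  shows "ms_int m a b \<phi> \<in> borel_measurable (F b)" "is_int m a b \<phi> (ms_int m a b \<phi>)" "square_int P (ms_int m a b \<phi>)"
  using someI_ex[OF is_int_exists[OF assms, of m]] unfolding ms_int_def[symmetric]
  by (auto simp: is_int_def)

text \<open>Refine \<open>R\<close> until the sum is close to the integral and use the refinement
  bound. The estimate depends on the integrand only through its oscillation over the cells, hence is
  uniform over families of integrands with a common modulus.\<close>

lemma LS_ms_int_bound:
  assumes g: "grid R a b" and ab: "t \<le> a" "b \<le> T"
    and \<phi>: "ms_uniform a b \<phi>" and e: "0 \<le> e"
    and le: "\<And>p u. p \<in> pts R a b \<Longrightarrow> p \<le> u \<Longrightarrow> u < next_pt R p \<Longrightarrow> l2dist P (\<phi> p) (\<phi> u) \<le> e"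
  shows "l2dist P (LS m R a b \<phi>) (ms_int m a b \<phi>) \<le> sqrt (C * (b - a)) * e"
proof (rule field_le_epsilon)
  fix \<eta> :: real assume "\<eta> > 0"
  have ab': "a \<le> b" using g by (simp add: grid_def)
  note I = ms_int_props[OF ab(1) ab' ab(2) \<phi>, of m]
  obtain d where d: "d > 0" "\<And>R. grid R a b \<Longrightarrow> mesh_less R a b d \<Longrightarrow>
      l2dist P (LS m R a b \<phi>) (ms_int m a b \<phi>) \<le> \<eta>"
    using I(2) \<open>\<eta> > 0\<close> unfolding is_int_def by blast
  obtain R' where R': "grid R' a b" "R \<subseteq> R'" "mesh_less R' a b d"
    using mesh_less_grid_exists[OF ab' d(1), of R] g by (auto simp: grid_def)
  have "l2dist P (LS m R a b \<phi>) (ms_int m a b \<phi>)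
    \<le> l2dist P (LS m R a b \<phi>) (LS m R' a b \<phi>) + l2dist P (LS m R' a b \<phi>) (ms_int m a b \<phi>)"
    using I(3) LS_ms_uniform[OF g ab \<phi>] LS_ms_uniform[OF R'(1) ab \<phi>] by (intro l2norm_triangle_diff) auto
  also have "\<dots> \<le> sqrt (C * (b - a)) * e + \<eta>"
    using R' d(2) by (intro add_mono LS_refine_bound[OF g _ _ ab \<phi> e le]) (auto simp: grid_def)
  finally show "l2dist P (LS m R a b \<phi>) (ms_int m a b \<phi>) \<le> sqrt (C * (b - a)) * e + \<eta>" .
qed

text \<open>The basic estimate: it contains linearity in the integrand, additivity in the interval and
  continuity, since the integrands may live on different intervals.\<close>

lemma ms_int_family_bound:
  assumes fin: "finite I" and lh: "t \<le> lo" "lo \<le> hi" "hi \<le> T"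
    and AB: "\<And>l. l \<in> I \<Longrightarrow> lo \<le> A l" "\<And>l. l \<in> I \<Longrightarrow> A l \<le> B l" "\<And>l. l \<in> I \<Longrightarrow> B l \<le> hi"
    and \<phi>: "\<And>l. l \<in> I \<Longrightarrow> ms_uniform (A l) (B l) (\<phi> l)"
    and \<beta>: "0 \<le> \<beta>"
    and le: "\<And>u. lo \<le> u \<Longrightarrow> u < hi \<Longrightarrow>
      l2norm P (\<lambda>w. \<Sum>l\<in>{l\<in>I. A l \<le> u \<and> u < B l}. c l * \<phi> l u w) \<le> \<beta>"
  shows "l2norm P (\<lambda>w. \<Sum>l\<in>I. c l * ms_int m (A l) (B l) (\<phi> l) w) \<le> sqrt (C * (hi - lo)) * \<beta>"
proof (rule field_le_epsilon)
  fix e :: real assume "e > 0"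
  define e1 where "e1 = e / ((\<Sum>l\<in>I. \<bar>c l\<bar>) + 1)"
  have csum: "0 \<le> (\<Sum>l\<in>I. \<bar>c l\<bar>)" by (simp add: sum_nonneg)
  then have pos: "0 < (\<Sum>l\<in>I. \<bar>c l\<bar>) + 1" by linarith
  then have "e1 > 0" using \<open>e > 0\<close> unfolding e1_def by (intro divide_pos_pos) auto
  moreover from this have "(\<Sum>l\<in>I. \<bar>c l\<bar>) * e1 \<le> ((\<Sum>l\<in>I. \<bar>c l\<bar>) + 1) * e1"
    by (intro mult_right_mono) auto
  moreover have "((\<Sum>l\<in>I. \<bar>c l\<bar>) + 1) * e1 = e" using pos unfolding e1_def by simp
  ultimately have e1: "e1 > 0" "(\<Sum>l\<in>I. \<bar>c l\<bar>) * e1 \<le> e" by auto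
  have Ab: "t \<le> A l" "A l \<le> B l" "B l \<le> T" if "l \<in> I" for l
    using AB[OF that] lh by auto
  note Ip = ms_int_props[OF Ab \<phi>]
  have "\<forall>l\<in>I. \<exists>d>0. \<forall>R. grid R (A l) (B l) \<longrightarrow> mesh_less R (A l) (B l) d \<longrightarrow>
      l2dist P (LS m R (A l) (B l) (\<phi> l)) (ms_int m (A l) (B l) (\<phi> l)) \<le> e1"
    using Ip(2) e1(1) unfolding is_int_def by blast
  then obtain D where D: "\<And>l. l \<in> I \<Longrightarrow> D l > 0" "\<And>l R. l \<in> I \<Longrightarrow> grid R (A l) (B l) \<Longrightarrow>
      mesh_less R (A l) (B l) (D l) \<Longrightarrow>
      l2dist P (LS m R (A l) (B l) (\<phi> l)) (ms_int m (A l) (B l) (\<phi> l)) \<le> e1"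
    by metis
  define d where "d = Min (insert 1 (D ` I))"
  have d: "d > 0" "\<And>l. l \<in> I \<Longrightarrow> d \<le> D l"
    using fin D(1) by (auto simp: d_def Min_gr_iff)
  \<comment> \<open>With all end points in one fine grid, the left sum over each interval is a
    partial sum over the same increments.\<close>
  obtain R where R: "grid R lo hi" "A ` I \<union> B ` I \<subseteq> R" "mesh_less R lo hi d"
    using mesh_less_grid_exists[OF lh(2) d(1), of "A ` I \<union> B ` I"] fin by auto
  have finR: "finite R" using R by (simp add: grid_def)
  have gl: "grid R (A l) (B l)" if "l \<in> I" for l
    using R Ab[OF that] that by (auto simp: grid_def)
  have ml: "mesh_less R (A l) (B l) (D l)" if "l \<in> I" for l
    using mesh_less_subset[OF R(3) AB(1)[OF that] AB(3)[OF that]] d(2)[OF that]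
    unfolding mesh_less_def by force
  \<comment> \<open>The total integrand at time \<open>p\<close>: all members whose interval
    contains \<open>p\<close>, including its left and excluding its right end point, in accordance
    with \<open>pts\<close>.\<close>
  define Y where "Y = (\<lambda>p w. \<Sum>l\<in>{l\<in>I. A l \<le> p \<and> p < B l}. c l * \<phi> l p w)"
  have sum_eq: "(\<Sum>l\<in>I. c l * LS m R (A l) (B l) (\<phi> l) w) = LS m R lo hi Y w" for w
  proof -
    have "(\<Sum>l\<in>I. c l * LS m R (A l) (B l) (\<phi> l) w)
      = (\<Sum>l\<in>I. \<Sum>p\<in>{p\<in>pts R lo hi. A l \<le> p \<and> p < B l}. c l * \<phi> l p w * dI m p (next_pt R p) w)"
    proof (rule sum.cong[OF refl])
      fix l assume "l \<in> I"
      then have "pts R (A l) (B l) = {p\<in>pts R lo hi. A l \<le> p \<and> p < B l}"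
        using AB[of l] by (auto simp: pts_def)
      then show "c l * LS m R (A l) (B l) (\<phi> l) w
        = (\<Sum>p\<in>{p\<in>pts R lo hi. A l \<le> p \<and> p < B l}. c l * \<phi> l p w * dI m p (next_pt R p) w)"
        by (simp add: LS_def sum_distrib_left mult.assoc)
    qed
    also have "\<dots> = (\<Sum>p\<in>pts R lo hi. \<Sum>l\<in>{l\<in>I. A l \<le> p \<and> p < B l}. c l * \<phi> l p w * dI m p (next_pt R p) w)"
      using fin finR by (intro sum.swap_restrict) auto
    also have "\<dots> = LS m R lo hi Y w"
      by (simp add: LS_def Y_def sum_distrib_right)
    finally show ?thesis .
  qed
  have Yb: "l2norm P (LS m R lo hi Y) \<le> sqrt (C * (hi - lo)) * \<beta>"
  proof (rule LS_bound(3)[OF R(1) lh(1,3) \<beta>])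
    fix p assume p: "p \<in> pts R lo hi"
    note pb = pts_bounds[OF R(1) p]
    show "l2norm P (Y p) \<le> \<beta>" unfolding Y_def using pb by (intro le) auto
    show "square_int P (Y p)"
      unfolding Y_def using ms_uniformD(2)[OF \<phi>] by (intro square_int_sum square_int_cmult) auto
    show "Y p \<in> borel_measurable (F p)"
      unfolding Y_def
    proof (rule borel_measurable_sum)
      fix l assume "l \<in> {l\<in>I. A l \<le> p \<and> p < B l}"
      then have "\<phi> l p \<in> borel_measurable (F p)" using ms_uniformD(1)[OF \<phi>] by auto
      then show "(\<lambda>w. c l * \<phi> l p w) \<in> borel_measurable (F p)" by measurable
    qed
  qed
  have sqI: "square_int P (\<lambda>w. \<Sum>l\<in>I. c l * ms_int m (A l) (B l) (\<phi> l) w)"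
    using Ip(3) by (intro square_int_sum square_int_cmult)
  have sqL: "square_int P (LS m R (A l) (B l) (\<phi> l))" if "l \<in> I" for l
    using LS_ms_uniform(2)[OF gl[OF that] Ab(1)[OF that] Ab(3)[OF that] \<phi>[OF that]] .
  have "square_int P (\<lambda>w. \<Sum>l\<in>I. c l * LS m R (A l) (B l) (\<phi> l) w)"
    using sqL by (intro square_int_sum square_int_cmult)
  then have sqS: "square_int P (LS m R lo hi Y)" unfolding sum_eq .
  have "l2norm P (\<lambda>w. (\<Sum>l\<in>I. c l * ms_int m (A l) (B l) (\<phi> l) w) - LS m R lo hi Y w)
    = l2norm P (\<lambda>w. \<Sum>l\<in>I. c l * (ms_int m (A l) (B l) (\<phi> l) w - LS m R (A l) (B l) (\<phi> l) w))"
    unfolding sum_eq[symmetric] by (simp add: sum_subtractf right_diff_distrib)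
  also have "\<dots> \<le> (\<Sum>l\<in>I. l2norm P (\<lambda>w. c l * (ms_int m (A l) (B l) (\<phi> l) w - LS m R (A l) (B l) (\<phi> l) w)))"
    using fin sqL Ip(3) by (intro l2norm_sum square_int_cmult square_int_diff)
  also have "\<dots> \<le> (\<Sum>l\<in>I. \<bar>c l\<bar> * e1)"
  proof (rule sum_mono)
    fix l assume l: "l \<in> I"
    show "l2norm P (\<lambda>w. c l * (ms_int m (A l) (B l) (\<phi> l) w - LS m R (A l) (B l) (\<phi> l) w)) \<le> \<bar>c l\<bar> * e1"
      unfolding l2norm_cmult l2norm_minus_commute[of P "ms_int m (A l) (B l) (\<phi> l)"]
      using D(2)[OF l gl[OF l] ml[OF l]] by (intro mult_left_mono) auto
  qed
  also have "\<dots> \<le> e" using e1(2) by (simp add: sum_distrib_right)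
  finally show "l2norm P (\<lambda>w. \<Sum>l\<in>I. c l * ms_int m (A l) (B l) (\<phi> l) w) \<le> sqrt (C * (hi - lo)) * \<beta> + e"
    using l2norm_le_add_diff[OF sqI sqS] Yb by linarith
qed

lemma ms_int_bound:
  assumes "t \<le> a" "a \<le> b" "b \<le> T" "ms_uniform a b \<phi>" "0 \<le> \<beta>"
    and "\<And>u. a \<le> u \<Longrightarrow> u < b \<Longrightarrow> l2norm P (\<phi> u) \<le> \<beta>"
  shows "l2norm P (ms_int m a b \<phi>) \<le> sqrt (C * (b - a)) * \<beta>"
  using ms_int_family_bound[of "{()}" a b "\<lambda>_. a" "\<lambda>_. b" "\<lambda>_. \<phi>" \<beta> "\<lambda>_. 1" m] assms by simp

lemma ms_int_diff_bound:
  assumes "t \<le> a" "a \<le> b" "b \<le> T" "ms_uniform a b \<phi>" "ms_uniform a b \<psi>" "0 \<le> \<beta>"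
    and "\<And>u. a \<le> u \<Longrightarrow> u < b \<Longrightarrow> l2dist P (\<phi> u) (\<psi> u) \<le> \<beta>"
  shows "l2dist P (ms_int m a b \<phi>) (ms_int m a b \<psi>) \<le> sqrt (C * (b - a)) * \<beta>"
  using ms_int_family_bound[of "UNIV::bool set" a b "\<lambda>_. a" "\<lambda>_. b" "\<lambda>l. if l then \<phi> else \<psi>" \<beta> "\<lambda>l. if l then 1 else -1" m] assms
  by (simp add: UNIV_bool)

lemma ms_int_split:
  assumes abc: "t \<le> a" "a \<le> b" "b \<le> c" "c \<le> T" and \<phi>: "ms_uniform a c \<phi>"
  shows "l2norm P (\<lambda>w. ms_int m a c \<phi> w - ms_int m a b \<phi> w - ms_int m b c \<phi> w) = 0"
proof -
  \<comment> \<open>Member 0 is the integral over \<open>[a,c]\<close>, members 1 and 2 are those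
    over the two parts with sign reversed. At each time exactly two members are active and cancel,
    so the basic estimate holds with bound 0.\<close>
  let ?A = "\<lambda>l::nat. if l = 2 then b else a" and ?B = "\<lambda>l::nat. if l = 1 then b else c"
  have "l2norm P (\<lambda>w. \<Sum>l\<in>{0,1,2::nat}. (if l = 0 then 1 else -1) * ms_int m (?A l) (?B l) \<phi> w) \<le> sqrt (C * (c - a)) * 0"
  proof (rule ms_int_family_bound)
    fix u assume u: "a \<le> u" "u < c"
    show "l2norm P (\<lambda>w. \<Sum>l\<in>{l\<in>{0,1,2::nat}. ?A l \<le> u \<and> u < ?B l}. (if l = 0 then 1 else -1) * \<phi> u w) \<le> 0"
    proof (cases "u < b")
      case True
      then have "{l\<in>{0,1,2::nat}. ?A l \<le> u \<and> u < ?B l} = {0,1}" using u by auto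
      then show ?thesis by (simp add: l2norm_zero)
    next
      case False
      then have "{l\<in>{0,1,2::nat}. ?A l \<le> u \<and> u < ?B l} = {0,2}" using u by auto
      then show ?thesis by (simp add: l2norm_zero)
    qed
  qed (use abc in \<open>auto intro: ms_uniform_subset[OF \<phi>]\<close>)
  then have "l2norm P (\<lambda>w. ms_int m a c \<phi> w - ms_int m a b \<phi> w - ms_int m b c \<phi> w) \<le> 0"
    by (simp add: algebra_simps)
  then show ?thesis by (rule antisym[OF _ l2norm_nonneg])
qed

text \<open>Upper limit and integrand vary together: the longer integral is split at
  \<open>b\<close>, the integrands are compared on the common part, and the remainder lives on a
  short interval. This serves both the continuity of iterated integrals in the outer variables and
  the truncation of an integral at a grid point.\<close>

lemma ms_int_continuity_bound:
  assumes c: "t \<le> c" "c \<le> b" "b \<le> b'" "b' \<le> T"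
    and \<phi>: "ms_uniform c b \<phi>" "ms_uniform c b' \<phi>'" and e: "0 \<le> e" "0 \<le> B"
    and le: "\<And>u. c \<le> u \<Longrightarrow> u < b \<Longrightarrow> l2dist P (\<phi>' u) (\<phi> u) \<le> e"
    and leB: "\<And>u. b \<le> u \<Longrightarrow> u < b' \<Longrightarrow> l2norm P (\<phi>' u) \<le> B"
  shows "l2dist P (ms_int m c b' \<phi>') (ms_int m c b \<phi>) \<le> sqrt (C * (T - t)) * e + sqrt (C * (b' - b)) * B"
proof -
  have g: "ms_uniform c b \<phi>'" "ms_uniform b b' \<phi>'" using c by (auto intro: ms_uniform_subset[OF \<phi>(2)])
  have sq: "square_int P (ms_int m c b' \<phi>')" "square_int P (ms_int m c b \<phi>')" "square_int P (ms_int m b b' \<phi>')" "square_int P (ms_int m c b \<phi>)"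
    using c \<phi> g by (auto intro!: ms_int_props(3))
  have 0: "l2norm P (\<lambda>w. ms_int m c b' \<phi>' w - ms_int m c b \<phi>' w - ms_int m b b' \<phi>' w) = 0"
    by (rule ms_int_split[OF c \<phi>(2)])
  have "l2dist P (ms_int m c b \<phi>') (ms_int m c b \<phi>) \<le> sqrt (C * (b - c)) * e"
    using c \<phi> g e le by (intro ms_int_diff_bound) auto
  also have "\<dots> \<le> sqrt (C * (T - t)) * e"
    using c e C_bounds by (intro mult_right_mono) auto
  finally have 1: "l2dist P (ms_int m c b \<phi>') (ms_int m c b \<phi>) \<le> sqrt (C * (T - t)) * e" .
  have 2: "l2norm P (ms_int m b b' \<phi>') \<le> sqrt (C * (b' - b)) * B"
    using c g e leB by (intro ms_int_bound) auto
  \<comment> \<open>Additivity holds only up to a null set, so its defect stays in the decomposition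
    as a term of norm 0.\<close>
  have "l2norm P (\<lambda>w. (ms_int m c b' \<phi>' w - ms_int m c b \<phi>' w - ms_int m b b' \<phi>' w)
      + ((ms_int m c b \<phi>' w - ms_int m c b \<phi> w) + ms_int m b b' \<phi>' w))
    \<le> l2norm P (\<lambda>w. ms_int m c b' \<phi>' w - ms_int m c b \<phi>' w - ms_int m b b' \<phi>' w)
      + l2norm P (\<lambda>w. (ms_int m c b \<phi>' w - ms_int m c b \<phi> w) + ms_int m b b' \<phi>' w)"
    using sq by (intro l2norm_triangle square_int_add square_int_diff) auto
  also have "l2norm P (\<lambda>w. (ms_int m c b \<phi>' w - ms_int m c b \<phi> w) + ms_int m b b' \<phi>' w)
    \<le> l2dist P (ms_int m c b \<phi>') (ms_int m c b \<phi>) + l2norm P (ms_int m b b' \<phi>')"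
    using sq by (intro l2norm_triangle square_int_diff) auto
  finally show ?thesis using 0 1 2 by (simp add: algebra_simps)
qed

end

section \<open>Partitions as grids\<close>

lemma partition_mono:
  assumes "is_partition a b N \<tau>" "i < j" "j \<le> N"
  shows "\<tau> i < \<tau> j"
  using assms(2,3)
proof (induct j)
  case (Suc j)
  have "\<tau> j < \<tau> (Suc j)" using assms(1) Suc by (auto simp: is_partition_def)
  then show ?case using Suc by (cases "i = j") auto
qed simp

lemma partition_mono_le:
  assumes "is_partition a b N \<tau>" "i \<le> j" "j \<le> N"
  shows "\<tau> i \<le> \<tau> j"
  using partition_mono[OF assms(1), of i j] assms by (cases "i = j") auto

lemma partition_range:
  assumes "is_partition a b N \<tau>" "l \<le> N"
  shows "a \<le> \<tau> l" "\<tau> l \<le> b"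
  using partition_mono_le[OF assms(1), of 0 l] partition_mono_le[OF assms(1), of l N] assms
  by (auto simp: is_partition_def)

lemma partition_grid:
  assumes p: "is_partition a b N \<tau>"
  defines "R \<equiv> \<tau> ` {..N}"
  shows "grid R a b" and "\<And>l. l < N \<Longrightarrow> next_pt R (\<tau> l) = \<tau> (Suc l)"
    and "pts R a b = \<tau> ` {..<N}" and "inj_on \<tau> {..<N}"
proof -
  note r = partition_range[OF p] and mono = partition_mono[OF p]
  have ends: "\<tau> 0 = a" "\<tau> N = b" using p by (auto simp: is_partition_def)
  have "a \<in> R" "b \<in> R" using ends by (auto simp: R_def)
  then show g: "grid R a b" using r[of 0] ends by (auto simp: grid_def R_def)
  show "next_pt R (\<tau> l) = \<tau> (Suc l)" if "l < N" for l
    unfolding next_pt_def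
  proof (rule Min_eqI)
    show "\<tau> (Suc l) \<in> {q \<in> R. \<tau> l < q}" using that mono[of l "Suc l"] by (auto simp: R_def)
    fix y assume "y \<in> {q \<in> R. \<tau> l < q}"
    then obtain i where i: "i \<le> N" "y = \<tau> i" "\<tau> l < \<tau> i" by (auto simp: R_def)
    then have "\<not> i \<le> l" using partition_mono_le[OF p, of i l] that by force
    then show "\<tau> (Suc l) \<le> y" using partition_mono_le[OF p, of "Suc l" i] i by auto
  qed (simp add: R_def)
  show "pts R a b = \<tau> ` {..<N}"
  proof
    show "pts R a b \<subseteq> \<tau> ` {..<N}" using ends by (auto simp: pts_def R_def) (metis imageI le_neq_implies_less lessThan_iff order.irrefl)
    show "\<tau> ` {..<N} \<subseteq> pts R a b"
      using r mono[of _ N] ends by (auto simp: pts_def R_def)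
  qed
  show "inj_on \<tau> {..<N}"
    by (rule linorder_inj_onI) (use mono in \<open>force+\<close>)
qed

lemma partition_sum:
  assumes p: "is_partition a b N \<tau>"
  shows "(\<Sum>l<N. f (\<tau> l) (\<tau> (Suc l))) = (\<Sum>p\<in>pts (\<tau> ` {..N}) a b. f p (next_pt (\<tau> ` {..N}) p))"
  unfolding partition_grid(3)[OF p] by (subst sum.reindex[OF partition_grid(4)[OF p]])
    (simp add: partition_grid(2)[OF p])

lemma partition_mesh_less:
  assumes p: "is_partition a b N \<tau>" and "mesh N \<tau> < d"
  shows "mesh_less (\<tau> ` {..N}) a b d" and "\<And>l. l < N \<Longrightarrow> \<tau> (Suc l) - \<tau> l < d" and "0 < d"
proof -
  have "\<tau> (Suc l) - \<tau> l \<le> mesh N \<tau>" if "l < N" for l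
    unfolding mesh_def using that by (intro Max_ge) auto
  then show *: "\<And>l. l < N \<Longrightarrow> \<tau> (Suc l) - \<tau> l < d" using assms(2) by fastforce
  then show "mesh_less (\<tau> ` {..N}) a b d"
    unfolding mesh_less_def partition_grid(3)[OF p] by (auto simp: partition_grid(2)[OF p])
  have "0 \<le> mesh N \<tau>" unfolding mesh_def by (intro Max_ge) auto
  then show "0 < d" using assms(2) by simp
qed

lemma partition_floor:
  assumes p: "is_partition a b N \<tau>" and l: "l < N" "\<tau> l \<le> u" "u < \<tau> (Suc l)"
  shows "floor_pt (\<tau> ` {..N}) u = \<tau> l"
proof (rule flr_eqI)
  show "\<tau> l < \<tau> N" using partition_mono[OF p l(1)] by simp
  show "u < next_pt (\<tau> ` {..N}) (\<tau> l)" using partition_grid(2)[OF p l(1)] l by simp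
qed (use l in auto)

text \<open>The integrals are defined by conditions on all partition sequences; uniqueness of their
  values needs at least one such sequence.\<close>

lemma partition_seq_exists:
  assumes "a \<le> b"
  obtains N \<tau> where "partition_seq a b N \<tau>"
proof (cases "a = b")
  case True
  \<comment> \<open>Partition points increase strictly, so a one-point interval has only the
    partition without cells.\<close>
  have "partition_seq a b (\<lambda>_. 0) (\<lambda>_ _. a)"
    using True by (auto simp: partition_seq_def is_partition_def mesh_def)
  then show ?thesis by (rule that)
next
  case False
  then have ab: "a < b" using assms by simp
  define \<tau> where "\<tau> = (\<lambda>n l. a + real l * ((b - a) / real (Suc n)))"
  have d: "\<tau> n (Suc l) - \<tau> n l = (b - a) / real (Suc n)" for n l
    unfolding \<tau>_def of_nat_Suc[of l] distrib_right by simp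
  have "mesh (Suc n) (\<tau> n) = (b - a) / real (Suc n)" for n
  proof -
    have "insert 0 ((\<lambda>l. \<tau> n (Suc l) - \<tau> n l) ` {..<Suc n}) = {0, (b - a) / real (Suc n)}"
      unfolding d by auto
    then show ?thesis using ab by (simp add: mesh_def)
  qed
  moreover have "(\<lambda>n. (b - a) / real (Suc n)) \<longlonglongrightarrow> 0"
    by (rule LIMSEQ_Suc) (rule lim_const_over_n)
  moreover have "is_partition a b (Suc n) (\<tau> n)" for n
    unfolding is_partition_def
  proof (intro conjI allI impI)
    have "0 < (b - a) / real (Suc n)" using ab by simp
    then show "\<tau> n l < \<tau> n (Suc l)" for l using d[of n l] by linarith
    show "\<tau> n (Suc n) = b" by (simp add: \<tau>_def del: of_nat_Suc)
  qed (simp add: \<tau>_def)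
  ultimately have "partition_seq a b Suc \<tau>" by (simp add: partition_seq_def)
  then show ?thesis by (rule that)
qed

lemma partition_seq_mesh:
  assumes "partition_seq a b N \<tau>" "0 < d"
  shows "\<forall>\<^sub>F n in sequentially. mesh (N n) (\<tau> n) < d"
  using assms by (auto simp: partition_seq_def intro: order_tendstoD)

lemma floor_close:
  assumes g: "grid R a b" and m: "mesh_less R a b d" and d: "0 < d" and u: "u \<in> {a..b}"
  shows "\<bar>floor_pt R u - u\<bar> < d" "\<bar>u - floor_pt R u\<bar> < d"
proof -
  have R: "finite R" "a \<in> R" "b \<in> R" "a \<le> u" using g u by (auto simp: grid_def)
  note f = flr_props[OF R(1,2,4)]
  have "\<bar>floor_pt R u - u\<bar> < d"
  proof (cases "u < b")
    case True
    then have "floor_pt R u \<in> pts R a b" using f by (auto simp: pts_def)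
    then have "next_pt R (floor_pt R u) - floor_pt R u < d" using m by (simp add: mesh_less_def)
    then show ?thesis using flr_nxt[OF R(1,2,4,3) True] f(2) by linarith
  next
    case False
    then have "u = b" using u by simp
    then have "floor_pt R u = u" using f(2) f(4)[OF R(3)] by simp
    then show ?thesis using d by simp
  qed
  then show "\<bar>floor_pt R u - u\<bar> < d" "\<bar>u - floor_pt R u\<bar> < d" by auto
qed

text \<open>In the application \<open>g\<close> is the weighted energy of a difference of processes
  at time \<open>u\<close>, and nothing is known about its measurability in \<open>u\<close>. The
  integral of such a function is a lower integral, for which additivity may fail.\<close>

lemma nn_integral_le_add_const:
  assumes k: "k \<in> borel_measurable Q" and A: "A \<in> sets Q" and c: "c < \<infinity>"
    and le: "\<And>x. x \<in> space Q \<Longrightarrow> k x \<le> 2 * g x + c * indicator A x"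
  shows "(\<integral>\<^sup>+x. k x \<partial>Q) \<le> 2 * (\<integral>\<^sup>+x. g x \<partial>Q) + c * emeasure Q A"
proof -
  \<comment> \<open>\<open>g\<close> need not be measurable, hence the detour over the measurable function \<open>D\<close>\<close>
  define D where "D = (\<lambda>x. ennreal (1 / 2) * (k x - c * indicator A x))"
  have D [measurable]: "D \<in> borel_measurable Q" using k A unfolding D_def by measurable
  have half: "2 * (ennreal (1 / 2) * x) = x" "ennreal (1 / 2) * (2 * x) = x" for x :: ennreal
  proof -
    have "2 * ennreal (1 / 2) = 1"
      by (metis ennreal_1 ennreal_mult' ennreal_numeral mult_2 field_sum_of_halves zero_le_numeral)
    then show "2 * (ennreal (1 / 2) * x) = x" "ennreal (1 / 2) * (2 * x) = x"
      unfolding mult.assoc[symmetric] mult.commute[of "ennreal (1 / 2)" 2] by simp_all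
  qed
  have "(\<integral>\<^sup>+x. k x \<partial>Q) \<le> (\<integral>\<^sup>+x. 2 * D x + c * indicator A x \<partial>Q)"
  proof (rule nn_integral_mono)
    fix x
    show "k x \<le> 2 * D x + c * indicator A x"
      unfolding D_def half by (cases "c * indicator A x \<le> k x")
        (auto simp: diff_add_cancel_ennreal intro: add_increasing)
  qed
  also have "\<dots> = 2 * (\<integral>\<^sup>+x. D x \<partial>Q) + (\<integral>\<^sup>+x. c * indicator A x \<partial>Q)"
    using A by (subst nn_integral_add) (auto simp: nn_integral_cmult)
  also have "\<dots> \<le> 2 * (\<integral>\<^sup>+x. g x \<partial>Q) + c * emeasure Q A"
  proof (intro add_mono mult_left_mono nn_integral_mono)
    fix x assume "x \<in> space Q"
    from le[OF this] have "k x - c * indicator A x \<le> 2 * g x"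
      using c by (auto simp: ennreal_minus_le_iff add.commute indicator_def)
    from mult_left_mono[OF this, of "ennreal (1 / 2)"] show "D x \<le> g x"
      unfolding D_def half by simp
  qed (use A in \<open>simp_all add: nn_integral_cmult_indicator\<close>)
  finally show ?thesis .
qed

lemma ennreal_tendsto_0I:
  fixes f :: "nat \<Rightarrow> ennreal"
  assumes "\<And>e. 0 < e \<Longrightarrow> \<forall>\<^sub>F n in sequentially. f n \<le> ennreal e"
  shows "f \<longlonglongrightarrow> 0"
proof (rule order_tendstoI)
  fix a :: ennreal assume "0 < a"
  then obtain r where r: "0 < r" "r < a" using dense by blast
  then obtain e where e: "r = ennreal e" "0 < e" by (cases r) auto
  show "\<forall>\<^sub>F n in sequentially. f n < a"
    using assms[OF e(2)] by eventually_elim (use r e in auto)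
qed simp

context bounded_martingale_setting
begin

section \<open>Agreement with the definition of the integrals\<close>

lemma partition_LS:
  assumes "is_partition a b N \<tau>"
  shows "(\<Sum>l<N. \<phi> (\<tau> l) w * dI m (\<tau> l) (\<tau> (Suc l)) w) = LS m (\<tau> ` {..N}) a b \<phi> w"
  unfolding LS_def by (rule partition_sum[OF assms])

lemma is_int_ms_lim:
  assumes ab: "t \<le> a" "a \<le> b" "b \<le> T" and \<phi>: "ms_uniform a b \<phi>" and I: "is_int m a b \<phi> X"
    and ps: "partition_seq a b N \<tau>"
  shows "ms_lim P (\<lambda>n w. \<Sum>l<N n. \<phi> (\<tau> n l) w * dI m (\<tau> n l) (\<tau> n (Suc l)) w) X"
proof -
  have p: "is_partition a b (N n) (\<tau> n)" for n using ps by (simp add: partition_seq_def)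
  show ?thesis
    unfolding partition_LS[OF p] ms_lim_iff
  proof (intro conjI allI)
    show "square_int P (LS m (\<tau> n ` {..N n}) a b \<phi>)" for n
      by (rule LS_ms_uniform(2)[OF partition_grid(1)[OF p] ab(1,3) \<phi>])
    show "square_int P X" using I by (simp add: is_int_def)
    show "(\<lambda>n. l2dist P (LS m (\<tau> n ` {..N n}) a b \<phi>) X) \<longlonglongrightarrow> 0"
    proof (rule LIMSEQ_I)
      fix e :: real assume "e > 0"
      then obtain d where d: "d > 0" "\<And>R. grid R a b \<Longrightarrow> mesh_less R a b d \<Longrightarrow>
          l2dist P (LS m R a b \<phi>) X \<le> e / 2"
        using I unfolding is_int_def by (metis half_gt_zero)
      obtain n0 where "\<And>n. n \<ge> n0 \<Longrightarrow> mesh (N n) (\<tau> n) < d"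
        using partition_seq_mesh[OF ps d(1)] by (auto simp: eventually_sequentially)
      then have "\<And>n. n \<ge> n0 \<Longrightarrow> l2dist P (LS m (\<tau> n ` {..N n}) a b \<phi>) X \<le> e / 2"
        using d(2)[OF partition_grid(1)[OF p]] partition_mesh_less(1)[OF p] by blast
      then show "\<exists>n0. \<forall>n\<ge>n0. norm (l2dist P (LS m (\<tau> n ` {..N n}) a b \<phi>) X - 0) < e"
        using \<open>e > 0\<close> by (intro exI[of _ n0]) (force simp: l2norm_nonneg)
    qed
  qed
qed

text \<open>The defining sums use arbitrary intermediate points, where the integrand may look ahead
  of the left end point. Since increments of time are deterministic and add up to
  \<open>b - a\<close>, the triangle inequality suffices to compare with left end points.\<close>

lemma ms_uniform_time_integral:
  assumes ab: "t \<le> a" "a \<le> b" "b \<le> T" and \<phi>: "ms_uniform a b \<phi>"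
  shows "has_time_integral P a b \<phi> (ms_int False a b \<phi>)"
  unfolding has_time_integral_def
proof (intro allI impI, elim conjE)
  fix N \<tau> \<sigma> assume ps: "partition_seq a b N \<tau>"
    and \<sigma>: "\<forall>n. \<forall>l<N n. \<sigma> n l \<in> {\<tau> n l..\<tau> n (Suc l)}"
  have p: "is_partition a b (N n) (\<tau> n)" for n using ps by (simp add: partition_seq_def)
  have r: "\<tau> n l \<in> {a..b}" "\<tau> n (Suc l) \<in> {a..b}" "\<sigma> n l \<in> {a..b}" "0 \<le> \<tau> n (Suc l) - \<tau> n l" if "l < N n" for n l
  proof -
    have \<sigma>l: "\<tau> n l \<le> \<sigma> n l" "\<sigma> n l \<le> \<tau> n (Suc l)" using \<sigma> that by auto
    show "\<tau> n l \<in> {a..b}" "\<tau> n (Suc l) \<in> {a..b}" "\<sigma> n l \<in> {a..b}" "0 \<le> \<tau> n (Suc l) - \<tau> n l"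
      using partition_range[OF p, of l n] partition_range[OF p, of "Suc l" n] that \<sigma>l by auto
  qed
  have sq: "square_int P (\<lambda>w. \<Sum>l<N n. \<phi> (f l) w * (\<tau> n (Suc l) - \<tau> n l))"
    if "\<And>l. l < N n \<Longrightarrow> f l \<in> {a..b}" for f n
    using that ms_uniformD(2)[OF \<phi>] by (intro square_int_sum square_int_multc) auto
  show "ms_lim P (\<lambda>n w. \<Sum>l<N n. \<phi> (\<sigma> n l) w * (\<tau> n (Suc l) - \<tau> n l)) (ms_int False a b \<phi>)"
  proof (rule ms_lim_approx)
    show "ms_lim P (\<lambda>n w. \<Sum>l<N n. \<phi> (\<tau> n l) w * (\<tau> n (Suc l) - \<tau> n l)) (ms_int False a b \<phi>)"
      using is_int_ms_lim[OF ab \<phi> ms_int_props(2)[OF ab \<phi>] ps, of False] by (simp add: dI_False)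
    show "square_int P (\<lambda>w. \<Sum>l<N n. \<phi> (\<sigma> n l) w * (\<tau> n (Suc l) - \<tau> n l))" for n
      using r by (intro sq) auto
    let ?D = "\<lambda>n w. (\<Sum>l<N n. \<phi> (\<sigma> n l) w * (\<tau> n (Suc l) - \<tau> n l)) - (\<Sum>l<N n. \<phi> (\<tau> n l) w * (\<tau> n (Suc l) - \<tau> n l))"
    show "(\<lambda>n. l2norm P (?D n)) \<longlonglongrightarrow> 0"
    proof (rule LIMSEQ_I)
      fix e :: real assume "e > 0"
      define e' where "e' = e / (b - a + 1)"
      have e': "e' > 0" "(b - a) * e' < e" using ab \<open>e > 0\<close> by (auto simp: e'_def field_simps)
      obtain d where d: "0 < d" "\<And>u v. u \<in> {a..b} \<Longrightarrow> v \<in> {a..b} \<Longrightarrow> \<bar>u - v\<bar> < d \<Longrightarrow>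
          l2dist P (\<phi> u) (\<phi> v) < e'"
        using ms_uniform_modulus[OF \<phi> e'(1)] by metis
      obtain n0 where n0: "\<And>n. n \<ge> n0 \<Longrightarrow> mesh (N n) (\<tau> n) < d"
        using partition_seq_mesh[OF ps d(1)] by (auto simp: eventually_sequentially)
      have "l2norm P (?D n) < e" if "n \<ge> n0" for n
      proof -
        have "?D n = (\<lambda>w. \<Sum>l<N n. (\<tau> n (Suc l) - \<tau> n l) * (\<phi> (\<sigma> n l) w - \<phi> (\<tau> n l) w))"
          unfolding sum_subtractf[symmetric] by (simp add: algebra_simps)
        then have "l2norm P (?D n) \<le> (\<Sum>l<N n. l2norm P (\<lambda>w. (\<tau> n (Suc l) - \<tau> n l) * (\<phi> (\<sigma> n l) w - \<phi> (\<tau> n l) w)))"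
          using r ms_uniformD(2)[OF \<phi>] by (simp only:) (intro l2norm_sum square_int_cmult square_int_diff; auto)
        also have "\<dots> \<le> (\<Sum>l<N n. (\<tau> n (Suc l) - \<tau> n l) * e')"
        proof (rule sum_mono)
          fix l assume "l \<in> {..<N n}"
          then have l: "l < N n" by simp
          have "\<bar>\<sigma> n l - \<tau> n l\<bar> < d"
            using partition_mesh_less(2)[OF p n0[OF that] l] \<sigma> l by force
          then show "l2norm P (\<lambda>w. (\<tau> n (Suc l) - \<tau> n l) * (\<phi> (\<sigma> n l) w - \<phi> (\<tau> n l) w)) \<le> (\<tau> n (Suc l) - \<tau> n l) * e'"
            unfolding l2norm_cmult using r[OF l] d(2)[of "\<sigma> n l" "\<tau> n l"]
            by (simp add: mult_left_mono less_imp_le)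
        qed
        also have "\<dots> = (b - a) * e'"
          using p[of n] by (simp add: sum_distrib_right[symmetric] sum_lessThan_telescope is_partition_def)
        finally show ?thesis using e'(2) by simp
      qed
      then show "\<exists>n0. \<forall>n\<ge>n0. norm (l2norm P (?D n) - 0) < e" by (auto simp: l2norm_nonneg)
    qed
  qed
qed

section \<open>Step processes and agreement with the martingale integral\<close>

abbreviation energy :: "real set \<Rightarrow> real \<Rightarrow> real \<Rightarrow> (real \<Rightarrow> 'a \<Rightarrow> real) \<Rightarrow> ennreal" where
  "energy R a b Y \<equiv> \<Sum>p\<in>pts R a b. \<integral>\<^sup>+w. ennreal ((Y p w * dI True p (next_pt R p) w)\<^sup>2) \<partial>P"

text \<open>A step integrand does not depend on time within a cell, so measurability of
  \<open>h\<close> in time comes from \<open>\<rho>\<close> alone; summing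
  \<open>nn_isometry\<close> over the cells gives the equation.\<close>

lemma step_isometry:
  assumes g: "grid R a b" and ab: "0 \<le> a" "b \<le> T"
    and Y: "\<And>p. p \<in> pts R a b \<Longrightarrow> Y p \<in> borel_measurable (F p)"
  defines "h \<equiv> \<lambda>\<tau>. (rho_energy \<tau> (Y (floor_pt R \<tau>))) * indicator {a..<b} \<tau>"
  shows "h \<in> borel_measurable lborel"
    and "energy R a b Y = (\<integral>\<^sup>+\<tau>. h \<tau> \<partial>lborel)"
proof -
  note pb = pts_bounds[OF g]
  have fin: "finite R" "a \<in> R" "b \<in> R" using g by (auto simp: grid_def)
  define H where "H = (\<lambda>p \<tau>. (\<integral>\<^sup>+w. ennreal ((Y p w)\<^sup>2 * \<rho> (max 0 (min \<tau> T)) w) \<partial>P) * indicator {p..<next_pt R p} \<tau>)"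
  have H: "H p \<in> borel_measurable lborel" if p: "p \<in> pts R a b" for p
  proof -
    interpret pair_sigma_finite lborel P ..
    have [measurable]: "(\<lambda>(\<tau>, w). \<rho> (max 0 (min \<tau> T)) w) \<in> borel_measurable (lborel \<Otimes>\<^sub>M P)"
      using rho_clamp_measurable by (simp cong: measurable_cong_sets)
    have [measurable]: "Y p \<in> borel_measurable P"
      using Y[OF p] pb[OF p] ab by (intro adapted_P[of p]) auto
    show ?thesis unfolding H_def by measurable
  qed
  have hH: "h \<tau> = (\<Sum>p\<in>pts R a b. H p \<tau>)" for \<tau>
  proof (cases "\<tau> \<in> {a..<b}")
    case True
    note f = flr_props[OF fin(1,2), of \<tau>]
    have q: "floor_pt R \<tau> \<in> pts R a b" "\<tau> < next_pt R (floor_pt R \<tau>)" "floor_pt R \<tau> \<le> \<tau>"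
      using f True flr_nxt[OF fin(1,2) _ fin(3), of \<tau>] by (auto simp: pts_def)
    have "H p \<tau> = 0" if "p \<in> pts R a b" "p \<noteq> floor_pt R \<tau>" for p
    proof -
      have "\<not> (p \<le> \<tau> \<and> \<tau> < next_pt R p)"
        using flr_eqI[OF fin(1) pb(6)[OF that(1)] fin(3) pb(2)[OF that(1)], of \<tau>] that(2) by auto
      then show ?thesis by (auto simp: H_def)
    qed
    then have "(\<Sum>p\<in>pts R a b. H p \<tau>) = (\<Sum>p\<in>{floor_pt R \<tau>}. H p \<tau>)"
      using q fin by (intro sum.mono_neutral_right) auto
    also have "\<dots> = h \<tau>" using q True ab by (simp add: H_def h_def)
    finally show ?thesis by simp
  next
    case False
    have "H p \<tau> = 0" if "p \<in> pts R a b" for p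
      using pb[OF that] False by (auto simp: H_def indicator_def)
    then show ?thesis using False by (simp add: h_def)
  qed
  then have h_eq: "h = (\<lambda>\<tau>. \<Sum>p\<in>pts R a b. H p \<tau>)" by auto
  show "h \<in> borel_measurable lborel" unfolding h_eq using H by (intro borel_measurable_sum)
  have "(\<integral>\<^sup>+\<tau>. h \<tau> \<partial>lborel) = (\<Sum>p\<in>pts R a b. \<integral>\<^sup>+\<tau>. H p \<tau> \<partial>lborel)"
    unfolding h_eq using H by (intro nn_integral_sum)
  also have "\<dots> = energy R a b Y"
  proof (rule sum.cong[OF refl])
    fix p assume p: "p \<in> pts R a b"
    have "(\<integral>\<^sup>+\<tau>. H p \<tau> \<partial>lborel)
      = (\<integral>\<^sup>+\<tau>\<in>{p..next_pt R p}. (rho_energy \<tau> (Y p)) \<partial>lborel)"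
    proof (rule nn_integral_cong_AE)
      \<comment> \<open>The cells here are half-open, the intervals of \<open>nn_isometry\<close>
        closed; they differ in one point.\<close>
      have "AE \<tau> in lborel. \<tau> \<noteq> next_pt R p" by (rule AE_lborel_singleton)
      then show "AE \<tau> in lborel. H p \<tau> = (rho_energy \<tau> (Y p)) * indicator {p..next_pt R p} \<tau>"
      proof eventually_elim
        case (elim \<tau>)
        then show ?case using pb[OF p] ab by (auto simp: H_def indicator_def)
      qed
    qed
    also have "\<dots> = (\<integral>\<^sup>+w. ennreal ((Y p w * dI True p (next_pt R p) w)\<^sup>2) \<partial>P)"
      unfolding dI_True using pb[OF p] ab Y[OF p] by (intro nn_isometry[symmetric]) auto
    finally show "(\<integral>\<^sup>+\<tau>. H p \<tau> \<partial>lborel) = (\<integral>\<^sup>+w. ennreal ((Y p w * dI True p (next_pt R p) w)\<^sup>2) \<partial>P)" .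
  qed
  finally show "energy R a b Y = (\<integral>\<^sup>+\<tau>. h \<tau> \<partial>lborel)" ..
qed

text \<open>Finite energy does not make \<open>Y p\<close> square integrable, since
  \<open>\<rho>\<close> may vanish. It does make each product with the increment square integrable,
  and this is all that \<open>LS_mart\<close> asks for.\<close>

lemma LS_mart_of_finite:
  assumes g: "grid R a b" and ab: "0 \<le> a" "b \<le> T"
    and Y: "\<And>p. p \<in> pts R a b \<Longrightarrow> Y p \<in> borel_measurable (F p)"
    and fin: "energy R a b Y < \<infinity>"
  shows "square_int P (LS True R a b Y)"
    and "ennreal ((l2norm P (LS True R a b Y))\<^sup>2)
      = energy R a b Y"
proof -
  have finR: "finite (pts R a b)" using g by (simp add: grid_def)
  have sq: "square_int P (\<lambda>w. Y p w * dI True p (next_pt R p) w)" if p: "p \<in> pts R a b" for p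
  proof -
    note pb = pts_bounds[OF g p]
    have "(\<lambda>w. Y p w * dI True p (next_pt R p) w) \<in> borel_measurable P"
      using adapted_P[OF _ Y[OF p]] adapted_P[OF _ dI_adapted, of "next_pt R p" p True] pb ab by auto
    moreover have "(\<integral>\<^sup>+w. ennreal ((Y p w * dI True p (next_pt R p) w)\<^sup>2) \<partial>P) < \<infinity>"
      using fin p finR by simp
    ultimately show ?thesis unfolding square_int_def by (auto intro: integrableI_nonneg)
  qed
  show "square_int P (LS True R a b Y)" by (rule LS_mart(2)[OF g ab Y sq])
  have "(\<integral>\<^sup>+w. ennreal ((Y p w * dI True p (next_pt R p) w)\<^sup>2) \<partial>P)
      = ennreal ((l2norm P (\<lambda>w. Y p w * dI True p (next_pt R p) w))\<^sup>2)" if "p \<in> pts R a b" for p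
    unfolding l2norm_sq using sq[OF that] by (intro nn_integral_eq_integral) (auto simp: square_int_def)
  moreover have m: "(l2norm P (LS True R a b Y))\<^sup>2
      = (\<Sum>p\<in>pts R a b. (l2norm P (\<lambda>w. Y p w * dI True p (next_pt R p) w))\<^sup>2)"
    by (rule LS_mart(3)[OF g ab Y sq])
  ultimately show "ennreal ((l2norm P (LS True R a b Y))\<^sup>2)
      = energy R a b Y"
    by (subst m) (simp add: sum_ennreal[symmetric] del: sum_ennreal)
qed

lemma weighted_norm2_bound:
  assumes ab: "t \<le> a" "a \<le> b" "b \<le> T" and sq: "\<And>u. u \<in> {a..b} \<Longrightarrow> square_int P (\<phi> u)"
    and le: "\<And>u. u \<in> {a..b} \<Longrightarrow> l2norm P (\<phi> u) \<le> \<beta>"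
  shows "weighted_norm2 P \<rho> a b \<phi> \<le> ennreal (K * \<beta>\<^sup>2 * (b - a))"
proof -
  have "weighted_norm2 P \<rho> a b \<phi> \<le> (\<integral>\<^sup>+u\<in>{a..b}. ennreal (K * \<beta>\<^sup>2) \<partial>lborel)"
    unfolding weighted_norm2_def
  proof (rule nn_integral_mono)
    fix u
    have "(rho_energy u (\<phi> u)) \<le> ennreal (K * \<beta>\<^sup>2)" if u: "u \<in> {a..b}"
    proof -
      have "(rho_energy u (\<phi> u)) \<le> ennreal (K * (l2norm P (\<phi> u))\<^sup>2)"
        using u ab by (intro rho_weight_le sq) auto
      also have "\<dots> \<le> ennreal (K * \<beta>\<^sup>2)"
        using le[OF u] K_nonneg by (intro ennreal_leI mult_left_mono power_mono) (auto simp: l2norm_nonneg)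
      finally show ?thesis .
    qed
    then show "(rho_energy u (\<phi> u)) * indicator {a..b} u \<le> ennreal (K * \<beta>\<^sup>2) * indicator {a..b} u"
      by (auto simp: indicator_def)
  qed
  also have "\<dots> = ennreal (K * \<beta>\<^sup>2 * (b - a))"
    using K_nonneg ab by (subst nn_integral_cmult_indicator) (auto simp: ennreal_mult)
  finally show ?thesis .
qed

lemma ms_uniform_H2:
  assumes "t \<le> a" "a \<le> b" "b \<le> T" "ms_uniform a b \<phi>"
  shows "\<phi> \<in> H2 P F \<rho> a b"
proof -
  obtain B where "\<And>u. u \<in> {a..b} \<Longrightarrow> l2norm P (\<phi> u) \<le> B"
    using ms_uniform_bounded[OF assms(4)] by metis
  then have "weighted_norm2 P \<rho> a b \<phi> \<le> ennreal (K * B\<^sup>2 * (b - a))"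
    using assms ms_uniformD(2)[OF assms(4)] by (intro weighted_norm2_bound) auto
  then show ?thesis using ms_uniformD(1)[OF assms(4)] by (auto simp: H2_def le_less_trans)
qed

text \<open>The approximation samples the process at the last partition point not after
  \<open>u\<close>, which is adapted; its weighted error is controlled by the modulus of continuity
  and the bound on \<open>\<rho>\<close>.\<close>

lemma step_approx_exists:
  assumes ab: "t \<le> a" "a \<le> b" "b \<le> T" and \<phi>: "ms_uniform a b \<phi>"
  shows "\<exists>N \<tau> \<psi>. step_approx P F \<rho> a b \<phi> N \<tau> \<psi>"
proof -
  obtain N \<tau> where ps: "partition_seq a b N \<tau>" using partition_seq_exists[OF ab(2)] .
  have p: "is_partition a b (N n) (\<tau> n)" for n using ps by (simp add: partition_seq_def)
  define R where "R = (\<lambda>n. \<tau> n ` {..N n})"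
  have g: "grid (R n) a b" for n unfolding R_def by (rule partition_grid(1)[OF p])
  define \<psi> where "\<psi> = (\<lambda>n u. \<phi> (floor_pt (R n) u))"
  have f: "floor_pt (R n) u \<in> {a..b}" "floor_pt (R n) u \<le> u" if "u \<in> {a..b}" for n u
    using flr_props[of "R n" a u] g[of n] that by (auto simp: grid_def)
  obtain B where B: "\<And>u. u \<in> {a..b} \<Longrightarrow> l2norm P (\<phi> u) \<le> B"
    using ms_uniform_bounded[OF \<phi>] by metis
  have "weighted_norm2 P \<rho> a b (\<psi> n) < \<infinity>" for n
  proof -
    have "weighted_norm2 P \<rho> a b (\<psi> n) \<le> ennreal (K * B\<^sup>2 * (b - a))"
    proof (rule weighted_norm2_bound[OF ab])
      fix u assume "u \<in> {a..b}"
      note u = f(1)[OF this, of n]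
      show "square_int P (\<psi> n u)" unfolding \<psi>_def by (rule ms_uniformD(2)[OF \<phi> u])
      show "l2norm P (\<psi> n u) \<le> B" unfolding \<psi>_def by (rule B[OF u])
    qed
    also have "\<dots> < \<infinity>" by simp
    finally show ?thesis .
  qed
  moreover have "\<psi> n u \<in> borel_measurable (F u)" if u: "u \<in> {a..b}" for n u
    unfolding \<psi>_def
  proof (rule adapted_mono[OF ms_uniformD(1)[OF \<phi> f(1)[OF u]] _ f(2)[OF u]])
    show "0 \<le> floor_pt (R n) u" "u \<le> T" using f(1)[OF u, of n] u ab t_nonneg by auto
  qed
  ultimately have "\<psi> n \<in> H2 P F \<rho> a b" for n by (simp add: H2_def)
  moreover have "step_on (N n) (\<tau> n) (\<psi> n)" for n
    unfolding step_on_def \<psi>_def R_def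
  proof (intro allI impI ballI)
    fix l u assume l: "l < N n" and u: "u \<in> {\<tau> n l..<\<tau> n (Suc l)}"
    have "\<tau> n l < \<tau> n (Suc l)" using p[of n] l by (simp add: is_partition_def)
    then show "\<phi> (floor_pt (\<tau> n ` {..N n}) u) = \<phi> (floor_pt (\<tau> n ` {..N n}) (\<tau> n l))"
      using partition_floor[OF p l, of u] partition_floor[OF p l, of "\<tau> n l"] u by simp
  qed
  moreover have "(\<lambda>n. weighted_norm2 P \<rho> a b (\<lambda>u w. \<psi> n u w - \<phi> u w)) \<longlonglongrightarrow> 0"
  proof (rule ennreal_tendsto_0I)
    fix e :: real assume "0 < e"
    define e' where "e' = sqrt (e / (K * (b - a) + 1))"
    have pos: "0 < K * (b - a) + 1" using K_nonneg ab by (simp add: add_nonneg_pos)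
    then have e': "e' > 0" "K * e'\<^sup>2 * (b - a) \<le> e"
      using \<open>0 < e\<close> by (auto simp: e'_def field_simps)
    obtain d where d: "0 < d" "\<And>u v. u \<in> {a..b} \<Longrightarrow> v \<in> {a..b} \<Longrightarrow> \<bar>u - v\<bar> < d \<Longrightarrow>
        l2dist P (\<phi> u) (\<phi> v) < e'"
      using ms_uniform_modulus[OF \<phi> e'(1)] by metis
    show "\<forall>\<^sub>F n in sequentially. weighted_norm2 P \<rho> a b (\<lambda>u w. \<psi> n u w - \<phi> u w) \<le> ennreal e"
      using partition_seq_mesh[OF ps d(1)]
    proof eventually_elim
      case (elim n)
      have "weighted_norm2 P \<rho> a b (\<lambda>u w. \<psi> n u w - \<phi> u w) \<le> ennreal (K * e'\<^sup>2 * (b - a))"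
      proof (rule weighted_norm2_bound[OF ab])
        fix u assume u: "u \<in> {a..b}"
        show "square_int P (\<lambda>w. \<psi> n u w - \<phi> u w)"
          unfolding \<psi>_def by (intro square_int_diff ms_uniformD(2)[OF \<phi>] f u)
        have "mesh_less (R n) a b d" unfolding R_def by (rule partition_mesh_less(1)[OF p elim])
        then have "\<bar>floor_pt (R n) u - u\<bar> < d" by (rule floor_close(1)[OF g _ d(1) u])
        then show "l2dist P (\<psi> n u) (\<phi> u) \<le> e'"
          unfolding \<psi>_def by (intro less_imp_le d(2) f u)
      qed
      also have "\<dots> \<le> ennreal e" using e'(2) by (rule ennreal_leI)
      finally show ?case .
    qed
  qed
  ultimately show ?thesis using ps unfolding step_approx_def by blast
qed

text \<open>At times \<open>u < b\<close> the step process satisfies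
  \<open>\<psi> (floor_pt R u) = \<psi> u\<close>, so its deviation from \<phi> at the grid point is
  \<open>\<psi> u - \<phi> u\<close> plus an oscillation of \<phi> over less than one mesh width.
  Expanding the square of this sum produces the factors 2, and integration over time gives the
  weighted norm plus the oscillation term.\<close>

lemma step_sums_close:
  assumes ab: "t \<le> a" "a \<le> b" "b \<le> T" and \<phi>: "ms_uniform a b \<phi>"
    and p: "is_partition a b N \<tau>" and \<psi>: "\<psi> \<in> H2 P F \<rho> a b" "step_on N \<tau> \<psi>"
    and mesh: "mesh N \<tau> < d" and e: "0 \<le> e"
    and d: "\<And>u v. u \<in> {a..b} \<Longrightarrow> v \<in> {a..b} \<Longrightarrow> \<bar>u - v\<bar> < d \<Longrightarrow>
        l2dist P (\<phi> u) (\<phi> v) \<le> e"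
  shows "square_int P (LS True (\<tau> ` {..N}) a b \<psi>)"
    and "ennreal ((l2dist P (LS True (\<tau> ` {..N}) a b \<psi>) (LS True (\<tau> ` {..N}) a b \<phi>))\<^sup>2)
      \<le> 2 * weighted_norm2 P \<rho> a b (\<lambda>u w. \<psi> u w - \<phi> u w) + ennreal (2 * K * e\<^sup>2 * (b - a))"
proof -
  define R where "R = \<tau> ` {..N}"
  have g: "grid R a b" unfolding R_def by (rule partition_grid(1)[OF p])
  note pb = pts_bounds[OF g]
  have a0: "0 \<le> a" using ab t_nonneg by simp
  have \<psi>F: "\<psi> u \<in> borel_measurable (F u)" if "u \<in> {a..b}" for u using \<psi>(1) that by (simp add: H2_def)
  have f: "floor_pt R u \<in> {a..b}" "floor_pt R u \<le> u" "\<bar>u - floor_pt R u\<bar> < d" if "u \<in> {a..b}" for u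
    using flr_props[of R a u] g that floor_close[OF g partition_mesh_less(1)[OF p mesh, folded R_def] partition_mesh_less(3)[OF p mesh] that]
    by (auto simp: grid_def)
  have step: "\<psi> (floor_pt R u) = \<psi> u" if "u \<in> {a..<b}" for u
  proof -
    have q: "floor_pt R u \<in> pts R a b" "floor_pt R u \<le> u" "u < next_pt R (floor_pt R u)"
      using flr_props[of R a u] flr_nxt[of R a u b] g that by (auto simp: grid_def pts_def)
    obtain l where l: "l < N" "floor_pt R u = \<tau> l"
      using q(1) partition_grid(3)[OF p, folded R_def] by auto
    then have "u \<in> {\<tau> l..<\<tau> (Suc l)}"
      using q(2,3) partition_grid(2)[OF p l(1), folded R_def] by simp
    then have "\<psi> u = \<psi> (\<tau> l)" using \<psi>(2) l(1) unfolding step_on_def by blast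
    then show ?thesis by (simp only: l(2))
  qed
  have \<psi>Fp: "\<psi> p \<in> borel_measurable (F p)" if "p \<in> pts R a b" for p
    using that by (intro \<psi>F) (auto simp: pts_def)
  have h\<psi>: "energy R a b \<psi> \<le> weighted_norm2 P \<rho> a b \<psi>"
    unfolding weighted_norm2_def
  proof (rule ord_eq_le_trans)
    show "energy R a b \<psi>
      = (\<integral>\<^sup>+\<tau>. (rho_energy \<tau> (\<psi> (floor_pt R \<tau>))) * indicator {a..<b} \<tau> \<partial>lborel)"
      by (rule step_isometry(2)[OF g a0 ab(3) \<psi>Fp])
  qed (rule nn_integral_mono, auto simp: step indicator_def)
  then have "energy R a b \<psi> < \<infinity>"
    using \<psi>(1) by (auto simp: H2_def le_less_trans)
  from LS_mart_of_finite(1)[OF g a0 ab(3) \<psi>Fp this]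
  show "square_int P (LS True (\<tau> ` {..N}) a b \<psi>)" unfolding R_def .
  define W where "W = weighted_norm2 P \<rho> a b (\<lambda>u w. \<psi> u w - \<phi> u w)"
  define Y where "Y = (\<lambda>p w. \<psi> p w - \<phi> p w)"
  have YF: "Y p \<in> borel_measurable (F p)" if "p \<in> pts R a b" for p
    unfolding Y_def using \<psi>Fp[OF that] ms_uniformD(1)[OF \<phi>, of p] pb(1,2)[OF that] by auto
  let ?c = "ennreal (2 * K * e\<^sup>2)"
  let ?g = "\<lambda>u. (rho_energy u (\<lambda>w. \<psi> u w - \<phi> u w)) * indicator {a..b} u"
  have pt: "(rho_energy u (Y (floor_pt R u))) * indicator {a..<b} u \<le> 2 * ?g u + ?c * indicator {a..<b} u" for u
  proof (cases "u \<in> {a..<b}")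
    case True
    then have u: "u \<in> {a..b}" "u \<in> {t..T}" "u \<in> {0..T}" "floor_pt R u \<in> {0..T}" using ab t_nonneg f(1)[of u] by auto
    note f = f[OF u(1)]
    have sq: "square_int P (\<lambda>w. \<phi> u w - \<phi> (floor_pt R u) w)"
      using ms_uniformD(2)[OF \<phi>] u f by (intro square_int_diff) auto
    have [measurable]: "\<psi> u \<in> borel_measurable P" "\<phi> u \<in> borel_measurable P" "\<phi> (floor_pt R u) \<in> borel_measurable P" "\<rho> u \<in> borel_measurable P"
      using adapted_P[OF u(3) \<psi>F[OF u(1)]] adapted_P[OF u(3) ms_uniformD(1)[OF \<phi> u(1)]]
        adapted_P[OF u(4) ms_uniformD(1)[OF \<phi> f(1)]] adapted_P[OF u(3) rho_adapted[OF u(3)]] by auto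
    have "(rho_energy u (Y (floor_pt R u)))
      \<le> (\<integral>\<^sup>+w. 2 * ennreal ((\<psi> u w - \<phi> u w)\<^sup>2 * \<rho> u w) + 2 * ennreal ((\<phi> u w - \<phi> (floor_pt R u) w)\<^sup>2 * \<rho> u w) \<partial>P)"
    proof (rule nn_integral_mono_AE)
      show "AE w in P. ennreal ((Y (floor_pt R u) w)\<^sup>2 * \<rho> u w)
        \<le> 2 * ennreal ((\<psi> u w - \<phi> u w)\<^sup>2 * \<rho> u w) + 2 * ennreal ((\<phi> u w - \<phi> (floor_pt R u) w)\<^sup>2 * \<rho> u w)"
        using rho_nonneg[OF u(3)]
      proof eventually_elim
        case (elim w)
        have sq2: "(x + y)\<^sup>2 \<le> 2 * x\<^sup>2 + 2 * y\<^sup>2" for x y :: real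
          using sum_squares_bound[of x y] by (simp add: power2_sum)
        have "(Y (floor_pt R u) w)\<^sup>2 = ((\<psi> u w - \<phi> u w) + (\<phi> u w - \<phi> (floor_pt R u) w))\<^sup>2"
          using True by (simp add: Y_def step)
        also have "\<dots> \<le> 2 * (\<psi> u w - \<phi> u w)\<^sup>2 + 2 * (\<phi> u w - \<phi> (floor_pt R u) w)\<^sup>2" by (rule sq2)
        finally have "(Y (floor_pt R u) w)\<^sup>2 * \<rho> u w
          \<le> 2 * ((\<psi> u w - \<phi> u w)\<^sup>2 * \<rho> u w) + 2 * ((\<phi> u w - \<phi> (floor_pt R u) w)\<^sup>2 * \<rho> u w)"
          using mult_right_mono[OF _ elim] by (fastforce simp: distrib_right mult.assoc)
        then have "ennreal ((Y (floor_pt R u) w)\<^sup>2 * \<rho> u w)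
          \<le> ennreal (2 * ((\<psi> u w - \<phi> u w)\<^sup>2 * \<rho> u w) + 2 * ((\<phi> u w - \<phi> (floor_pt R u) w)\<^sup>2 * \<rho> u w))"
          by (rule ennreal_leI)
        also have "\<dots> = 2 * ennreal ((\<psi> u w - \<phi> u w)\<^sup>2 * \<rho> u w) + 2 * ennreal ((\<phi> u w - \<phi> (floor_pt R u) w)\<^sup>2 * \<rho> u w)"
          using elim by (subst ennreal_plus) (auto simp: ennreal_mult')
        finally show ?case .
      qed
    qed
    also have "\<dots> = 2 * (rho_energy u (\<lambda>w. \<psi> u w - \<phi> u w))
        + 2 * (rho_energy u (\<lambda>w. \<phi> u w - \<phi> (floor_pt R u) w))"
      by (simp add: nn_integral_add nn_integral_cmult)
    finally have A: "(rho_energy u (Y (floor_pt R u)))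
        \<le> 2 * (rho_energy u (\<lambda>w. \<psi> u w - \<phi> u w))
        + 2 * (rho_energy u (\<lambda>w. \<phi> u w - \<phi> (floor_pt R u) w))" .
    have "(rho_energy u (\<lambda>w. \<phi> u w - \<phi> (floor_pt R u) w)) \<le> ennreal (K * e\<^sup>2)"
    proof -
      have "l2dist P (\<phi> u) (\<phi> (floor_pt R u)) \<le> e" using u f by (intro d) auto
      then have "K * (l2dist P (\<phi> u) (\<phi> (floor_pt R u)))\<^sup>2 \<le> K * e\<^sup>2"
        using K_nonneg by (intro mult_left_mono power_mono) (auto simp: l2norm_nonneg)
      then show ?thesis using rho_weight_le[OF u(2) sq] by (meson ennreal_leI order_trans)
    qed
    then have "2 * (rho_energy u (\<lambda>w. \<phi> u w - \<phi> (floor_pt R u) w)) \<le> 2 * ennreal (K * e\<^sup>2)"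
      by (rule mult_left_mono) simp
    also have "\<dots> = ?c" using K_nonneg by (simp add: ennreal_mult' mult.assoc)
    finally show ?thesis using True order_trans[OF A add_left_mono] by simp
  qed simp
  have L: "energy R a b Y
    \<le> 2 * W + ennreal (2 * K * e\<^sup>2 * (b - a))"
  proof -
    have "energy R a b Y
      \<le> 2 * (\<integral>\<^sup>+u. ?g u \<partial>lborel) + ?c * emeasure lborel {a..<b}"
    proof (rule ord_eq_le_trans)
      show "energy R a b Y
        = (\<integral>\<^sup>+\<tau>. (rho_energy \<tau> (Y (floor_pt R \<tau>))) * indicator {a..<b} \<tau> \<partial>lborel)"
        by (rule step_isometry(2)[OF g a0 ab(3) YF])
      show "(\<integral>\<^sup>+\<tau>. (rho_energy \<tau> (Y (floor_pt R \<tau>))) * indicator {a..<b} \<tau> \<partial>lborel)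
        \<le> 2 * (\<integral>\<^sup>+u. ?g u \<partial>lborel) + ?c * emeasure lborel {a..<b}"
        by (rule nn_integral_le_add_const[OF step_isometry(1)[OF g a0 ab(3) YF]]) (simp_all add: pt)
    qed
    also have "\<dots> = 2 * W + ennreal (2 * K * e\<^sup>2 * (b - a))"
      using ab K_nonneg by (simp add: W_def weighted_norm2_def ennreal_mult)
    finally show ?thesis .
  qed
  show "ennreal ((l2dist P (LS True (\<tau> ` {..N}) a b \<psi>) (LS True (\<tau> ` {..N}) a b \<phi>))\<^sup>2)
      \<le> 2 * weighted_norm2 P \<rho> a b (\<lambda>u w. \<psi> u w - \<phi> u w) + ennreal (2 * K * e\<^sup>2 * (b - a))"
  \<comment> \<open>If the weighted distance is infinite the right-hand side is infinite and the
    bound is trivial.\<close>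
  proof (cases "W < \<infinity>")
    case True
    then have fin: "energy R a b Y < \<infinity>"
      using L by (auto simp: ennreal_mult_less_top elim!: le_less_trans)
    show ?thesis
      unfolding LS_diff R_def[symmetric] Y_def[symmetric]
      using L[unfolded W_def, folded Y_def] LS_mart_of_finite(2)[OF g a0 ab(3) YF fin] by simp
  next
    case False
    then have "weighted_norm2 P \<rho> a b (\<lambda>u w. \<psi> u w - \<phi> u w) = top" by (simp add: W_def less_top[symmetric])
    then show ?thesis by (simp add: ennreal_mult_top)
  qed
qed

lemma ms_uniform_mart_integral:
  assumes ab: "t \<le> a" "a \<le> b" "b \<le> T" and \<phi>: "ms_uniform a b \<phi>"
  shows "has_mart_integral P F M \<rho> a b \<phi> (ms_int True a b \<phi>)"
  unfolding has_mart_integral_def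
proof (intro conjI allI impI)
  show "\<phi> \<in> H2 P F \<rho> a b" by (rule ms_uniform_H2[OF ab \<phi>])
  show "\<exists>N \<tau> \<psi>. step_approx P F \<rho> a b \<phi> N \<tau> \<psi>" by (rule step_approx_exists[OF ab \<phi>])
  fix N \<tau> \<psi> assume sa: "step_approx P F \<rho> a b \<phi> N \<tau> \<psi>"
  then have ps: "partition_seq a b N \<tau>" and \<psi>: "\<And>n. \<psi> n \<in> H2 P F \<rho> a b" "\<And>n. step_on (N n) (\<tau> n) (\<psi> n)"
    and W: "(\<lambda>n. weighted_norm2 P \<rho> a b (\<lambda>u w. \<psi> n u w - \<phi> u w)) \<longlonglongrightarrow> 0"
    by (auto simp: step_approx_def)
  have p: "is_partition a b (N n) (\<tau> n)" for n using ps by (simp add: partition_seq_def)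
  have eq: "(\<lambda>n w. \<Sum>l<N n. \<psi> n (\<tau> n l) w * (M (\<tau> n (Suc l)) w - M (\<tau> n l) w))
    = (\<lambda>n. LS True (\<tau> n ` {..N n}) a b (\<psi> n))"
    by (intro ext) (simp add: partition_LS[OF p, symmetric] dI_True)
  show "ms_lim P (\<lambda>n w. \<Sum>l<N n. \<psi> n (\<tau> n l) w * (M (\<tau> n (Suc l)) w - M (\<tau> n l) w)) (ms_int True a b \<phi>)"
    unfolding eq
  proof (rule ms_lim_approx)
    show "ms_lim P (\<lambda>n. LS True (\<tau> n ` {..N n}) a b \<phi>) (ms_int True a b \<phi>)"
      using is_int_ms_lim[OF ab \<phi> ms_int_props(2)[OF ab \<phi>] ps, of True] by (simp add: partition_LS[OF p])
    have close: "\<forall>\<^sub>F n in sequentially. square_int P (LS True (\<tau> n ` {..N n}) a b (\<psi> n)) \<and>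
      l2dist P (LS True (\<tau> n ` {..N n}) a b (\<psi> n)) (LS True (\<tau> n ` {..N n}) a b \<phi>) < e"
      if "e > 0" for e
    proof -
      \<comment> \<open>Chosen so that the oscillation term is at most \<open>e\<^sup>2 / 2\<close>;
        the 1 under the root keeps the denominator positive.\<close>
      define e' where "e' = e / (2 * sqrt (K * (b - a) + 1))"
      have pos: "0 < K * (b - a) + 1" using K_nonneg ab by (simp add: add_nonneg_pos)
      have e': "e' > 0" "2 * K * e'\<^sup>2 * (b - a) \<le> e\<^sup>2 / 2"
      proof -
        show "e' > 0" using pos \<open>e > 0\<close> by (simp add: e'_def)
        have "e'\<^sup>2 = e\<^sup>2 / (4 * (K * (b - a) + 1))" using pos by (simp add: e'_def power_divide power_mult_distrib)
        then have "4 * (K * (b - a) + 1) * e'\<^sup>2 = e\<^sup>2" using pos by simp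
        then have "4 * (K * (b - a) * e'\<^sup>2) + 4 * e'\<^sup>2 = e\<^sup>2" by (simp only: distrib_right distrib_left mult.assoc mult_1)
        moreover have "2 * K * e'\<^sup>2 * (b - a) = 2 * (K * (b - a) * e'\<^sup>2)" by simp
        moreover have "0 \<le> e'\<^sup>2" by simp
        ultimately show "2 * K * e'\<^sup>2 * (b - a) \<le> e\<^sup>2 / 2" by linarith
      qed
      obtain d where d: "0 < d" "\<And>u v. u \<in> {a..b} \<Longrightarrow> v \<in> {a..b} \<Longrightarrow> \<bar>u - v\<bar> < d \<Longrightarrow>
          l2dist P (\<phi> u) (\<phi> v) \<le> e'"
        using ms_uniform_modulus[OF \<phi> e'(1)] by (metis less_imp_le)
      \<comment> \<open>The weighted norm enters twice, giving \<open>e\<^sup>2 / 4\<close>; with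
        the oscillation term the total is three quarters of \<open>e\<^sup>2\<close>.\<close>
      have "0 < ennreal (e\<^sup>2 / 8)" using \<open>e > 0\<close> by simp
      from order_tendstoD(2)[OF W this] partition_seq_mesh[OF ps d(1)] show ?thesis
      proof eventually_elim
        case (elim n)
        let ?D = "\<lambda>w. LS True (\<tau> n ` {..N n}) a b (\<psi> n) w - LS True (\<tau> n ` {..N n}) a b \<phi> w"
        note c = step_sums_close[OF ab \<phi> p \<psi> elim(2) less_imp_le[OF e'(1)] d(2)]
        have "ennreal ((l2norm P ?D)\<^sup>2) \<le> 2 * weighted_norm2 P \<rho> a b (\<lambda>u w. \<psi> n u w - \<phi> u w) + ennreal (2 * K * e'\<^sup>2 * (b - a))"
          by (rule c(2))
        also have "\<dots> \<le> 2 * ennreal (e\<^sup>2 / 8) + ennreal (e\<^sup>2 / 2)"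
          using elim(1) e'(2) by (intro add_mono mult_left_mono ennreal_leI) auto
        also have "\<dots> = ennreal (3 / 4 * e\<^sup>2)"
        proof -
          have "2 * ennreal (e\<^sup>2 / 8) = ennreal (2 * (e\<^sup>2 / 8))" by (subst ennreal_mult') auto
          then show ?thesis by (simp add: ennreal_plus[symmetric] del: ennreal_plus)
        qed
        finally have "(l2norm P ?D)\<^sup>2 \<le> 3 / 4 * e\<^sup>2" by (simp add: ennreal_le_iff)
        also have "\<dots> < e\<^sup>2" using \<open>e > 0\<close> by simp
        finally have "l2norm P ?D < e" using \<open>e > 0\<close> by (simp add: power2_less_imp_less)
        moreover have "square_int P (LS True (\<tau> n ` {..N n}) a b (\<psi> n))" by (rule c(1))
        ultimately show ?case by blast
      qed
    qed
    show "(\<lambda>n. l2dist P (LS True (\<tau> n ` {..N n}) a b (\<psi> n)) (LS True (\<tau> n ` {..N n}) a b \<phi>)) \<longlonglongrightarrow> 0"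
    proof (rule order_tendstoI)
      fix x :: real assume "0 < x"
      from close[OF this] show "\<forall>\<^sub>F n in sequentially. l2dist P (LS True (\<tau> n ` {..N n}) a b (\<psi> n)) (LS True (\<tau> n ` {..N n}) a b \<phi>) < x"
        by eventually_elim simp
    next
      fix x :: real assume "x < 0"
      then show "\<forall>\<^sub>F n in sequentially. x < l2dist P (LS True (\<tau> n ` {..N n}) a b (\<psi> n)) (LS True (\<tau> n ` {..N n}) a b \<phi>)"
        using l2norm_nonneg by (intro always_eventually allI) (rule less_le_trans)
    qed
    fix n
    \<comment> \<open>\<open>ms_lim\<close> demands square integrability for every \<open>n\<close>,
      not only for fine partitions. With the crude modulus \<open>B + B\<close> the closeness lemma
      applies to any mesh.\<close>
    obtain B where B: "\<And>u. u \<in> {a..b} \<Longrightarrow> l2norm P (\<phi> u) \<le> B" "0 \<le> B"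
      using ms_uniform_bounded[OF \<phi>] by metis
    have "l2dist P (\<phi> u) (\<phi> v) \<le> B + B" if "u \<in> {a..b}" "v \<in> {a..b}" for u v
      using l2norm_triangle_minus[OF ms_uniformD(2)[OF \<phi> that(1)] ms_uniformD(2)[OF \<phi> that(2)]] B(1)[OF that(1)] B(1)[OF that(2)]
      by linarith
    then show "square_int P (LS True (\<tau> n ` {..N n}) a b (\<psi> n))"
      using step_sums_close(1)[OF ab \<phi> p \<psi>, of n "mesh (N n) (\<tau> n) + 1" "B + B"] B(2) by simp
  qed
qed

lemma has_int_ms_int:
  assumes "t \<le> a" "a \<le> b" "b \<le> T" "ms_uniform a b \<phi>"
  shows "has_int P F M \<rho> m a b \<phi> (ms_int m a b \<phi>)"
  using ms_uniform_mart_integral[OF assms] ms_uniform_time_integral[OF assms] by (simp add: has_int_def)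

section \<open>Uniqueness of single integrals\<close>

lemma weighted_norm2_cong_AE:
  assumes "\<And>u. u \<in> {a..b} \<Longrightarrow> AE w in P. \<phi> u w = \<psi> u w"
  shows "weighted_norm2 P \<rho> a b \<phi> = weighted_norm2 P \<rho> a b \<psi>"
  unfolding weighted_norm2_def
proof (rule nn_integral_cong)
  fix u
  have "(rho_energy u (\<phi> u)) = (rho_energy u (\<psi> u))" if "u \<in> {a..b}"
    using assms[OF that] by (intro nn_integral_cong_AE) auto
  then show "(rho_energy u (\<phi> u)) * indicator {a..b} u
    = (rho_energy u (\<psi> u)) * indicator {a..b} u"
    by (auto simp: indicator_def)
qed

text \<open>The integrand \<open>\<phi>'\<close> may be built from other versions, with an
  exceptional null set depending on \<open>u\<close>. Neither the weighted norm, where the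
  expectation is inside the time integral, nor a finite sum notices the change.\<close>

lemma has_int_unique:
  assumes ab: "t \<le> a" "a \<le> b" "b \<le> T" and \<phi>: "ms_uniform a b \<phi>"
    and ae: "\<And>u. u \<in> {a..b} \<Longrightarrow> AE w in P. \<phi>' u w = \<phi> u w"
    and I: "has_int P F M \<rho> m a b \<phi>' X"
  shows "AE w in P. X w = ms_int m a b \<phi> w"
proof (cases m)
  case True
  obtain N \<tau> \<psi> where sa: "step_approx P F \<rho> a b \<phi>' N \<tau> \<psi>"
    and L: "ms_lim P (\<lambda>n w. \<Sum>l<N n. \<psi> n (\<tau> n l) w * (M (\<tau> n (Suc l)) w - M (\<tau> n l) w)) X"
    using I True by (auto simp: has_int_def has_mart_integral_def)
  have "weighted_norm2 P \<rho> a b (\<lambda>u w. \<psi> n u w - \<phi>' u w) = weighted_norm2 P \<rho> a b (\<lambda>u w. \<psi> n u w - \<phi> u w)" for n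
    using ae by (intro weighted_norm2_cong_AE) auto
  \<comment> \<open>The same step processes approximate both integrands, so the same sums have both
    integrals as limits.\<close>
  then have "step_approx P F \<rho> a b \<phi> N \<tau> \<psi>" using sa by (simp add: step_approx_def)
  then have "ms_lim P (\<lambda>n w. \<Sum>l<N n. \<psi> n (\<tau> n l) w * (M (\<tau> n (Suc l)) w - M (\<tau> n l) w)) (ms_int True a b \<phi>)"
    using ms_uniform_mart_integral[OF ab \<phi>] unfolding has_mart_integral_def by blast
  from ms_lim_unique[OF L this] True show ?thesis by simp
next
  case False
  obtain N \<tau> where ps: "partition_seq a b N \<tau>" using partition_seq_exists[OF ab(2)] .
  have p: "is_partition a b (N n) (\<tau> n)" for n using ps by (simp add: partition_seq_def)
  have L: "\<forall>n. \<forall>l<N n. \<tau> n l \<in> {\<tau> n l..\<tau> n (Suc l)}"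
    using p by (auto simp: is_partition_def less_imp_le)
  have "ms_lim P (\<lambda>n w. \<Sum>l<N n. \<phi>' (\<tau> n l) w * (\<tau> n (Suc l) - \<tau> n l)) X"
    using I False ps L unfolding has_int_def has_time_integral_def by auto
  moreover have "ms_lim P (\<lambda>n w. \<Sum>l<N n. \<phi> (\<tau> n l) w * (\<tau> n (Suc l) - \<tau> n l)) (ms_int False a b \<phi>)"
    using ms_uniform_time_integral[OF ab \<phi>] ps L unfolding has_time_integral_def by auto
  moreover have "AE w in P. (\<Sum>l<N n. \<phi>' (\<tau> n l) w * (\<tau> n (Suc l) - \<tau> n l)) = (\<Sum>l<N n. \<phi> (\<tau> n l) w * (\<tau> n (Suc l) - \<tau> n l))" for n
  proof -
    have "AE w in P. \<forall>l\<in>{..<N n}. \<phi>' (\<tau> n l) w = \<phi> (\<tau> n l) w"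
      using ae partition_range[OF p, of _ n] by (subst AE_finite_all) auto
    then show ?thesis by eventually_elim simp
  qed
  ultimately have "AE w in P. X w = ms_int False a b \<phi> w" by (rule ms_lim_unique)
  then show ?thesis using False by simp
qed

end

section \<open>Ordered tuples of times\<close>

lemma ordered_times_upd:
  assumes x: "x \<in> ordered_times a b {1..<j}" and j: "1 \<le> j"
    and u: "a \<le> u" "u \<le> b" "j \<noteq> 1 \<Longrightarrow> u \<le> x (j - 1)"
  shows "x(j := u) \<in> ordered_times a b {1..<Suc j}"
proof -
  have J: "{1..<Suc j} = insert j {1..<j}" using j by auto
  have x': "x \<in> {1..<j} \<rightarrow>\<^sub>E {a..b}" "\<And>i i'. i \<in> {1..<j} \<Longrightarrow> i' \<in> {1..<j} \<Longrightarrow> i \<le> i' \<Longrightarrow> x i' \<le> x i"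
    using x by (auto simp: ordered_times_def)
  have le: "u \<le> x i" if "i \<in> {1..<j}" for i
    using u(3) x'(2)[of i "j - 1"] that by fastforce
  show ?thesis
    unfolding ordered_times_def J using x' u le j by (auto intro!: PiE_fun_upd)
qed

lemma ordered_times_lower:
  assumes "x \<in> ordered_times a b {1..<j}" "c \<le> b" "j \<noteq> 1 \<Longrightarrow> c \<le> x (j - 1)"
  shows "x \<in> ordered_times c b {1..<j}"
proof -
  have "c \<le> x i" if "i \<in> {1..<j}" for i
  proof -
    have "x (j - 1) \<le> x i" using assms(1) that by (auto simp: ordered_times_def)
    then show ?thesis using assms(3) that by force
  qed
  then show ?thesis using assms(1) by (auto simp: ordered_times_def PiE_iff)
qed

context bounded_martingale_setting
begin

section \<open>Iterated integrals of kernels\<close>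

definition upper :: "nat \<Rightarrow> (nat \<Rightarrow> real) \<Rightarrow> real" where
  "upper j x = (if j = 1 then T else x (j - 1))"

abbreviation tuples :: "real \<Rightarrow> nat \<Rightarrow> (nat \<Rightarrow> real) set" where
  "tuples c j \<equiv> ordered_times c T {1..<j}"

lemma upper_bounds:
  assumes "x \<in> tuples c j" "1 \<le> j" "c \<le> T"
  shows "c \<le> upper j x" "upper j x \<le> T"
  using assms by (auto simp: upper_def ordered_times_def PiE_iff)

lemma tuples_upd:
  assumes "x \<in> tuples c j" "1 \<le> j" "c \<le> u" "u \<le> upper j x" "c \<le> T"
  shows "x(j := u) \<in> tuples c (Suc j)"
  using assms upper_bounds[OF assms(1,2,5)] by (intro ordered_times_upd) (auto simp: upper_def)

lemma tuples_lower:
  assumes "x \<in> tuples c j" "1 \<le> j" "c' \<le> upper j x" "c' \<le> T"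
  shows "x \<in> tuples c' j"
  by (rule ordered_times_lower[OF assms(1)]) (use assms in \<open>auto simp: upper_def\<close>)

lemma upper_upd [simp]: "1 \<le> j \<Longrightarrow> upper (Suc j) (x(j := u)) = u"
  by (simp add: upper_def)

definition kernel :: "real \<Rightarrow> nat \<Rightarrow> ((nat \<Rightarrow> real) \<Rightarrow> 'a \<Rightarrow> real) \<Rightarrow> bool" where
  "kernel c j Y \<longleftrightarrow>
     (\<forall>x\<in>tuples c j. Y x \<in> borel_measurable (F (upper j x)) \<and> square_int P (Y x)) \<and>
     (\<exists>B\<ge>0. \<forall>x\<in>tuples c j. l2norm P (Y x) \<le> B) \<and>
     (\<forall>e>0. \<exists>d>0. \<forall>x\<in>tuples c j. \<forall>y\<in>tuples c j. (\<forall>i\<in>{1..<j}. \<bar>x i - y i\<bar> < d) \<longrightarrow>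
        l2dist P (Y x) (Y y) < e)"

lemma kernelD:
  assumes "kernel c j Y" "x \<in> tuples c j"
  shows "Y x \<in> borel_measurable (F (upper j x))" "square_int P (Y x)"
  using assms by (auto simp: kernel_def)

lemma kernel_bound:
  assumes "kernel c j Y"
  obtains B where "0 \<le> B" "\<forall>x\<in>tuples c j. l2norm P (Y x) \<le> B"
  using assms unfolding kernel_def by blast

lemma kernel_modulus:
  assumes "kernel c j Y" "0 < e"
  obtains d where "0 < d" "\<forall>x\<in>tuples c j. \<forall>y\<in>tuples c j. (\<forall>i\<in>{1..<j}. \<bar>x i - y i\<bar> < d) \<longrightarrow>
     l2dist P (Y x) (Y y) < e"
  using assms unfolding kernel_def by blast

lemma kernel_ms_uniform:
  assumes Y: "kernel c (Suc j) Y" and j: "1 \<le> j" and x: "x \<in> tuples c j" and c: "c \<le> T"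
  shows "ms_uniform c (upper j x) (\<lambda>u. Y (x(j := u)))"
  unfolding ms_uniform_def
proof (intro conjI ballI allI impI)
  note up = tuples_upd[OF x j _ _ c]
  fix u assume "u \<in> {c..upper j x}"
  then have "x(j := u) \<in> tuples c (Suc j)" using up by auto
  from kernelD[OF Y this] show "Y (x(j := u)) \<in> borel_measurable (F u)" "square_int P (Y (x(j := u)))"
    using j by auto
next
  note up = tuples_upd[OF x j _ _ c]
  fix e :: real assume "0 < e"
  obtain d where d: "0 < d" "\<forall>x\<in>tuples c (Suc j). \<forall>y\<in>tuples c (Suc j). (\<forall>i\<in>{1..<Suc j}. \<bar>x i - y i\<bar> < d) \<longrightarrow>
     l2dist P (Y x) (Y y) < e"
    by (rule kernel_modulus[OF Y \<open>0 < e\<close>])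
  have "l2dist P (Y (x(j := u))) (Y (x(j := v))) < e"
    if "u \<in> {c..upper j x}" "v \<in> {c..upper j x}" "\<bar>u - v\<bar> < d" for u v
    using that d(1) by (intro d(2)[rule_format] up) auto
  then show "\<exists>d>0. \<forall>u\<in>{c..upper j x}. \<forall>v\<in>{c..upper j x}. \<bar>u - v\<bar> < d \<longrightarrow>
      l2dist P (Y (x(j := u))) (Y (x(j := v))) < e"
    using d(1) by blast
qed

lemma sqrt_C_small:
  assumes "0 \<le> B" "0 < e"
  obtains d where "0 < d" "\<And>h. h \<le> d \<Longrightarrow> sqrt (C * h) * B \<le> e"
proof
  define q where "q = e / (B + 1)"
  have q: "0 < q" "q * B \<le> e" using assms by (auto simp: q_def field_simps)
  show "0 < q\<^sup>2 / C" using q C_bounds by simp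
  fix h assume "h \<le> q\<^sup>2 / C"
  then have "C * h \<le> q\<^sup>2" using C_bounds by (simp add: field_simps)
  then have "sqrt (C * h) \<le> q" using q by (intro real_le_lsqrt) auto
  then have "sqrt (C * h) * B \<le> q * B" using assms(1) by (intro mult_right_mono)
  then show "sqrt (C * h) * B \<le> e" using q(2) by simp
qed

text \<open>The largest factor by which one integration over a subinterval of \<open>[t,T]\<close>
  can enlarge an L2 bound.\<close>

definition s0 :: real where "s0 = sqrt (C * (T - t))"

lemma s0_nonneg: "0 \<le> s0"
  using C_bounds t_less by (simp add: s0_def)

lemma sqrt_C_le_s0: "t \<le> a \<Longrightarrow> b \<le> T \<Longrightarrow> sqrt (C * (b - a)) \<le> s0"
  unfolding s0_def using C_bounds by (intro real_sqrt_le_mono mult_left_mono) auto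

lemma kernel_ms_int:
  assumes Y: "kernel c (Suc j) Y" and j: "1 \<le> j" and c: "t \<le> c" "c \<le> T"
  shows "kernel c j (\<lambda>x. ms_int m c (upper j x) (\<lambda>u. Y (x(j := u))))"
  unfolding kernel_def
proof (intro conjI ballI allI impI)
  fix x assume x: "x \<in> tuples c j"
  note ub = upper_bounds[OF x j c(2)]
  show "ms_int m c (upper j x) (\<lambda>u. Y (x(j := u))) \<in> borel_measurable (F (upper j x))"
    "square_int P (ms_int m c (upper j x) (\<lambda>u. Y (x(j := u))))"
    using ms_int_props[OF c(1) ub kernel_ms_uniform[OF Y j x c(2)]] by auto
next
  obtain B where B: "0 \<le> B" "\<forall>x\<in>tuples c (Suc j). l2norm P (Y x) \<le> B"
    by (rule kernel_bound[OF Y])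
  have "l2norm P (ms_int m c (upper j x) (\<lambda>u. Y (x(j := u)))) \<le> s0 * B" if x: "x \<in> tuples c j" for x
  proof -
    note ub = upper_bounds[OF x j c(2)]
    have "l2norm P (ms_int m c (upper j x) (\<lambda>u. Y (x(j := u)))) \<le> sqrt (C * (upper j x - c)) * B"
      using tuples_upd[OF x j _ _ c(2)] B
      by (intro ms_int_bound[OF c(1) ub kernel_ms_uniform[OF Y j x c(2)]]) auto
    also have "\<dots> \<le> s0 * B" using B(1) c ub by (intro mult_right_mono sqrt_C_le_s0) auto
    finally show ?thesis .
  qed
  moreover have "0 \<le> s0 * B" using B(1) s0_nonneg by simp
  ultimately show "\<exists>B\<ge>0. \<forall>x\<in>tuples c j. l2norm P (ms_int m c (upper j x) (\<lambda>u. Y (x(j := u)))) \<le> B"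
    by blast
  fix e :: real assume "0 < e"
  define e1 where "e1 = e / (4 * (s0 + 1))"
  have e1: "0 < e1" "s0 * e1 \<le> e / 4" using \<open>0 < e\<close> s0_nonneg by (auto simp: e1_def field_simps)
  obtain d1 where d1: "0 < d1" "\<forall>x\<in>tuples c (Suc j). \<forall>y\<in>tuples c (Suc j). (\<forall>i\<in>{1..<Suc j}. \<bar>x i - y i\<bar> < d1) \<longrightarrow>
     l2dist P (Y x) (Y y) < e1"
    by (rule kernel_modulus[OF Y e1(1)])
  obtain d2 where d2: "0 < d2" "\<And>h. h \<le> d2 \<Longrightarrow> sqrt (C * h) * B \<le> e / 4"
    using sqrt_C_small[OF B(1), of "e / 4"] \<open>0 < e\<close> by (metis zero_less_divide_iff zero_less_numeral)
  define d where "d = min d1 d2"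
  \<comment> \<open>By symmetry the upper limit of \<open>x\<close> may be taken as the smaller one;
    the two parts of the estimate contribute \<open>e / 4\<close> each.\<close>
  have half: "l2dist P (ms_int m c (upper j y) (\<lambda>u. Y (y(j := u)))) (ms_int m c (upper j x) (\<lambda>u. Y (x(j := u)))) < e"
    if x: "x \<in> tuples c j" and y: "y \<in> tuples c j" and le: "upper j x \<le> upper j y"
      and xy: "\<And>i. i \<in> {1..<j} \<Longrightarrow> \<bar>x i - y i\<bar> < d" for x y
  proof -
    note ubx = upper_bounds[OF x j c(2)] and uby = upper_bounds[OF y j c(2)]
    have du: "upper j y - upper j x \<le> d2"
    proof (cases "j = 1")
      case True then show ?thesis using d2(1) by (simp add: upper_def)
    next
      case False
      then have "\<bar>x (j - 1) - y (j - 1)\<bar> < d" using j by (intro xy) auto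
      then have "y (j - 1) - x (j - 1) \<le> d2" unfolding d_def by linarith
      then show ?thesis using False by (simp add: upper_def)
    qed
    have "l2dist P (ms_int m c (upper j y) (\<lambda>u. Y (y(j := u)))) (ms_int m c (upper j x) (\<lambda>u. Y (x(j := u))))
      \<le> sqrt (C * (T - t)) * e1 + sqrt (C * (upper j y - upper j x)) * B"
    proof (rule ms_int_continuity_bound[OF c(1) ubx(1) le uby(2) kernel_ms_uniform[OF Y j x c(2)]
          kernel_ms_uniform[OF Y j y c(2)] less_imp_le[OF e1(1)] B(1)])
      fix u assume u: "c \<le> u" "u < upper j x"
      have "\<bar>(y(j := u)) i - (x(j := u)) i\<bar> < d1" if "i \<in> {1..<Suc j}" for i
        using xy[of i] that d1(1) by (auto simp: d_def)
      moreover have "y(j := u) \<in> tuples c (Suc j)" "x(j := u) \<in> tuples c (Suc j)"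
        using u le tuples_upd[OF y j u(1) _ c(2)] tuples_upd[OF x j u(1) _ c(2)] by auto
      ultimately have "l2dist P (Y (y(j := u))) (Y (x(j := u))) < e1"
        using d1(2) by blast
      then show "l2dist P (Y (y(j := u))) (Y (x(j := u))) \<le> e1" by simp
    next
      fix u assume u: "upper j x \<le> u" "u < upper j y"
      then show "l2norm P (Y (y(j := u))) \<le> B"
        using ubx by (intro B(2)[rule_format] tuples_upd y j c) auto
    qed
    also have "\<dots> \<le> e / 4 + e / 4" using e1(2) d2(2)[OF du] by (intro add_mono) (simp_all add: s0_def)
    also have "\<dots> < e" using \<open>0 < e\<close> by simp
    finally show ?thesis .
  qed
  have "l2dist P (ms_int m c (upper j x) (\<lambda>u. Y (x(j := u)))) (ms_int m c (upper j y) (\<lambda>u. Y (y(j := u)))) < e"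
    if x: "x \<in> tuples c j" and y: "y \<in> tuples c j"
      and xy: "\<forall>i\<in>{1..<j}. \<bar>x i - y i\<bar> < d" for x y
  proof (cases "upper j x \<le> upper j y")
    case True
    show ?thesis
      using half[OF x y True] xy
      unfolding l2norm_minus_commute[of P "ms_int m c (upper j x) (\<lambda>u. Y (x(j := u)))"] by blast
  next
    case False
    then show ?thesis using half[OF y x] xy by (simp add: abs_minus_commute)
  qed
  moreover have "0 < d" using d1 d2 by (simp add: d_def)
  ultimately show "\<exists>d>0. \<forall>x\<in>tuples c j. \<forall>y\<in>tuples c j. (\<forall>i\<in>{1..<j}. \<bar>x i - y i\<bar> < d) \<longrightarrow>
        l2dist P (ms_int m c (upper j x) (\<lambda>u. Y (x(j := u)))) (ms_int m c (upper j y) (\<lambda>u. Y (y(j := u)))) < e"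
    by blast
qed

text \<open>\<open>iter m Y c q j x\<close> is the integral of the kernel \<open>Y\<close> over \<open>t\<^sub>q, \<dots>, t\<^sub>j\<close> with lower limit \<open>c\<close> for fixed
  outer variables \<open>x = (t\<^sub>1, \<dots>, t\<^bsub>j-1\<^esub>)\<close>.\<close>

primrec iter_aux :: "(nat \<Rightarrow> bool) \<Rightarrow> ((nat \<Rightarrow> real) \<Rightarrow> 'a \<Rightarrow> real) \<Rightarrow> real \<Rightarrow> nat \<Rightarrow> nat \<Rightarrow>
    (nat \<Rightarrow> real) \<Rightarrow> 'a \<Rightarrow> real" where
  "iter_aux m Y c q 0 = Y"
| "iter_aux m Y c q (Suc d) =
    (\<lambda>x. ms_int (m (q - d)) c (upper (q - d) x) (\<lambda>u. iter_aux m Y c q d (x(q - d := u))))"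

text \<open>Indexed by the level reached instead of the number of integrations performed; level
  \<open>Suc q\<close> is the kernel itself.\<close>

definition iter :: "(nat \<Rightarrow> bool) \<Rightarrow> ((nat \<Rightarrow> real) \<Rightarrow> 'a \<Rightarrow> real) \<Rightarrow> real \<Rightarrow> nat \<Rightarrow> nat \<Rightarrow>
    (nat \<Rightarrow> real) \<Rightarrow> 'a \<Rightarrow> real" where
  "iter m Y c q j = iter_aux m Y c q (Suc q - j)"

lemma iter_top [simp]: "iter m Y c q (Suc q) = Y"
  by (simp add: iter_def)

lemma iter_step:
  assumes "j \<le> q"
  shows "iter m Y c q j = (\<lambda>x. ms_int (m j) c (upper j x) (\<lambda>u. iter m Y c q (Suc j) (x(j := u))))"
proof -
  have "Suc q - j = Suc (q - j)" "q - (q - j) = j" using assms by auto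
  then show ?thesis by (simp add: iter_def)
qed

lemma iter_kernel:
  assumes Y: "kernel c (Suc q) Y" and c: "t \<le> c" "c \<le> T" and j: "1 \<le> j" "j \<le> Suc q"
  shows "kernel c j (iter m Y c q j)"
  using j(2,1)
proof (induction rule: inc_induct)
  case base
  then show ?case using Y by simp
next
  case (step n)
  then have "kernel c (Suc n) (iter m Y c q (Suc n))" by simp
  from kernel_ms_int[OF this step.prems c] show ?case
    using step.hyps by (simp add: iter_step)
qed

text \<open>At each level the Riemann sums differ by the factor \<open>Z\<close> almost surely, and
  \<open>ms_lim_mult_factor\<close> carries this to the limit for unbounded \<open>Z\<close>. That
  \<open>Z\<close> is known from the lower limit on enters through the assumption that the product
  is again a kernel.\<close>

lemma iter_factor:
  assumes Y: "kernel c (Suc q) Y" and ZY: "kernel c (Suc q) (\<lambda>x w. Z w * Y x w)"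
    and c: "t \<le> c" "c \<le> T" and j: "1 \<le> j" "j \<le> Suc q" and x: "x \<in> tuples c j"
  shows "AE w in P. iter m (\<lambda>x w. Z w * Y x w) c q j x w = Z w * iter m Y c q j x w"
  using j(2,1) x
proof (induction arbitrary: x rule: inc_induct)
  case base
  then show ?case by simp
next
  case (step n)
  let ?ZY = "\<lambda>x w. Z w * Y x w"
  have n: "1 \<le> n" "n \<le> q" using step by auto
  note ub = upper_bounds[OF step.prems(2) n(1) c(2)]
  let ?\<phi> = "\<lambda>u. iter m Y c q (Suc n) (x(n := u))" and ?\<psi> = "\<lambda>u. iter m ?ZY c q (Suc n) (x(n := u))"
  have k: "kernel c (Suc n) (iter m Y c q (Suc n))" "kernel c (Suc n) (iter m ?ZY c q (Suc n))"
    using Y ZY c n by (auto intro!: iter_kernel)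
  have u: "ms_uniform c (upper n x) ?\<phi>" "ms_uniform c (upper n x) ?\<psi>"
    using kernel_ms_uniform[OF k(1) n(1) step.prems(2) c(2)] kernel_ms_uniform[OF k(2) n(1) step.prems(2) c(2)]
    by auto
  obtain N \<tau> where ps: "partition_seq c (upper n x) N \<tau>" using partition_seq_exists[OF ub(1)] .
  have p: "is_partition c (upper n x) (N i) (\<tau> i)" for i using ps by (simp add: partition_seq_def)
  have ae: "AE w in P. ?\<psi> (\<tau> i l) w = Z w * ?\<phi> (\<tau> i l) w" if "l < N i" for i l
    using partition_range[OF p, of l i] that n(1)
    by (intro step.IH tuples_upd[OF step.prems(2) n(1) _ _ c(2)]) auto
  have "AE w in P. ms_int (m n) c (upper n x) ?\<psi> w = Z w * ms_int (m n) c (upper n x) ?\<phi> w"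
  proof (rule ms_lim_mult_factor)
    show "ms_lim P (\<lambda>i w. \<Sum>l<N i. ?\<phi> (\<tau> i l) w * dI (m n) (\<tau> i l) (\<tau> i (Suc l)) w) (ms_int (m n) c (upper n x) ?\<phi>)"
      by (rule is_int_ms_lim[OF c(1) ub u(1) ms_int_props(2)[OF c(1) ub u(1)] ps])
    show "ms_lim P (\<lambda>i w. \<Sum>l<N i. ?\<psi> (\<tau> i l) w * dI (m n) (\<tau> i l) (\<tau> i (Suc l)) w) (ms_int (m n) c (upper n x) ?\<psi>)"
      by (rule is_int_ms_lim[OF c(1) ub u(2) ms_int_props(2)[OF c(1) ub u(2)] ps])
    fix i
    have "AE w in P. \<forall>l\<in>{..<N i}. ?\<psi> (\<tau> i l) w = Z w * ?\<phi> (\<tau> i l) w"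
      using ae by (subst AE_finite_all) auto
    then show "AE w in P. (\<Sum>l<N i. ?\<psi> (\<tau> i l) w * dI (m n) (\<tau> i l) (\<tau> i (Suc l)) w)
      = Z w * (\<Sum>l<N i. ?\<phi> (\<tau> i l) w * dI (m n) (\<tau> i l) (\<tau> i (Suc l)) w)"
      by eventually_elim (simp add: sum_distrib_left mult.assoc)
  qed
  then show ?case using n by (simp add: iter_step)
qed

section \<open>Kernels from deterministic functions\<close>

definition cont_kernel :: "real \<Rightarrow> nat \<Rightarrow> ((nat \<Rightarrow> real) \<Rightarrow> real) \<Rightarrow> bool" where
  "cont_kernel c j \<Psi> \<longleftrightarrow> (\<exists>B\<ge>0. \<forall>x\<in>tuples c j. \<bar>\<Psi> x\<bar> \<le> B) \<and>
     (\<forall>e>0. \<exists>d>0. \<forall>x\<in>tuples c j. \<forall>y\<in>tuples c j. (\<forall>i\<in>{1..<j}. \<bar>x i - y i\<bar> < d) \<longrightarrow> \<bar>\<Psi> x - \<Psi> y\<bar> < e)"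

lemma kernel_const_factor:
  assumes \<Psi>: "cont_kernel c j \<Psi>" and Z: "square_int P Z" "Z \<in> borel_measurable (F c)"
    and c: "t \<le> c" "c \<le> T" and j: "1 \<le> j"
  shows "kernel c j (\<lambda>x w. Z w * \<Psi> x)"
  unfolding kernel_def
proof (intro conjI ballI allI impI)
  fix x assume x: "x \<in> tuples c j"
  have "Z \<in> borel_measurable (F (upper j x))"
    using adapted_mono[OF Z(2)] upper_bounds[OF x j c(2)] c t_nonneg by auto
  then show "(\<lambda>w. Z w * \<Psi> x) \<in> borel_measurable (F (upper j x))" by measurable
  show "square_int P (\<lambda>w. Z w * \<Psi> x)" by (rule square_int_multc[OF Z(1)])
next
  have norm: "l2norm P (\<lambda>w. Z w * q) = \<bar>q\<bar> * l2norm P Z" for q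
    using l2norm_cmult[of P q Z] by (simp add: mult.commute)
  note n0 = l2norm_nonneg[of P Z]
  obtain B where B: "0 \<le> B" "\<And>x. x \<in> tuples c j \<Longrightarrow> \<bar>\<Psi> x\<bar> \<le> B"
    using \<Psi> unfolding cont_kernel_def by blast
  show "\<exists>B\<ge>0. \<forall>x\<in>tuples c j. l2norm P (\<lambda>w. Z w * \<Psi> x) \<le> B"
    unfolding norm using B n0 by (intro exI[of _ "B * l2norm P Z"]) (auto intro: mult_right_mono)
  fix e :: real assume "0 < e"
  define e1 where "e1 = e / (l2norm P Z + 1)"
  have e1: "0 < e1" "e1 * l2norm P Z < e" using \<open>0 < e\<close> n0 by (auto simp: e1_def field_simps)
  obtain d where d: "d > 0" "\<forall>x\<in>tuples c j. \<forall>y\<in>tuples c j. (\<forall>i\<in>{1..<j}. \<bar>x i - y i\<bar> < d) \<longrightarrow> \<bar>\<Psi> x - \<Psi> y\<bar> < e1"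
    using \<Psi> e1(1) unfolding cont_kernel_def by blast
  have "l2norm P (\<lambda>w. Z w * \<Psi> x - Z w * \<Psi> y) < e"
    if "x \<in> tuples c j" "y \<in> tuples c j" "\<forall>i\<in>{1..<j}. \<bar>x i - y i\<bar> < d" for x y
  proof -
    have "\<bar>\<Psi> x - \<Psi> y\<bar> * l2norm P Z \<le> e1 * l2norm P Z"
      using d(2) that n0 by (intro mult_right_mono) (auto intro: less_imp_le)
    then show ?thesis using e1(2) by (simp add: right_diff_distrib[symmetric] norm)
  qed
  then show "\<exists>d>0. \<forall>x\<in>tuples c j. \<forall>y\<in>tuples c j. (\<forall>i\<in>{1..<j}. \<bar>x i - y i\<bar> < d) \<longrightarrow>
        l2norm P (\<lambda>w. Z w * \<Psi> x - Z w * \<Psi> y) < e"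
    using d(1) by blast
qed

lemma kernel_process_factor:
  assumes \<Psi>: "cont_kernel c (Suc q) \<Psi>" and \<xi>: "ms_uniform c T \<xi>"
    and c: "t \<le> c" "c \<le> T" and q: "1 \<le> q"
  shows "kernel c (Suc q) (\<lambda>x w. \<Psi> x * \<xi> (x q) w)"
  unfolding kernel_def
proof (intro conjI ballI allI impI)
  have xq: "x q \<in> {c..T}" if "x \<in> tuples c (Suc q)" for x
    using that q by (auto simp: ordered_times_def PiE_iff)
  have up: "upper (Suc q) x = x q" for x using q by (simp add: upper_def)
  {
    fix x assume x: "x \<in> tuples c (Suc q)"
    note X = ms_uniformD[OF \<xi> xq[OF x]]
    show "(\<lambda>w. \<Psi> x * \<xi> (x q) w) \<in> borel_measurable (F (upper (Suc q) x))"
      unfolding up using X(1) by measurable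
    show "square_int P (\<lambda>w. \<Psi> x * \<xi> (x q) w)" by (rule square_int_cmult[OF X(2)])
  }
  obtain B where B: "0 \<le> B" "\<And>x. x \<in> tuples c (Suc q) \<Longrightarrow> \<bar>\<Psi> x\<bar> \<le> B"
    using \<Psi> unfolding cont_kernel_def by blast
  obtain B' where B': "0 \<le> B'" "\<And>u. u \<in> {c..T} \<Longrightarrow> l2norm P (\<xi> u) \<le> B'"
    using ms_uniform_bounded[OF \<xi>] by metis
  show "\<exists>B\<ge>0. \<forall>x\<in>tuples c (Suc q). l2norm P (\<lambda>w. \<Psi> x * \<xi> (x q) w) \<le> B"
    unfolding l2norm_cmult using B B' xq
    by (intro exI[of _ "B * B'"]) (auto intro!: mult_mono simp: l2norm_nonneg)
  fix e :: real assume "0 < e"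
  define e1 where "e1 = e / (2 * (B' + 1))"
  have e1: "0 < e1" "e1 * B' < e / 2" using \<open>0 < e\<close> B'(1) by (auto simp: e1_def field_simps)
  define e2 where "e2 = e / (2 * (B + 1))"
  have e2: "0 < e2" "B * e2 < e / 2" using \<open>0 < e\<close> B(1) by (auto simp: e2_def field_simps)
  obtain d1 where d1: "d1 > 0" "\<forall>x\<in>tuples c (Suc q). \<forall>y\<in>tuples c (Suc q). (\<forall>i\<in>{1..<Suc q}. \<bar>x i - y i\<bar> < d1) \<longrightarrow> \<bar>\<Psi> x - \<Psi> y\<bar> < e1"
    using \<Psi> e1(1) unfolding cont_kernel_def by blast
  obtain d2 where d2: "d2 > 0" "\<And>u v. u \<in> {c..T} \<Longrightarrow> v \<in> {c..T} \<Longrightarrow> \<bar>u - v\<bar> < d2 \<Longrightarrow>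
     l2dist P (\<xi> u) (\<xi> v) < e2"
    using ms_uniform_modulus[OF \<xi> e2(1)] by metis
  have "l2norm P (\<lambda>w. \<Psi> x * \<xi> (x q) w - \<Psi> y * \<xi> (y q) w) < e"
    if x: "x \<in> tuples c (Suc q)" and y: "y \<in> tuples c (Suc q)"
      and xy: "\<forall>i\<in>{1..<Suc q}. \<bar>x i - y i\<bar> < min d1 d2" for x y
  proof -
    have sq: "square_int P (\<xi> (x q))" "square_int P (\<xi> (y q))"
      using ms_uniformD(2)[OF \<xi>] xq x y by auto
    have "(\<lambda>w. \<Psi> x * \<xi> (x q) w - \<Psi> y * \<xi> (y q) w)
      = (\<lambda>w. (\<Psi> x - \<Psi> y) * \<xi> (x q) w + \<Psi> y * (\<xi> (x q) w - \<xi> (y q) w))"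
      by (auto simp: algebra_simps)
    then have "l2norm P (\<lambda>w. \<Psi> x * \<xi> (x q) w - \<Psi> y * \<xi> (y q) w)
      \<le> \<bar>\<Psi> x - \<Psi> y\<bar> * l2norm P (\<xi> (x q)) + \<bar>\<Psi> y\<bar> * l2dist P (\<xi> (x q)) (\<xi> (y q))"
      using l2norm_triangle[OF square_int_cmult[OF sq(1)] square_int_cmult[OF square_int_diff[OF sq]],
          of "\<Psi> x - \<Psi> y" "\<Psi> y"] by (simp add: l2norm_cmult)
    also have "\<dots> \<le> e1 * B' + B * e2"
    proof (intro add_mono mult_mono)
      show "\<bar>\<Psi> x - \<Psi> y\<bar> \<le> e1" using d1(2) x y xy by (auto intro: less_imp_le)
      show "l2norm P (\<xi> (x q)) \<le> B'" "\<bar>\<Psi> y\<bar> \<le> B" using B' B xq x y by auto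
      show "l2dist P (\<xi> (x q)) (\<xi> (y q)) \<le> e2"
        using xy q by (intro less_imp_le d2(2) xq x y) auto
    qed (use e1 B l2norm_nonneg in auto)
    also have "\<dots> < e" using e1(2) e2(2) by simp
    finally show ?thesis .
  qed
  then show "\<exists>d>0. \<forall>x\<in>tuples c (Suc q). \<forall>y\<in>tuples c (Suc q). (\<forall>i\<in>{1..<Suc q}. \<bar>x i - y i\<bar> < d) \<longrightarrow>
        l2norm P (\<lambda>w. \<Psi> x * \<xi> (x q) w - \<Psi> y * \<xi> (y q) w) < e"
    using d1(1) d2(1) by (intro exI[of _ "min d1 d2"]) auto
qed

text \<open>The tuple stays ordered when its innermost entry is frozen at \<open>p\<close>, because
  all remaining variables run above \<open>c \<ge> p\<close>.\<close>

lemma cont_kernel_freeze: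
  assumes \<Psi>: "cont_kernel s (Suc r) \<Psi>" and r: "1 \<le> r" and p: "s \<le> p" "p \<le> c" "c \<le> T"
  shows "cont_kernel c r (\<lambda>z. \<Psi> (z(r := p)))"
proof -
  have up: "z(r := p) \<in> tuples s (Suc r)" if z: "z \<in> tuples c r" for z
  proof (rule tuples_upd)
    note ub = upper_bounds[OF z r p(3)]
    show "z \<in> tuples s r" using tuples_lower[OF z r] ub p by simp
    show "p \<le> upper r z" using ub p by simp
  qed (use p r in auto)
  show ?thesis
    unfolding cont_kernel_def
  proof (intro conjI allI impI)
    show "\<exists>B\<ge>0. \<forall>x\<in>tuples c r. \<bar>\<Psi> (x(r := p))\<bar> \<le> B"
      using \<Psi> up unfolding cont_kernel_def by meson
    fix e :: real assume "0 < e"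
    then obtain d where d: "d > 0" "\<forall>x\<in>tuples s (Suc r). \<forall>y\<in>tuples s (Suc r). (\<forall>i\<in>{1..<Suc r}. \<bar>x i - y i\<bar> < d) \<longrightarrow> \<bar>\<Psi> x - \<Psi> y\<bar> < e"
      using \<Psi> unfolding cont_kernel_def by blast
    have "\<bar>\<Psi> (x(r := p)) - \<Psi> (y(r := p))\<bar> < e"
      if "x \<in> tuples c r" "y \<in> tuples c r" "\<forall>i\<in>{1..<r}. \<bar>x i - y i\<bar> < d" for x y
      using d(2)[rule_format, OF up[OF that(1)] up[OF that(2)]] that(3) d(1) by auto
    then show "\<exists>d>0. \<forall>x\<in>tuples c r. \<forall>y\<in>tuples c r. (\<forall>i\<in>{1..<r}. \<bar>x i - y i\<bar> < d) \<longrightarrow>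
        \<bar>\<Psi> (x(r := p)) - \<Psi> (y(r := p))\<bar> < e" using d(1) by blast
  qed
qed

section \<open>Reversing the order of integration\<close>

abbreviation no_times :: "nat \<Rightarrow> real" where
  "no_times \<equiv> \<lambda>_. undefined"

lemma undefined_tuple: "no_times \<in> tuples c 1"
  by (simp add: ordered_times_def)

context
  fixes m :: "nat \<Rightarrow> bool" and \<Psi> :: "(nat \<Rightarrow> real) \<Rightarrow> real" and \<xi> :: "real \<Rightarrow> 'a \<Rightarrow> real"
    and s :: real and r :: nat
  assumes \<Psi>: "cont_kernel s (Suc r) \<Psi>" and \<xi>: "ms_uniform s T \<xi>"
    and s: "t \<le> s" "s \<le> T" and r: "2 \<le> r"
begin

definition full_kernel :: "(nat \<Rightarrow> real) \<Rightarrow> 'a \<Rightarrow> real" where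
  "full_kernel = (\<lambda>x w. \<Psi> x * \<xi> (x r) w)"

text \<open>Used with \<open>p\<close> a grid point and \<open>c\<close> its successor: the factor
  is then measurable at the lower limit of the remaining integrals.\<close>

definition weight :: "real \<Rightarrow> real \<Rightarrow> 'a \<Rightarrow> real" where
  "weight p c w = \<xi> p w * dI (m r) p c w"

definition inner_iter :: "real \<Rightarrow> real \<Rightarrow> 'a \<Rightarrow> real" where
  "inner_iter p c = iter m (\<lambda>z w. \<Psi> (z(r := p))) c (r - 1) 1 no_times"

text \<open>The factor sits inside the kernel from the start, and the lower limit is the end
  \<open>c\<close> of the cell. \<open>weighted_inner_eq\<close> identifies the outermost level with
  the summand of the reversed sum.\<close>

definition weighted_inner :: "real \<Rightarrow> real \<Rightarrow> nat \<Rightarrow> (nat \<Rightarrow> real) \<Rightarrow> 'a \<Rightarrow> real" where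
  "weighted_inner p c = iter m (\<lambda>z w. weight p c w * \<Psi> (z(r := p))) c (r - 1)"

lemma weight_props:
  assumes "s \<le> p" "p \<le> c" "c \<le> T"
  shows "weight p c \<in> borel_measurable (F c)" "square_int P (weight p c)"
proof -
  have p: "\<xi> p \<in> borel_measurable (F p)" "square_int P (\<xi> p)"
    using assms ms_uniformD[OF \<xi>, of p] by auto
  have "\<xi> p \<in> borel_measurable (F c)" "dI (m r) p c \<in> borel_measurable (F c)"
    using p assms s t_nonneg by (auto intro: adapted_mono[of _ p] dI_adapted)
  then show "weight p c \<in> borel_measurable (F c)" unfolding weight_def by measurable
  show "square_int P (weight p c)"
    unfolding weight_def using p assms s by (intro square_int_dI(1)) auto
qed

lemma weighted_kernel:
  assumes "s \<le> p" "p \<le> c" "c \<le> T"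
  shows "kernel c (Suc (r - 1)) (\<lambda>z w. weight p c w * \<Psi> (z(r := p)))"
    and "kernel c (Suc (r - 1)) (\<lambda>z w. \<Psi> (z(r := p)))"
proof -
  have c: "t \<le> c" "1 \<le> r" "Suc (r - 1) = r" using assms s r by auto
  have k: "cont_kernel c r (\<lambda>z. \<Psi> (z(r := p)))"
    using assms r by (intro cont_kernel_freeze[OF \<Psi>]) auto
  show "kernel c (Suc (r - 1)) (\<lambda>z w. weight p c w * \<Psi> (z(r := p)))"
    unfolding c(3) by (rule kernel_const_factor[OF k weight_props(2,1)[OF assms] c(1) assms(3) c(2)])
  have "kernel c r (\<lambda>z w. 1 * \<Psi> (z(r := p)))"
    by (rule kernel_const_factor[OF k square_int_const _ c(1) assms(3) c(2)]) simp
  then show "kernel c (Suc (r - 1)) (\<lambda>z w. \<Psi> (z(r := p)))" unfolding c(3) by simp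
qed

lemma weighted_inner_kernel:
  assumes "s \<le> p" "p \<le> c" "c \<le> T" "1 \<le> j" "j \<le> r"
  shows "kernel c j (weighted_inner p c j)"
  unfolding weighted_inner_def using assms s r
  by (intro iter_kernel[OF weighted_kernel(1)[OF assms(1-3)]]) auto

lemma weighted_inner_eq:
  assumes "s \<le> p" "p \<le> c" "c \<le> T"
  shows "AE w in P. weighted_inner p c 1 no_times w = weight p c w * inner_iter p c w"
  unfolding weighted_inner_def inner_iter_def using assms s r
  by (intro iter_factor[OF weighted_kernel(2,1)[OF assms]] undefined_tuple) auto

lemma inner_measurable:
  assumes "s \<le> p" "p \<le> c" "c \<le> T"
  shows "inner_iter p c \<in> borel_measurable P"
proof -
  have "kernel c 1 (iter m (\<lambda>z w. \<Psi> (z(r := p))) c (r - 1) 1)"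
    using assms s r by (intro iter_kernel[OF weighted_kernel(2)[OF assms]]) auto
  from kernelD(2)[OF this undefined_tuple] show ?thesis by (simp add: inner_iter_def square_int_def)
qed

text \<open>Not a consequence of square integrability of the two factors: the product agrees almost
  surely with the iterated integral of a kernel and inherits its second moment.\<close>

lemma weight_inner_square_int:
  assumes "s \<le> p" "p \<le> c" "c \<le> T"
  shows "square_int P (\<lambda>w. weight p c w * inner_iter p c w)"
proof (rule square_int_cong_AE[OF _ weighted_inner_eq[OF assms]])
  show "square_int P (weighted_inner p c 1 no_times)"
    using kernelD(2)[OF weighted_inner_kernel[OF assms] undefined_tuple] r by simp
  show "(\<lambda>w. weight p c w * inner_iter p c w) \<in> borel_measurable P"
    by (intro borel_measurable_times square_int_borel weight_props(2) inner_measurable assms)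
qed

lemma full_kernel: "kernel s (Suc r) full_kernel"
  unfolding full_kernel_def using r by (intro kernel_process_factor[OF \<Psi> \<xi> s]) auto

text \<open>The sum is the left Riemann sum of the innermost integral up to the last grid point
  before the upper limit. The Riemann error contributes \<open>s0 * e1\<close>, the missing end
  piece, shorter than \<open>d\<close>, contributes \<open>sqrt (C * d) * B\<close>. Both are
  independent of \<open>x\<close>.\<close>

lemma innermost_bound:
  assumes g: "grid R s T" and mesh: "mesh_less R s T d" and d: "0 < d"
    and mod: "\<forall>x\<in>tuples s (Suc r). \<forall>y\<in>tuples s (Suc r). (\<forall>i\<in>{1..<Suc r}. \<bar>x i - y i\<bar> < d) \<longrightarrow>
      l2dist P (full_kernel x) (full_kernel y) < e1" and e1: "0 < e1"
    and B: "0 \<le> B" "\<forall>x\<in>tuples s (Suc r). l2norm P (full_kernel x) \<le> B"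
    and x: "x \<in> tuples s r"
  shows "l2norm P (\<lambda>w. iter m full_kernel s r r x w
      - (\<Sum>p\<in>{p\<in>pts R s T. next_pt R p \<le> upper r x}. weighted_inner p (next_pt R p) r x w))
    \<le> s0 * e1 + sqrt (C * d) * B"
proof -
  have r1: "1 \<le> r" using r by simp
  define b where "b = upper r x"
  have b: "s \<le> b" "b \<le> T" using upper_bounds[OF x r1 s(2)] by (auto simp: b_def)
  have R: "finite R" "s \<in> R" "T \<in> R" using g by (auto simp: grid_def)
  \<comment> \<open>The cells that end no later than \<open>b\<close> are exactly those that start
    before \<open>b'\<close>.\<close>
  define b' where "b' = floor_pt R b"
  note f = flr_props[OF R(1,2) b(1), folded b'_def]
  define \<phi> where "\<phi> = (\<lambda>u. full_kernel (x(r := u)))"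
  have \<phi>: "ms_uniform s b \<phi>"
    using kernel_ms_uniform[OF full_kernel r1 x s(2)] by (simp add: \<phi>_def b_def)
  then have \<phi>': "ms_uniform s b' \<phi>" by (rule ms_uniform_subset) (use f in auto)
  have up: "x(r := u) \<in> tuples s (Suc r)" if "s \<le> u" "u \<le> b" for u
    using tuples_upd[OF x r1 that(1) _ s(2)] that(2) by (simp add: b_def)
  have g': "grid R s b'" using R f by (simp add: grid_def)
  have set_eq: "{p\<in>pts R s T. next_pt R p \<le> b} = pts R s b'"
  proof (intro set_eqI iffI)
    fix p assume p: "p \<in> {p\<in>pts R s T. next_pt R p \<le> b}"
    then have "p < next_pt R p" "next_pt R p \<in> R" "p \<in> R" "s \<le> p" using pts_bounds[OF g, of p] by auto
    moreover from this have "next_pt R p \<le> b'" using f(4) p by auto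
    ultimately show "p \<in> pts R s b'" by (simp add: pts_def)
  next
    fix p assume p: "p \<in> pts R s b'"
    note pb = pts_bounds[OF g' p]
    show "p \<in> {p\<in>pts R s T. next_pt R p \<le> b}"
      using pb f(2) b by (auto simp: pts_def)
  qed
  have sum_eq: "(\<Sum>p\<in>{p\<in>pts R s T. next_pt R p \<le> upper r x}. weighted_inner p (next_pt R p) r x w)
      = LS (m r) R s b' \<phi> w" for w
  proof -
    \<comment> \<open>At level \<open>r\<close> no integration has been performed yet, so each term
      is its kernel, a single summand of the Riemann sum.\<close>
    have top: "weighted_inner p c r = (\<lambda>z w. weight p c w * \<Psi> (z(r := p)))" for p c
      using iter_top[of m _ c "r - 1"] r by (simp add: weighted_inner_def)
    show ?thesis
      unfolding b_def[symmetric] set_eq LS_def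
      by (intro sum.cong) (simp_all add: top weight_def \<phi>_def full_kernel_def)
  qed
  have it: "iter m full_kernel s r r x = ms_int (m r) s b \<phi>"
    by (simp add: iter_step[of r r] \<phi>_def b_def)
  have bT: "b' \<le> T" using f b by simp
  have sq: "square_int P (ms_int (m r) s b \<phi>)" "square_int P (ms_int (m r) s b' \<phi>)"
    using ms_int_props(3)[OF s(1) b \<phi>] ms_int_props(3)[OF s(1) f(3) bT \<phi>'] by auto
  have sqL: "square_int P (LS (m r) R s b' \<phi>)" by (rule LS_ms_uniform(2)[OF g' s(1) bT \<phi>'])
  have "l2dist P (ms_int (m r) s b \<phi>) (ms_int (m r) s b' \<phi>)
    \<le> sqrt (C * (T - t)) * 0 + sqrt (C * (b - b')) * B"
  proof (rule ms_int_continuity_bound[OF s(1) f(3,2) b(2) \<phi>' \<phi> _ B(1)])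
    fix u assume "b' \<le> u" "u < b"
    then show "l2norm P (\<phi> u) \<le> B" unfolding \<phi>_def using f(3) by (intro B(2)[rule_format] up) auto
  qed (simp_all add: l2norm_zero)
  also have "\<dots> \<le> sqrt (C * d) * B"
  proof -
    have "\<bar>b - b'\<bar> < d" unfolding b'_def using b by (intro floor_close(2)[OF g mesh d]) auto
    then have "C * (b - b') \<le> C * d" using C_bounds by (intro mult_left_mono) auto
    then show ?thesis using B(1) by (simp add: mult_right_mono)
  qed
  finally have 1: "l2dist P (ms_int (m r) s b \<phi>) (ms_int (m r) s b' \<phi>) \<le> sqrt (C * d) * B" .
  have "l2dist P (LS (m r) R s b' \<phi>) (ms_int (m r) s b' \<phi>) \<le> sqrt (C * (b' - s)) * e1"
  proof (rule LS_ms_int_bound[OF g' s(1) bT \<phi>' less_imp_le[OF e1]])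
    fix p u assume p: "p \<in> pts R s b'" "p \<le> u" "u < next_pt R p"
    note pb = pts_bounds[OF g' p(1)]
    have "next_pt R p - p < d" using mesh p(1) pts_mono[of s s b' T R] bT by (auto simp: mesh_less_def)
    then have "\<forall>i\<in>{1..<Suc r}. \<bar>(x(r := p)) i - (x(r := u)) i\<bar> < d" using p d by auto
    moreover have "x(r := p) \<in> tuples s (Suc r)" by (rule up) (use p pb f(2) in auto)
    moreover have "x(r := u) \<in> tuples s (Suc r)" by (rule up) (use p pb f(2) in auto)
    ultimately have "l2dist P (\<phi> p) (\<phi> u) < e1" unfolding \<phi>_def using mod by blast
    then show "l2dist P (\<phi> p) (\<phi> u) \<le> e1" by simp
  qed
  also have "\<dots> \<le> s0 * e1" using e1 s bT by (intro mult_right_mono sqrt_C_le_s0) auto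
  finally have 2: "l2dist P (ms_int (m r) s b' \<phi>) (LS (m r) R s b' \<phi>) \<le> s0 * e1"
    by (simp add: l2norm_minus_commute[of P "ms_int (m r) s b' \<phi>"])
  have "l2dist P (ms_int (m r) s b \<phi>) (LS (m r) R s b' \<phi>) \<le> s0 * e1 + sqrt (C * d) * B"
    using l2norm_triangle_diff[OF sq sqL] 1 2 by linarith
  then show ?thesis unfolding sum_eq it .
qed

text \<open>Downward induction on the level: the error at level \<open>j\<close> is the integral of the error at level \<open>j + 1\<close>.\<close>

lemma level_bound:
  assumes g: "grid R s T" and e: "0 \<le> e"
    and base: "\<And>x. x \<in> tuples s r \<Longrightarrow> l2norm P (\<lambda>w. iter m full_kernel s r r x w
      - (\<Sum>p\<in>{p\<in>pts R s T. next_pt R p \<le> upper r x}. weighted_inner p (next_pt R p) r x w)) \<le> e"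
    and j: "1 \<le> j" "j \<le> r" and x: "x \<in> tuples s j"
  shows "l2norm P (\<lambda>w. iter m full_kernel s r j x w
      - (\<Sum>p\<in>{p\<in>pts R s T. next_pt R p \<le> upper j x}. weighted_inner p (next_pt R p) j x w)) \<le> s0 ^ (r - j) * e"
  using j(2,1) x
proof (induction arbitrary: x rule: inc_induct)
  case base
  then show ?case using assms(3) by simp
next
  case (step n)
  note n = step.hyps(2) step.prems(1) and x = step.prems(2)
  define b where "b = upper n x"
  have b: "s \<le> b" "b \<le> T" using upper_bounds[OF x n(2) s(2)] by (auto simp: b_def)
  define Q where "Q = {p\<in>pts R s T. next_pt R p \<le> b}"
  note pb = pts_bounds[OF g]
  have finQ: "finite Q" using g by (auto simp: Q_def grid_def)
  have Qb: "s \<le> p" "p \<le> next_pt R p" "next_pt R p \<le> b" "next_pt R p \<le> T" "s \<le> next_pt R p" if "p \<in> Q" for p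
    using that pb[of p] b by (auto simp: Q_def)
  let ?V = "\<lambda>u. iter m full_kernel s r (Suc n) (x(n := u))"
  let ?Z = "\<lambda>p u. weighted_inner p (next_pt R p) (Suc n) (x(n := u))"
  have uV: "ms_uniform s b ?V"
    unfolding b_def using n s by (intro kernel_ms_uniform[OF iter_kernel[OF full_kernel s]] x) auto
  have uZ: "ms_uniform (next_pt R p) b (?Z p)" if "p \<in> Q" for p
    unfolding b_def
  proof (rule kernel_ms_uniform)
    show "kernel (next_pt R p) (Suc n) (weighted_inner p (next_pt R p) (Suc n))"
      using Qb[OF that] n by (intro weighted_inner_kernel) auto
    show "x \<in> tuples (next_pt R p) n"
      using tuples_lower[OF x n(2)] Qb[OF that] by (simp add: b_def)
  qed (use n Qb[OF that] in auto)
  \<comment> \<open>\<open>None\<close> stands for the integral from \<open>s\<close> of the exact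
    iterated integral, \<open>Some p\<close> for the integral from \<open>next_pt R p\<close> of the
    term of the cell at \<open>p\<close>, taken with negative sign.\<close>
  let ?I = "insert None (Some ` Q)"
  let ?A = "\<lambda>l. case l of None \<Rightarrow> s | Some p \<Rightarrow> next_pt R p"
  let ?\<phi> = "\<lambda>l. case l of None \<Rightarrow> ?V | Some p \<Rightarrow> ?Z p"
  let ?c = "\<lambda>l. case l of None \<Rightarrow> 1 | Some p \<Rightarrow> (-1 :: real)"
  have sum_I: "(\<Sum>l\<in>insert None (Some ` Q'). h l) = h None + (\<Sum>p\<in>Q'. h (Some p))"
    if "finite Q'" for Q' and h :: "real option \<Rightarrow> real"
    using that by (simp add: sum.reindex)
  have "l2norm P (\<lambda>w. \<Sum>l\<in>?I. ?c l * ms_int (m n) (?A l) b (?\<phi> l) w) \<le> sqrt (C * (b - s)) * (s0 ^ (r - Suc n) * e)"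
  proof (rule ms_int_family_bound[OF _ s(1) b])
    fix u assume u: "s \<le> u" "u < b"
    define Q' where "Q' = {p\<in>Q. next_pt R p \<le> u}"
    \<comment> \<open>At time \<open>u\<close> exactly the cells that have ended by \<open>u\<close>
      are active, so the combined integrand is the error at level \<open>Suc n\<close> with outer
      variable \<open>u\<close>.\<close>
    have I': "{l\<in>?I. ?A l \<le> u \<and> u < b} = insert None (Some ` Q')" using u by (auto simp: Q'_def)
    have Q'_eq: "Q' = {p\<in>pts R s T. next_pt R p \<le> upper (Suc n) (x(n := u))}"
      using u n by (auto simp: Q'_def Q_def)
    have "(\<Sum>l\<in>{l\<in>?I. ?A l \<le> u \<and> u < b}. ?c l * ?\<phi> l u w) = ?V u w - (\<Sum>p\<in>Q'. ?Z p u w)" for w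
      unfolding I' using finQ by (subst sum_I) (auto simp: Q'_def sum_negf)
    moreover have "l2norm P (\<lambda>w. ?V u w - (\<Sum>p\<in>Q'. ?Z p u w)) \<le> s0 ^ (r - Suc n) * e"
      unfolding Q'_eq
    proof (rule step.IH)
      show "x(n := u) \<in> tuples s (Suc n)" by (rule tuples_upd[OF x n(2) u(1) _ s(2)]) (use u in \<open>simp add: b_def\<close>)
    qed simp
    ultimately show "l2norm P (\<lambda>w. \<Sum>l\<in>{l\<in>?I. ?A l \<le> u \<and> u < b}. ?c l * ?\<phi> l u w) \<le> s0 ^ (r - Suc n) * e"
      by simp
  next
    show "0 \<le> s0 ^ (r - Suc n) * e" using e s0_nonneg by simp
  qed (use finQ Qb uV uZ b in \<open>auto split: option.splits\<close>)
  also have "\<dots> \<le> s0 * (s0 ^ (r - Suc n) * e)"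
    using e s0_nonneg s b by (intro mult_right_mono sqrt_C_le_s0) auto
  also have "\<dots> = s0 ^ (r - n) * e"
  proof -
    have "r - n = Suc (r - Suc n)" using n by simp
    then show ?thesis by (simp only: power_Suc mult.assoc)
  qed
  finally have *: "l2norm P (\<lambda>w. \<Sum>l\<in>?I. ?c l * ms_int (m n) (?A l) b (?\<phi> l) w) \<le> s0 ^ (r - n) * e" .
  have "(\<Sum>l\<in>?I. ?c l * ms_int (m n) (?A l) b (?\<phi> l) w) = iter m full_kernel s r n x w
      - (\<Sum>p\<in>Q. weighted_inner p (next_pt R p) n x w)" for w
  proof -
    have "iter m full_kernel s r n x = ms_int (m n) s b ?V"
      using n by (simp add: iter_step b_def)
    moreover have "weighted_inner p (next_pt R p) n x = ms_int (m n) (next_pt R p) b (?Z p)" for p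
      unfolding weighted_inner_def b_def using n by (subst iter_step) auto
    ultimately show ?thesis by (subst sum_I[OF finQ]) (simp add: sum_negf)
  qed
  then show ?case using * by (simp add: Q_def b_def)
qed

lemma reversed_limit:
  assumes "0 < e"
  shows "\<exists>d>0. \<forall>R. grid R s T \<longrightarrow> mesh_less R s T d \<longrightarrow>
    l2norm P (\<lambda>w. (\<Sum>p\<in>pts R s T. weight p (next_pt R p) w * inner_iter p (next_pt R p) w)
      - iter m full_kernel s r 1 no_times w) \<le> e"
proof -
  \<comment> \<open>Error allowed at the innermost level: \<open>r - 1\<close> further integrations
    multiply it by at most \<open>s0 ^ (r - 1)\<close>.\<close>
  define e0 where "e0 = e / (s0 ^ (r - 1) + 1)"
  have sp: "0 \<le> s0 ^ (r - 1)" using s0_nonneg by simp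
  then have e0: "0 < e0" "s0 ^ (r - 1) * e0 \<le> e" using \<open>0 < e\<close> by (auto simp: e0_def field_simps add_nonneg_pos)
  \<comment> \<open>Half of \<open>e0\<close> is spent on the Riemann error and half on the end
    piece.\<close>
  define e1 where "e1 = e0 / (2 * (s0 + 1))"
  have e1: "0 < e1" "s0 * e1 \<le> e0 / 2" using e0(1) s0_nonneg by (auto simp: e1_def field_simps)
  obtain B where B: "0 \<le> B" "\<forall>x\<in>tuples s (Suc r). l2norm P (full_kernel x) \<le> B"
    by (rule kernel_bound[OF full_kernel])
  obtain d1 where d1: "0 < d1" "\<forall>x\<in>tuples s (Suc r). \<forall>y\<in>tuples s (Suc r). (\<forall>i\<in>{1..<Suc r}. \<bar>x i - y i\<bar> < d1) \<longrightarrow>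
      l2dist P (full_kernel x) (full_kernel y) < e1"
    by (rule kernel_modulus[OF full_kernel e1(1)])
  obtain d2 where d2: "0 < d2" "\<And>h. h \<le> d2 \<Longrightarrow> sqrt (C * h) * B \<le> e0 / 2"
    using sqrt_C_small[OF B(1), of "e0 / 2"] e0(1) by (metis half_gt_zero)
  define d where "d = min d1 d2"
  have d: "0 < d" using d1 d2 by (simp add: d_def)
  have mod: "\<forall>x\<in>tuples s (Suc r). \<forall>y\<in>tuples s (Suc r). (\<forall>i\<in>{1..<Suc r}. \<bar>x i - y i\<bar> < d) \<longrightarrow>
      l2dist P (full_kernel x) (full_kernel y) < e1"
    using d1(2) by (simp add: d_def)
  have "l2norm P (\<lambda>w. (\<Sum>p\<in>pts R s T. weight p (next_pt R p) w * inner_iter p (next_pt R p) w)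
      - iter m full_kernel s r 1 no_times w) \<le> e"
    if g: "grid R s T" and mesh: "mesh_less R s T d" for R
  proof -
    note pb = pts_bounds[OF g]
    have fin: "finite (pts R s T)" using g by (simp add: grid_def)
    have base: "l2norm P (\<lambda>w. iter m full_kernel s r r x w
      - (\<Sum>p\<in>{p\<in>pts R s T. next_pt R p \<le> upper r x}. weighted_inner p (next_pt R p) r x w)) \<le> e0"
      if "x \<in> tuples s r" for x
    proof -
      have "s0 * e1 + sqrt (C * d) * B \<le> e0" using e1(2) d2(2)[of d] by (simp add: d_def)
      then show ?thesis using innermost_bound[OF g mesh d mod e1(1) B that] by linarith
    qed
    have "l2norm P (\<lambda>w. iter m full_kernel s r 1 no_times w
      - (\<Sum>p\<in>{p\<in>pts R s T. next_pt R p \<le> upper 1 no_times}. weighted_inner p (next_pt R p) 1 no_times w)) \<le> s0 ^ (r - 1) * e0"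
      using r by (intro level_bound[OF g less_imp_le[OF e0(1)] base _ _ undefined_tuple]) auto
    \<comment> \<open>At the outermost level the upper limit is \<open>T\<close>, so every cell has
      ended.\<close>
    also have "{p\<in>pts R s T. next_pt R p \<le> upper 1 no_times} = pts R s T"
      using pb by (auto simp: upper_def)
    finally have 1: "l2norm P (\<lambda>w. iter m full_kernel s r 1 no_times w
      - (\<Sum>p\<in>pts R s T. weighted_inner p (next_pt R p) 1 no_times w)) \<le> s0 ^ (r - 1) * e0" .
    let ?X = "\<lambda>w. \<Sum>p\<in>pts R s T. weight p (next_pt R p) w * inner_iter p (next_pt R p) w"
    let ?X' = "\<lambda>w. \<Sum>p\<in>pts R s T. weighted_inner p (next_pt R p) 1 no_times w"
    let ?V = "iter m full_kernel s r 1 no_times"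
    have nb: "s \<le> p" "p \<le> next_pt R p" "next_pt R p \<le> T" if "p \<in> pts R s T" for p using pb[OF that] by auto
    have "AE w in P. \<forall>p\<in>pts R s T. weighted_inner p (next_pt R p) 1 no_times w = weight p (next_pt R p) w * inner_iter p (next_pt R p) w"
      using fin weighted_inner_eq[OF nb] by (subst AE_finite_all) auto
    then have ae: "AE w in P. ?V w - ?X w = ?V w - ?X' w" by eventually_elim simp
    have sqV: "square_int P ?V"
      using kernelD(2)[OF iter_kernel[OF full_kernel s] undefined_tuple] by simp
    have sqX: "square_int P ?X" by (intro square_int_sum weight_inner_square_int nb)
    have "kernel (next_pt R p) 1 (weighted_inner p (next_pt R p) 1)" if "p \<in> pts R s T" for p
      using nb[OF that] r by (intro weighted_inner_kernel) auto
    then have sqX': "square_int P ?X'" using kernelD(2)[OF _ undefined_tuple] by (intro square_int_sum) blast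
    have "l2dist P ?V ?X = l2dist P ?V ?X'"
      by (rule l2norm_cong_AE[OF ae square_int_borel[OF square_int_diff[OF sqV sqX]]
          square_int_borel[OF square_int_diff[OF sqV sqX']]])
    then show ?thesis
      unfolding l2norm_minus_commute[of P ?X ?V] using 1 e0(2) by linarith
  qed
  then show ?thesis using d by blast
qed

lemma reversed_ms_lim:
  assumes ps: "partition_seq s T N \<tau>"
  shows "ms_lim P (\<lambda>n w. \<Sum>l<N n. \<xi> (\<tau> n l) w * dI (m r) (\<tau> n l) (\<tau> n (Suc l)) w
      * iter m (\<lambda>z w. \<Psi> (z(r := \<tau> n l))) (\<tau> n (Suc l)) (r - 1) 1 no_times w)
    (iter m (\<lambda>x w. \<Psi> x * \<xi> (x r) w) s r 1 no_times)"
proof -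
  have p: "is_partition s T (N n) (\<tau> n)" for n using ps by (simp add: partition_seq_def)
  define X where "X = (\<lambda>n w. \<Sum>p\<in>pts (\<tau> n ` {..N n}) s T. weight p (next_pt (\<tau> n ` {..N n}) p) w * inner_iter p (next_pt (\<tau> n ` {..N n}) p) w)"
  have X: "(\<lambda>n w. \<Sum>l<N n. \<xi> (\<tau> n l) w * dI (m r) (\<tau> n l) (\<tau> n (Suc l)) w
      * iter m (\<lambda>z w. \<Psi> (z(r := \<tau> n l))) (\<tau> n (Suc l)) (r - 1) 1 no_times w) = X"
    unfolding X_def
    by (intro ext, subst partition_sum[OF p, where f = "\<lambda>p q. weight p q _ * inner_iter p q _", symmetric])
      (simp add: weight_def inner_iter_def)
  show ?thesis
    unfolding X full_kernel_def[symmetric] ms_lim_iff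
  proof (intro conjI allI)
    fix n
    note pb = pts_bounds[OF partition_grid(1)[OF p]]
    show "square_int P (X n)"
      unfolding X_def using pb by (intro square_int_sum weight_inner_square_int) (auto intro: less_imp_le)
  next
    show "square_int P (iter m full_kernel s r 1 no_times)"
      using kernelD(2)[OF iter_kernel[OF full_kernel s] undefined_tuple] by simp
    show "(\<lambda>n. l2dist P (X n) (iter m full_kernel s r 1 no_times)) \<longlonglongrightarrow> 0"
    proof (rule LIMSEQ_I)
      fix e :: real assume "e > 0"
      then obtain d where d: "d > 0" "\<And>R. grid R s T \<Longrightarrow> mesh_less R s T d \<Longrightarrow>
          l2norm P (\<lambda>w. (\<Sum>p\<in>pts R s T. weight p (next_pt R p) w * inner_iter p (next_pt R p) w)
            - iter m full_kernel s r 1 no_times w) \<le> e / 2"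
        using reversed_limit[of "e / 2"] by auto
      obtain n0 where "\<And>n. n \<ge> n0 \<Longrightarrow> mesh (N n) (\<tau> n) < d"
        using partition_seq_mesh[OF ps d(1)] by (auto simp: eventually_sequentially)
      then have "l2dist P (X n) (iter m full_kernel s r 1 no_times) \<le> e / 2" if "n \<ge> n0" for n
        unfolding X_def using that by (intro d(2) partition_grid(1)[OF p] partition_mesh_less(1)[OF p])
      then show "\<exists>n0. \<forall>n\<ge>n0. norm (l2dist P (X n) (iter m full_kernel s r 1 no_times) - 0) < e"
        using \<open>e > 0\<close> by (intro exI[of _ n0]) (force simp: l2norm_nonneg)
    qed
  qed
qed

end

end

section \<open>Uniform continuity on compact sets\<close>

text \<open>Pinning the coordinates outside \<open>J\<close> to \<open>undefined\<close> turns the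
  set of tuples into a full product of compact sets, to which Tychonoff's theorem applies; the order
  relations cut out a closed subset.\<close>

lemma compact_ordered_times: "compact (ordered_times a b J)"
proof -
  let ?S = "\<lambda>i::nat. if i \<in> J then {a..b} else {undefined}"
  have eq: "(J \<rightarrow>\<^sub>E {a..b}) = Pi\<^sub>E UNIV ?S" by (auto simp: PiE_iff extensional_def if_split_mem2)
  have "compactin (product_topology (\<lambda>i. euclidean) UNIV) (Pi\<^sub>E UNIV ?S)"
    unfolding compactin_PiE by simp
  then have "compact (J \<rightarrow>\<^sub>E {a..b})" unfolding eq by (simp add: euclidean_product_topology)
  moreover have "closed {x::nat \<Rightarrow> real. \<forall>i\<in>J. \<forall>j\<in>J. i \<le> j \<longrightarrow> x j \<le> x i}"
  proof -
    have "closed {x::nat \<Rightarrow> real. x j \<le> x i}" for i j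
      by (intro closed_Collect_le continuous_on_product_coordinates)
    then have "closed (\<Inter>i\<in>J. \<Inter>j\<in>{j\<in>J. i \<le> j}. {x::nat \<Rightarrow> real. x j \<le> x i})" by (intro closed_INT ballI)
    moreover have "(\<Inter>i\<in>J. \<Inter>j\<in>{j\<in>J. i \<le> j}. {x::nat \<Rightarrow> real. x j \<le> x i})
      = {x. \<forall>i\<in>J. \<forall>j\<in>J. i \<le> j \<longrightarrow> x j \<le> x i}" by auto
    ultimately show ?thesis by simp
  qed
  ultimately have "compact ((J \<rightarrow>\<^sub>E {a..b}) \<inter> {x. \<forall>i\<in>J. \<forall>j\<in>J. i \<le> j \<longrightarrow> x j \<le> x i})"
    by (rule compact_Int_closed)
  then show ?thesis by (simp add: ordered_times_def Int_def)
qed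

lemma ordered_times_modulus:
  assumes cont: "continuous_on (ordered_times a b J) \<Phi>" and e: "(0::real) < e"
  obtains d where "0 < d" "\<forall>x\<in>ordered_times a b J. \<forall>y\<in>ordered_times a b J.
    (\<forall>i\<in>J. \<bar>x i - y i\<bar> < d) \<longrightarrow> \<bar>\<Phi> x - \<Phi> y\<bar> < e"
proof -
  obtain \<delta> where \<delta>: "0 < \<delta>" "\<And>x y. x \<in> ordered_times a b J \<Longrightarrow> y \<in> ordered_times a b J \<Longrightarrow>
      dist x y < \<delta> \<Longrightarrow> dist (\<Phi> x) (\<Phi> y) < e"
    using compact_uniformly_continuous[OF cont compact_ordered_times] e
    unfolding uniformly_continuous_on_def by (metis dist_commute)
  \<comment> \<open>The metric on functions is at most twice the largest of the first coordinate
    distances plus \<open>(1 / 2) ^ N\<close>; coordinate distances up to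
    \<open>\<delta> / 4\<close> thus keep the total below \<delta>.\<close>
  obtain N where N: "(1 / 2) ^ N < \<delta> / 2"
    using real_arch_pow_inv[of "\<delta> / 2" "1 / 2"] \<delta>(1) by auto
  have "\<bar>\<Phi> x - \<Phi> y\<bar> < e" if x: "x \<in> ordered_times a b J" and y: "y \<in> ordered_times a b J"
    and le: "\<forall>i\<in>J. \<bar>x i - y i\<bar> < \<delta> / 4" for x y
  proof -
    have "dist (x i) (y i) \<le> \<delta> / 4" for i
    proof (cases "i \<in> J")
      case True then show ?thesis using le by (auto simp: dist_real_def less_imp_le)
    next
      case False
      then have "x i = y i" using x y by (auto simp: ordered_times_def PiE_iff extensional_def)
      then show ?thesis using \<delta>(1) by simp
    qed
    then have "Max {dist (x (from_nat n)) (y (from_nat n)) |n. n \<le> N} \<le> \<delta> / 4"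
      by (subst Max_le_iff) auto
    then have "dist x y < \<delta>" using dist_fun_le_dist_first_terms[of x y N] N by linarith
    then show ?thesis using \<delta>(2)[OF x y] by (simp add: dist_real_def)
  qed
  then show thesis using \<delta>(1) by (intro that[of "\<delta> / 4"]) auto
qed

context bounded_martingale_setting
begin

text \<open>Heine-Cantor for the L2 pseudo-distance: a Lebesgue number of the cover by the pointwise
  balls is a uniform modulus, since two close times lie in a common ball and are compared with its
  centre.\<close>

lemma ms_continuous_ms_uniform:
  assumes ad: "\<And>u. u \<in> {a..b} \<Longrightarrow> \<xi> u \<in> borel_measurable (F u)" and ms: "ms_continuous_on P {a..b} \<xi>"
  shows "ms_uniform a b \<xi>"
  unfolding ms_uniform_def
proof (intro conjI ballI allI impI)
  have sq: "\<And>u. u \<in> {a..b} \<Longrightarrow> square_int P (\<xi> u)" using ms by (simp add: ms_continuous_on_def)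
  show "u \<in> {a..b} \<Longrightarrow> \<xi> u \<in> borel_measurable (F u)" "u \<in> {a..b} \<Longrightarrow> square_int P (\<xi> u)" for u
    using ad sq by auto
  fix e :: real assume e: "0 < e"
  have pt: "\<exists>d>0. \<forall>v\<in>{a..b}. \<bar>v - u\<bar> < d \<longrightarrow> l2dist P (\<xi> v) (\<xi> u) < e / 2" if u: "u \<in> {a..b}" for u
  proof -
    have "((\<lambda>v. \<integral>w. (\<xi> v w - \<xi> u w)\<^sup>2 \<partial>P) \<longlongrightarrow> 0) (at u within {a..b})"
      using ms u by (simp add: ms_continuous_on_def)
    from tendsto_real_sqrt[OF this]
    have "((\<lambda>v. l2dist P (\<xi> v) (\<xi> u)) \<longlongrightarrow> 0) (at u within {a..b})" by (simp add: l2norm_def)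
    then obtain d where d: "d > 0" "\<forall>v\<in>{a..b}. 0 < dist v u \<and> dist v u < d \<longrightarrow>
        dist (l2dist P (\<xi> v) (\<xi> u)) 0 < e / 2"
      unfolding Lim_within using e by (metis half_gt_zero)
    have "l2dist P (\<xi> v) (\<xi> u) < e / 2" if "v \<in> {a..b}" "\<bar>v - u\<bar> < d" for v
      using d(2) that e by (cases "v = u") (auto simp: dist_real_def l2norm_zero)
    then show ?thesis using d(1) by blast
  qed
  then obtain D where D: "\<And>u. u \<in> {a..b} \<Longrightarrow> 0 < D u"
    "\<And>u v. u \<in> {a..b} \<Longrightarrow> v \<in> {a..b} \<Longrightarrow> \<bar>v - u\<bar> < D u \<Longrightarrow> l2dist P (\<xi> v) (\<xi> u) < e / 2"
    by metis
  have cover: "{a..b} \<subseteq> \<Union> ((\<lambda>u. ball u (D u)) ` {a..b})" using D(1) by (auto intro!: bexI)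
  obtain d where d: "0 < d" "\<forall>x\<in>{a..b}. \<exists>G\<in>(\<lambda>u. ball u (D u)) ` {a..b}. ball x d \<subseteq> G"
    by (rule Heine_Borel_lemma[OF compact_Icc cover]) auto
  have "l2dist P (\<xi> u) (\<xi> v) < e" if uv: "u \<in> {a..b}" "v \<in> {a..b}" "\<bar>u - v\<bar> < d" for u v
  proof -
    obtain c where c: "c \<in> {a..b}" "ball u d \<subseteq> ball c (D c)" using d(2) uv(1) by blast
    have "u \<in> ball c (D c)" "v \<in> ball c (D c)" using c(2) d(1) uv(3) by (auto simp: dist_real_def subset_eq)
    then have "\<bar>u - c\<bar> < D c" "\<bar>v - c\<bar> < D c" by (auto simp: dist_real_def abs_minus_commute)
    then have "l2dist P (\<xi> u) (\<xi> c) < e / 2" "l2dist P (\<xi> v) (\<xi> c) < e / 2"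
      using D(2)[OF c(1)] uv by auto
    then show ?thesis
      using l2norm_triangle_diff[OF sq[OF uv(1)] sq[OF c(1)] sq[OF uv(2)]]
      by (simp add: l2norm_minus_commute[of P "\<xi> c" "\<xi> v"])
  qed
  then show "\<exists>d>0. \<forall>u\<in>{a..b}. \<forall>v\<in>{a..b}. \<bar>u - v\<bar> < d \<longrightarrow> l2dist P (\<xi> u) (\<xi> v) < e"
    using d(1) by blast
qed

section \<open>Existence and uniqueness of both integrals\<close>

text \<open>Concatenates inner and outer halves of a tuple. Index 0 is taken from \<open>z\<close>,
  where it is \<open>undefined\<close>, and entries of \<open>z\<close> beyond \<open>r\<close> are
  dropped.\<close>

definition join_times :: "nat \<Rightarrow> (nat \<Rightarrow> real) \<Rightarrow> (nat \<Rightarrow> real) \<Rightarrow> nat \<Rightarrow> real" where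
  "join_times r z x = (\<lambda>i. if i \<le> r then z i else x i)"

text \<open>The case \<open>q > r\<close> is needed for \<open>q = k\<close> and
  \<open>r = k - 1\<close>, where the additional variable is the argument of \<xi> and not of
  \<Phi>.\<close>

lemma join_times_mem:
  assumes z: "z \<in> ordered_times s b {1..<Suc q}" and x: "x \<in> ordered_times a s {Suc r..<k}"
    and le: "r \<le> q" "r < k" "a \<le> s" "s \<le> b"
  shows "join_times r z x \<in> ordered_times a b {1..<k}"
proof -
  have z1: "z i \<in> {s..b}" if "1 \<le> i" "i \<le> r" for i
    using z that le by (auto simp: ordered_times_def PiE_iff)
  have z2: "z j \<le> z i" if "1 \<le> i" "i \<le> j" "j \<le> r" for i j
    using z that le by (auto simp: ordered_times_def)
  have z0: "z 0 = undefined" using z by (auto simp: ordered_times_def PiE_iff extensional_def)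
  have x1: "x i \<in> {a..s}" if "r < i" "i < k" for i
    using x that by (auto simp: ordered_times_def PiE_iff)
  have x2: "x j \<le> x i" if "r < i" "i \<le> j" "j < k" for i j
    using x that by (auto simp: ordered_times_def)
  have x0: "x i = undefined" if "k \<le> i" for i
    using x that by (auto simp: ordered_times_def PiE_iff extensional_def)
  show ?thesis
    unfolding ordered_times_def
  proof (intro CollectI conjI ballI impI PiE_I)
    fix i assume "i \<in> {1..<k}"
    then show "join_times r z x i \<in> {a..b}"
      using z1[of i] x1[of i] le by (auto simp: join_times_def)
  next
    fix i assume "i \<notin> {1..<k}"
    then show "join_times r z x i = undefined"
      using z0 x0[of i] le by (cases "i = 0") (auto simp: join_times_def)
  next
    fix i j assume ij: "i \<in> {1..<k}" "j \<in> {1..<k}" "i \<le> j"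
    consider "j \<le> r" | "i \<le> r" "r < j" | "r < i" by linarith
    then show "join_times r z x j \<le> join_times r z x i"
    proof cases
      case 1 then show ?thesis using ij z2[of i j] by (simp add: join_times_def)
    next
      case 2 then show ?thesis using ij z1[of i] x1[of j] by (simp add: join_times_def)
    next
      case 3 then show ?thesis using ij x2[of i j] by (simp add: join_times_def)
    qed
  qed
qed

lemma ordered_times_upd_below:
  assumes x: "x \<in> ordered_times a s {Suc r..<k}" and "s \<le> p" "p \<le> c" "a \<le> s" "r < k"
  shows "x(r := p) \<in> ordered_times a c {r..<k}"
proof -
  have J: "{r..<k} = insert r {Suc r..<k}" using assms(5) by auto
  have x': "x \<in> {Suc r..<k} \<rightarrow>\<^sub>E {a..s}" "\<And>i j. i \<in> {Suc r..<k} \<Longrightarrow> j \<in> {Suc r..<k} \<Longrightarrow> i \<le> j \<Longrightarrow> x j \<le> x i"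
    using x by (auto simp: ordered_times_def)
  then have "x \<in> {Suc r..<k} \<rightarrow>\<^sub>E {a..c}" "\<And>i. i \<in> {Suc r..<k} \<Longrightarrow> x i \<le> p"
    using assms by (force simp: PiE_iff)+
  then show ?thesis
    unfolding ordered_times_def J using x' assms by (auto intro!: PiE_fun_upd)
qed

text \<open>Freezing the innermost integration variable is the same as passing its value to the
  fixed variables; this links the Riemann sums to the recursion for the reversed integrals.\<close>

lemma join_times_upd: "1 \<le> r \<Longrightarrow> join_times r (z(r := p)) x = join_times (r - 1) z (x(r := p))"
  by (auto simp: join_times_def fun_eq_iff)

lemma join_times_upd_above: "r < k \<Longrightarrow> join_times r (z(k := p)) x = join_times r z x"
  by (auto simp: join_times_def fun_eq_iff)

lemma iter_has_int:
  assumes Y: "kernel c (Suc q) Y" and c: "t \<le> c" "c \<le> T" and j: "1 \<le> j" "j \<le> q" and x: "x \<in> tuples c j"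
  shows "has_int P F M \<rho> (m j) c (upper j x) (\<lambda>u. iter m Y c q (Suc j) (x(j := u))) (iter m Y c q j x)"
    and "ms_uniform c (upper j x) (\<lambda>u. iter m Y c q (Suc j) (x(j := u)))"
proof -
  have k: "kernel c (Suc j) (iter m Y c q (Suc j))" using j by (intro iter_kernel[OF Y c]) auto
  show u: "ms_uniform c (upper j x) (\<lambda>u. iter m Y c q (Suc j) (x(j := u)))"
    by (rule kernel_ms_uniform[OF k j(1) x c(2)])
  show "has_int P F M \<rho> (m j) c (upper j x) (\<lambda>u. iter m Y c q (Suc j) (x(j := u))) (iter m Y c q j x)"
    unfolding iter_step[OF j(2)] by (rule has_int_ms_int[OF c(1) upper_bounds[OF x j(1) c(2)] u])
qed

context
  fixes m :: "nat \<Rightarrow> bool" and \<Phi> :: "(nat \<Rightarrow> real) \<Rightarrow> real" and \<xi> :: "real \<Rightarrow> 'a \<Rightarrow> real" and k :: nat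
  assumes \<Phi>: "continuous_on (tuples t k) \<Phi>" and \<xi>: "ms_uniform t T \<xi>" and k: "2 \<le> k"
begin

lemma cont_kernel_join_times:
  assumes x: "x \<in> ordered_times t s {Suc r..<k}" and le: "r \<le> q" "r < k" and s: "t \<le> s" "s \<le> T"
  shows "cont_kernel s (Suc q) (\<lambda>z. \<Phi> (join_times r z x))"
  unfolding cont_kernel_def
proof (intro conjI allI impI)
  note mg = join_times_mem[OF _ x le s]
  have "bounded (\<Phi> ` tuples t k)"
    by (intro compact_imp_bounded compact_continuous_image \<Phi> compact_ordered_times)
  then obtain B where B: "\<forall>x\<in>tuples t k. \<bar>\<Phi> x\<bar> \<le> B" by (auto simp: bounded_iff)
  show "\<exists>B\<ge>0. \<forall>z\<in>tuples s (Suc q). \<bar>\<Phi> (join_times r z x)\<bar> \<le> B"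
  proof (intro exI conjI ballI)
    fix z assume "z \<in> tuples s (Suc q)"
    then show "\<bar>\<Phi> (join_times r z x)\<bar> \<le> max 0 B" using B mg by fastforce
  qed simp
  fix e :: real assume "0 < e"
  obtain d where d: "0 < d" "\<forall>x\<in>tuples t k. \<forall>y\<in>tuples t k. (\<forall>i\<in>{1..<k}. \<bar>x i - y i\<bar> < d) \<longrightarrow> \<bar>\<Phi> x - \<Phi> y\<bar> < e"
    by (rule ordered_times_modulus[OF \<Phi> \<open>0 < e\<close>])
  have "\<bar>\<Phi> (join_times r y x) - \<Phi> (join_times r z x)\<bar> < e"
    if yz: "y \<in> tuples s (Suc q)" "z \<in> tuples s (Suc q)" "\<forall>i\<in>{1..<Suc q}. \<bar>y i - z i\<bar> < d" for y z
  proof -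
    have "\<forall>i\<in>{1..<k}. \<bar>join_times r y x i - join_times r z x i\<bar> < d" using yz(3) le d(1) by (auto simp: join_times_def)
    then show ?thesis using d(2) mg[OF yz(1)] mg[OF yz(2)] by blast
  qed
  then show "\<exists>d>0. \<forall>y\<in>tuples s (Suc q). \<forall>z\<in>tuples s (Suc q). (\<forall>i\<in>{1..<Suc q}. \<bar>y i - z i\<bar> < d) \<longrightarrow>
      \<bar>\<Phi> (join_times r y x) - \<Phi> (join_times r z x)\<bar> < e" using d(1) by blast
qed

text \<open>\<Phi> takes tuples indexed by \<open>{1..<k}\<close>, while the kernel also carries the
  entry \<open>x k\<close>; joining with the empty tuple erases this entry.\<close>

definition S_kernel :: "(nat \<Rightarrow> real) \<Rightarrow> 'a \<Rightarrow> real" where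
  "S_kernel = (\<lambda>x w. \<Phi> (join_times (k - 1) x no_times) * \<xi> (x k) w)"

text \<open>The candidate for the reversed integral over
  \<open>t\<^sub>1, \<dots>, t\<^sub>r\<close> is by definition a forward iterated integral with
  lower limit \<open>s\<close>; that it satisfies the reversed recursion is the content of
  \<open>reversed_step\<close>.\<close>

definition reversed :: "nat \<Rightarrow> real \<Rightarrow> (nat \<Rightarrow> real) \<Rightarrow> 'a \<Rightarrow> real" where
  "reversed r s x = iter m (\<lambda>z w. \<Phi> (join_times r z x)) s r 1 no_times"

lemma undefined_ordered_times: "no_times \<in> ordered_times a b {Suc (k - 1)..<k}"
  using k by (simp add: ordered_times_def)

lemma cont_kernel_full: "cont_kernel t (Suc k) (\<lambda>z. \<Phi> (join_times (k - 1) z no_times))"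
  using k t_less by (intro cont_kernel_join_times[OF undefined_ordered_times]) auto

lemma S_kernel: "kernel t (Suc k) S_kernel"
  unfolding S_kernel_def using t_less k by (intro kernel_process_factor[OF cont_kernel_full \<xi>]) auto

lemma S_kernel_upd:
  assumes "x \<in> tuples t k"
  shows "S_kernel (x(k := u)) = (\<lambda>w. \<Phi> x * \<xi> u w)"
proof -
  have "join_times (k - 1) (x(k := u)) no_times = x"
    using assms k by (auto simp: join_times_def ordered_times_def PiE_iff extensional_def fun_eq_iff)
  then show ?thesis by (simp add: S_kernel_def)
qed

lemma upper_k: "upper k x = x (k - 1)"
  using k by (simp add: upper_def)

lemma has_iterated_integral_iter:
  "has_iterated_integral P F M \<rho> m k t T \<xi> \<Phi> (iter m S_kernel t k 1 no_times)"
  unfolding has_iterated_integral_def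
proof (intro exI[of _ "iter m S_kernel t k"] conjI ballI)
  note I = iter_has_int(1)[OF S_kernel order_refl less_imp_le[OF t_less]]
  fix x assume x: "x \<in> tuples t k"
  show "has_int P F M \<rho> (m k) t (x (k - 1)) (\<lambda>u w. \<Phi> x * \<xi> u w) (iter m S_kernel t k k x)"
    using I[OF _ order_refl x, of m] k by (simp add: S_kernel_upd[OF x] upper_k)
next
  note I = iter_has_int(1)[OF S_kernel order_refl less_imp_le[OF t_less]]
  fix r x assume "r \<in> {1..<k}" "x \<in> tuples t r"
  then show "has_int P F M \<rho> (m r) t (if r = 1 then T else x (r - 1))
      (\<lambda>u. iter m S_kernel t k (Suc r) (x(r := u))) (iter m S_kernel t k r x)"
    using I[of r x m] by (simp add: upper_def)
qed simp

text \<open>Descending induction on the level. For fixed outer variables the chosen integrands agree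
  with the constructed ones almost surely at each time, and \<open>has_int_unique\<close> passes
  this on to the integral.\<close>

lemma has_iterated_integral_unique:
  assumes "has_iterated_integral P F M \<rho> m k t T \<xi> \<Phi> S"
  shows "AE w in P. S w = iter m S_kernel t k 1 no_times w"
proof -
  obtain V :: "nat \<Rightarrow> (nat \<Rightarrow> real) \<Rightarrow> 'a \<Rightarrow> real"
    where V: "\<And>x. x \<in> tuples t k \<Longrightarrow> has_int P F M \<rho> (m k) t (x (k - 1)) (\<lambda>u w. \<Phi> x * \<xi> u w) (V k x)"
      "\<And>r x. r \<in> {1..<k} \<Longrightarrow> x \<in> tuples t r \<Longrightarrow>
         has_int P F M \<rho> (m r) t (if r = 1 then T else x (r - 1)) (\<lambda>u. V (Suc r) (x(r := u))) (V r x)"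
      "S = V 1 no_times"
    using assms unfolding has_iterated_integral_def by blast
  have tT: "t \<le> T" using t_less by simp
  have "AE w in P. V r x w = iter m S_kernel t k r x w" if "1 \<le> r" "r \<le> k" "x \<in> tuples t r" for r x
    using that(2,1,3)
  proof (induction arbitrary: x rule: inc_induct)
    case base
    have k1: "1 \<le> k" using k by simp
    note I = iter_has_int(2)[OF S_kernel order_refl tT k1 order_refl base(2)]
    show ?case
      unfolding iter_step[OF order_refl]
      by (rule has_int_unique[OF order_refl upper_bounds[OF base(2) k1 tT] I])
        (use V(1)[OF base(2)] in \<open>simp_all add: S_kernel_upd[OF base(2)] upper_k\<close>)
  next
    case (step n)
    have n: "n \<le> k" "n \<in> {1..<k}" using step by auto
    note I = iter_has_int(2)[OF S_kernel order_refl tT step.prems(1) n(1) step.prems(2), of m]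
    show ?case
      unfolding iter_step[OF n(1)]
    proof (rule has_int_unique[OF order_refl upper_bounds[OF step.prems(2,1) tT] I])
      fix u assume u: "u \<in> {t..upper n x}"
      have "x(n := u) \<in> tuples t (Suc n)"
        by (rule tuples_upd[OF step.prems(2,1) _ _ tT]) (use u in auto)
      then show "AE w in P. V (Suc n) (x(n := u)) w = iter m S_kernel t k (Suc n) (x(n := u)) w"
        by (rule step.IH[rotated]) simp
    next
      show "has_int P F M \<rho> (m n) t (upper n x) (\<lambda>u. V (Suc n) (x(n := u))) (V n x)"
        using V(2)[OF n(2) step.prems(2)] by (simp add: upper_def)
    qed
  qed
  from this[OF order_refl _ undefined_tuple] show ?thesis using k V(3) by simp
qed

lemma reversed_1:
  assumes s: "s \<in> {t..T}" and x: "x \<in> ordered_times t s {2..<k}"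
  shows "has_int P F M \<rho> (m 1) s T (\<lambda>u w. \<Phi> (x(1 := u))) (reversed 1 s x)"
    and "ms_uniform s T (\<lambda>u w. \<Phi> (x(1 := u)))"
    and "reversed 1 s x = ms_int (m 1) s T (\<lambda>u w. \<Phi> (x(1 := u)))"
proof -
  have s': "t \<le> s" "s \<le> T" using s by auto
  have x': "x \<in> ordered_times t s {Suc 1..<k}" using x by (simp add: numeral_2_eq_2)
  have "cont_kernel s (Suc 1) (\<lambda>z. \<Phi> (join_times 1 z x))"
    using k by (intro cont_kernel_join_times[OF x' _ _ s']) auto
  \<comment> \<open>The constant process 1 turns a deterministic continuous function into a
    kernel.\<close>
  from kernel_process_factor[OF this, of "\<lambda>_ _. 1"] s'
  have kern: "kernel s (Suc 1) (\<lambda>z w. \<Phi> (join_times 1 z x))"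
    by (simp add: ms_uniform_def square_int_const l2norm_zero)
  have mg: "join_times 1 (no_times(1 := u)) x = x(1 := u)" for u
    using x by (auto simp: join_times_def fun_eq_iff ordered_times_def PiE_iff extensional_def)
  have eq: "(\<lambda>u. iter m (\<lambda>z w. \<Phi> (join_times 1 z x)) s 1 (Suc 1) (no_times(1 := u))) = (\<lambda>u w. \<Phi> (x(1 := u)))"
    unfolding iter_top mg ..
  have up: "upper 1 x = T" for x by (simp add: upper_def)
  note I = iter_has_int[OF kern s' order_refl order_refl undefined_tuple, where m = m, unfolded eq up]
  show "has_int P F M \<rho> (m 1) s T (\<lambda>u w. \<Phi> (x(1 := u))) (reversed 1 s x)"
    unfolding reversed_def by (rule I(1))
  show "ms_uniform s T (\<lambda>u w. \<Phi> (x(1 := u)))" by (rule I(2))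
  show "reversed 1 s x = ms_int (m 1) s T (\<lambda>u w. \<Phi> (x(1 := u)))"
    unfolding reversed_def iter_step[OF order_refl] eq up ..
qed

lemma reversed_step:
  assumes r: "r \<in> {2..<k}" and s: "s \<in> {t..T}" and x: "x \<in> ordered_times t s {Suc r..<k}"
    and ps: "partition_seq s T N \<tau>"
  shows "ms_lim P (\<lambda>n w. \<Sum>l<N n. dI (m r) (\<tau> n l) (\<tau> n (Suc l)) w *
      reversed (r - 1) (\<tau> n (Suc l)) (x(r := \<tau> n l)) w) (reversed r s x)"
proof -
  have s': "t \<le> s" "s \<le> T" and r': "2 \<le> r" "1 \<le> r" "r < k" using s r by auto
  have \<Psi>: "cont_kernel s (Suc r) (\<lambda>z. \<Phi> (join_times r z x))"
    by (rule cont_kernel_join_times[OF x order_refl r'(3) s'])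
  have one: "ms_uniform s T (\<lambda>_ _. 1)"
    by (auto simp: ms_uniform_def square_int_const l2norm_zero intro: exI[of _ 1])
  show ?thesis
    using reversed_ms_lim[OF \<Psi> one s' r'(1) ps, of m]
    by (simp add: join_times_upd[OF r'(2)] reversed_def)
qed

lemma reversed_last:
  assumes ps: "partition_seq t T N \<tau>"
  shows "ms_lim P (\<lambda>n w. \<Sum>l<N n. \<xi> (\<tau> n l) w * dI (m k) (\<tau> n l) (\<tau> n (Suc l)) w *
      reversed (k - 1) (\<tau> n (Suc l)) no_times w) (iter m S_kernel t k 1 no_times)"
proof -
  have "k - 1 < k" using k by simp
  then show ?thesis
    using reversed_ms_lim[OF cont_kernel_full \<xi> order_refl less_imp_le[OF t_less] k ps, of m]
    by (simp add: join_times_upd_above reversed_def S_kernel_def)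
qed

lemma has_reversed_integral_iter:
  "has_reversed_integral P F M \<rho> m k t T \<xi> \<Phi> (iter m S_kernel t k 1 no_times)"
  unfolding has_reversed_integral_def
  using reversed_1(1) reversed_step reversed_last
  by (intro exI[of _ reversed]) (simp add: dI_def)

text \<open>Induction on the number of variables already integrated. Along one fixed partition
  sequence each sum contains only finitely many inner integrals, so their exceptional sets together
  are null and both sums have the same limit almost surely.\<close>

lemma has_reversed_integral_unique:
  assumes "has_reversed_integral P F M \<rho> m k t T \<xi> \<Phi> S"
  shows "AE w in P. S w = iter m S_kernel t k 1 no_times w"
proof -
  obtain A :: "nat \<Rightarrow> real \<Rightarrow> (nat \<Rightarrow> real) \<Rightarrow> 'a \<Rightarrow> real"
    where A1: "\<And>s x. s \<in> {t..T} \<Longrightarrow> x \<in> ordered_times t s {2..<k} \<Longrightarrow>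
        has_int P F M \<rho> (m 1) s T (\<lambda>u w. \<Phi> (x(1 := u))) (A 1 s x)"
      and Ar: "\<And>r s x N \<tau>. r \<in> {2..<k} \<Longrightarrow> s \<in> {t..T} \<Longrightarrow> x \<in> ordered_times t s {Suc r..<k} \<Longrightarrow>
        partition_seq s T N \<tau> \<Longrightarrow>
        ms_lim P (\<lambda>n w. \<Sum>l<N n. dI (m r) (\<tau> n l) (\<tau> n (Suc l)) w * A (r - 1) (\<tau> n (Suc l)) (x(r := \<tau> n l)) w) (A r s x)"
      and Ak: "\<And>N \<tau>. partition_seq t T N \<tau> \<Longrightarrow>
        ms_lim P (\<lambda>n w. \<Sum>l<N n. \<xi> (\<tau> n l) w * dI (m k) (\<tau> n l) (\<tau> n (Suc l)) w *
          A (k - 1) (\<tau> n (Suc l)) no_times w) S"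
    using assms unfolding has_reversed_integral_def dI_def[symmetric] by blast
  have range: "\<tau> n l \<in> {s..T}" "\<tau> n (Suc l) \<in> {s..T}" "\<tau> n l \<le> \<tau> n (Suc l)"
    if "partition_seq s T N \<tau>" "l < N n" for s N \<tau> n l
  proof -
    have p: "is_partition s T (N n) (\<tau> n)" using that by (simp add: partition_seq_def)
    show "\<tau> n l \<in> {s..T}" "\<tau> n (Suc l) \<in> {s..T}" "\<tau> n l \<le> \<tau> n (Suc l)"
      using partition_range[OF p, of l] partition_range[OF p, of "Suc l"] partition_mono_le[OF p, of l "Suc l"] that
      by auto
  qed
  have ae: "AE w in P. A r s x w = reversed r s x w"
    if "1 \<le> r" "r < k" "s \<in> {t..T}" "x \<in> ordered_times t s {Suc r..<k}" for r s x
    using that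
  proof (induction r arbitrary: s x rule: nat_induct_at_least)
    case base
    then have x: "x \<in> ordered_times t s {2..<k}" by (simp add: numeral_2_eq_2)
    have s: "t \<le> s" "s \<le> T" using base by auto
    show ?case
      unfolding reversed_1(3)[OF base(2) x]
      by (rule has_int_unique[OF s order_refl reversed_1(2)[OF base(2) x] _ A1[OF base(2) x]]) simp
  next
    case (Suc r)
    have r: "Suc r \<in> {2..<k}" "r < k" using Suc by auto
    have s: "t \<le> s" "s \<le> T" using Suc.prems by auto
    obtain N \<tau> where ps: "partition_seq s T N \<tau>" using partition_seq_exists[OF s(2)] .
    show ?case
    proof (rule ms_lim_unique[OF Ar[OF r(1) Suc.prems(2,3) ps] reversed_step[OF r(1) Suc.prems(2,3) ps]])
      fix n
      have "AE w in P. \<forall>l\<in>{..<N n}. A r (\<tau> n (Suc l)) (x(Suc r := \<tau> n l)) w = reversed r (\<tau> n (Suc l)) (x(Suc r := \<tau> n l)) w"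
      proof (subst AE_finite_all)
        show "\<forall>l\<in>{..<N n}. AE w in P. A r (\<tau> n (Suc l)) (x(Suc r := \<tau> n l)) w = reversed r (\<tau> n (Suc l)) (x(Suc r := \<tau> n l)) w"
        proof
          fix l assume "l \<in> {..<N n}"
          note R = range[OF ps, of l n]
          have "x(Suc r := \<tau> n l) \<in> ordered_times t (\<tau> n (Suc l)) {Suc r..<k}"
            using \<open>l \<in> _\<close> R s r by (intro ordered_times_upd_below[OF Suc.prems(3)]) auto
          then show "AE w in P. A r (\<tau> n (Suc l)) (x(Suc r := \<tau> n l)) w = reversed r (\<tau> n (Suc l)) (x(Suc r := \<tau> n l)) w"
            by (rule Suc.IH[rotated 2]) (use \<open>l \<in> _\<close> R s r in auto)
        qed
      qed simp
      then show "AE w in P. (\<Sum>l<N n. dI (m (Suc r)) (\<tau> n l) (\<tau> n (Suc l)) w * A (Suc r - 1) (\<tau> n (Suc l)) (x(Suc r := \<tau> n l)) w)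
        = (\<Sum>l<N n. dI (m (Suc r)) (\<tau> n l) (\<tau> n (Suc l)) w * reversed (Suc r - 1) (\<tau> n (Suc l)) (x(Suc r := \<tau> n l)) w)"
        by eventually_elim simp
    qed
  qed
  obtain N \<tau> where ps: "partition_seq t T N \<tau>" using partition_seq_exists[OF less_imp_le[OF t_less]] .
  show ?thesis
  proof (rule ms_lim_unique[OF Ak[OF ps] reversed_last[OF ps]])
    fix n
    have "AE w in P. \<forall>l\<in>{..<N n}. A (k - 1) (\<tau> n (Suc l)) no_times w = reversed (k - 1) (\<tau> n (Suc l)) no_times w"
      using range[OF ps, of _ n] k undefined_ordered_times by (subst AE_finite_all) (auto intro!: ae)
    then show "AE w in P. (\<Sum>l<N n. \<xi> (\<tau> n l) w * dI (m k) (\<tau> n l) (\<tau> n (Suc l)) w * A (k - 1) (\<tau> n (Suc l)) no_times w)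
      = (\<Sum>l<N n. \<xi> (\<tau> n l) w * dI (m k) (\<tau> n l) (\<tau> n (Suc l)) w * reversed (k - 1) (\<tau> n (Suc l)) no_times w)"
      by eventually_elim simp
  qed
qed

end

end

theorem theorem6:
  fixes P :: "'a measure" and F :: "real \<Rightarrow> 'a measure"
    and M \<rho> \<xi> :: "real \<Rightarrow> 'a \<Rightarrow> real"
    and \<Phi> :: "(nat \<Rightarrow> real) \<Rightarrow> real"
    and m :: "nat \<Rightarrow> bool" and k :: nat and t T K :: real
  assumes "martingale_setting P F M \<rho> T"
    and "0 \<le> t" and "t < T" and "2 \<le> k"
    and "\<xi> \<in> H2_cont P F \<rho> t T"
    and "continuous_on (ordered_times t T {1..<k}) \<Phi>"
    and "\<forall>\<tau>\<in>{t..T}. AE \<omega> in P. \<bar>\<rho> \<tau> \<omega>\<bar> \<le> K"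
  shows "(\<exists>S'. has_reversed_integral P F M \<rho> m k t T \<xi> \<Phi> S') \<and>
         (\<exists>S. has_iterated_integral P F M \<rho> m k t T \<xi> \<Phi> S) \<and>
         (\<forall>S S'. has_iterated_integral P F M \<rho> m k t T \<xi> \<Phi> S \<longrightarrow>
                 has_reversed_integral P F M \<rho> m k t T \<xi> \<Phi> S' \<longrightarrow>
                 (AE \<omega> in P. S \<omega> = S' \<omega>))"
proof -
  interpret martingale_setting P F M \<rho> T by fact
  interpret bounded_martingale_setting P F M \<rho> T t K
    by unfold_locales (use assms in auto)
  have \<xi>: "ms_uniform t T \<xi>"
    using assms(5) by (intro ms_continuous_ms_uniform) (auto simp: H2_cont_def H2_def)
  note ctx = assms(6) \<xi> assms(4)
  \<comment> \<open>Every version of either integral agrees almost surely with the same variable,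
    the iterated integral of \<open>S_kernel\<close>, which also witnesses both existence
    claims.\<close>
  have "AE \<omega> in P. S \<omega> = S' \<omega>"
    if "has_iterated_integral P F M \<rho> m k t T \<xi> \<Phi> S" "has_reversed_integral P F M \<rho> m k t T \<xi> \<Phi> S'" for S S'
    using has_iterated_integral_unique[OF ctx that(1)] has_reversed_integral_unique[OF ctx that(2)]
    by eventually_elim simp
  then show ?thesis
    using has_reversed_integral_iter[OF ctx, of m] has_iterated_integral_iter[OF ctx, of m] by blast
qed

end
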